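(* Let $\mu,\nu\in\mathcal{P}(\mathcal{X})$ with $\mu\ll\nu$. Assume the cost function $c:\mathcal{X}\times\mathcal{U}\to\mathbb{R}$ is bounded, non-negative and measurable, and assume the predictor is universally stable in total variation in expectation. Let $\gamma^\nu$ be the policy that is optimal for the average cost problem with prior $\nu$, and let $$\|J_\infty^*\|_{sp}:=\sup_{\mu_1\in\mathcal{P}(\mathcal{X})}J_\infty^*(\mu_1)-\inf_{\mu_2\in\mathcal{P}(\mathcal{X})}J_\infty^*(\mu_2).$$ Then $$J_\infty(\mu,\gamma^\nu)-J_\infty^*(\mu)\le\|J_\infty^*\|_{sp}.$$
   Context: Setting (POMDP). $\mathcal{X},\mathcal{Y},\mathcal{U}$ (state, measurement, action spaces) are Polish spaces with their Borel sigma fields; $\mathcal{X}$ is also $\sigma$-compact. $\mathcal{P}(\mathcal{X})$ is the set of Borel probability measures on $\mathcal{X}$. $T(dx'|x,u)$ is a transition kernel from $\mathcal{X}\times\mathcal{U}$ to $\mathcal{X}$, and $Q(dy|x)$ is an observation kernel from $\mathcal{X}$ to $\mathcal{Y}$. An admissible policy $\gamma=\{\gamma_n\}_{n\ge0}$ is a sequence of measurable maps $\gamma_n:\mathcal{Y}^{n+1}\times\mathcal{U}^{n}\to\mathcal{U}$, with actions $U_n=\gamma_n(Y_{[0,n]},U_{[0,n-1]})$ (so each $U_n$ is a function of $Y_{[0,n]}=(Y_0,\dots,Y_n)$); $\Gamma$ is the set of admissible policies. For a prior $\mu\in\mathcal{P}(\mathcal{X})$ and $\gamma\in\Gamma$,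 the strategic measure $P^{\mu,\gamma}$ (expectation $E^{\mu,\gamma}$) is the law of $(X_n,Y_n)_{n\ge0}$ on $\mathcal{X}^{\mathbb{Z}_+}\times\mathcal{Y}^{\mathbb{Z}_+}$ with $P^{\mu,\gamma}((X_0,Y_0)\in A)=\int_A Q(dy|x)\mu(dx)$ and, for $n\ge1$, $P^{\mu,\gamma}((X_n,Y_n)\in A\mid (X,Y)_{[0,n-1]}=(x,y)_{[0,n-1]})=\int_A Q(dy|x)T(dx|x_{n-1},u_{n-1})$, where $u_{n-1}=\gamma_{n-1}(y_{[0,n-1]},u_{[0,n-2]})$. Predictor: $\pi_{n-}^{\mu,\gamma}(\cdot)=P^{\mu,\gamma}(X_n\in\cdot\mid Y_{[0,n-1]})$, $n\ge1$. Filter: $\pi_n^{\mu,\gamma}(\cdot)=P^{\mu,\gamma}(X_n\in\cdot\mid Y_{[0,n]})$, $n\ge0$. Total variation: $\|P-Q\|_{TV}=\sup_{\|f\|_\infty\le1}|\int f\,dP-\int f\,dQ|$ over measurable $f$. The predictor is universally stable in total variation in expectation if for every $\gamma\in\Gamma$ and every $\lambda\in\mathcal{P}(\mathcal{X})$ with $\mu\ll\lambda$, $\lim_{n\to\infty}E^{\mu,\gamma}[\|\pi_{n-}^{\mu,\gamma}-\pi_{n-}^{\lambda,\gamma}\|_{TV}]=0$. Average cost: $J_\infty(\mu,\gamma)=\limsup_{N\to\infty}\frac1N E^{\mu,\gamma}\left[\sum_{i=0}^{N-1}c(X_i,U_i)\right]$ and $J_\infty^*(\mu)=\inf_{\gamma\in\Gamma}J_\infty(\mu,\gamma)$.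 Optimal policies (standing assumption). For each prior $\lambda\in\mathcal{P}(\mathcal{X})$ there is an optimal policy $\gamma^\lambda\in\Gamma$, $J_\infty(\lambda,\gamma^\lambda)=J_\infty^*(\lambda)$, which is a stationary function of the filter: there is a measurable map $\Phi:\mathcal{P}(\mathcal{X})\to\mathcal{U}$, not depending on $\lambda$ or $n$, such that $\gamma_n^\lambda(y_{[0,n]})=\Phi(\pi_n^{\lambda,\gamma^\lambda})$ for all $n\geq 0$, where $\pi_n^{\lambda,\gamma^\lambda}$ is the filter realization given $Y_{[0,n]}=y_{[0,n]}$. In $J_\infty(\mu,\gamma^\nu)$, the policy $\gamma^\nu$ is applied as a map from measurements to actions while the true prior is $\mu$. *)

theory Defs
  imports "HOL-Probability.Probability"
begin

section \<open>Priors, policies, strategic measures\<close>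

text \<open>Borel probability measures. For a Polish space, the sigma-algebra of
  \<^const>\<open>prob_algebra\<close> (generated by the evaluations on Borel sets) is the Borel
  sigma-algebra of the weak topology.\<close>

abbreviation priors :: "'a::topological_space measure set" where
  "priors \<equiv> space (prob_algebra borel)"

type_synonym ('y, 'u) policy = "nat \<Rightarrow> (nat \<Rightarrow> 'y) \<times> (nat \<Rightarrow> 'u) \<Rightarrow> 'u"

definition admissible :: "('y::polish_space, 'u::polish_space) policy set" where
  "admissible = {\<gamma>. \<forall>n. \<gamma> n \<in>
     (\<Pi>\<^sub>M i\<in>{..n}. borel) \<Otimes>\<^sub>M (\<Pi>\<^sub>M i\<in>{..<n}. borel) \<rightarrow>\<^sub>M borel}"

lemma restrict_fundef_cong [fundef_cong]:
  "A = B \<Longrightarrow> (\<And>x. x \<in> B \<Longrightarrow> f x = g x) \<Longrightarrow> restrict f A = restrict g B"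
  by (auto simp: restrict_def)

text \<open>The action at time \<open>n\<close> along the measurement sequence \<open>y\<close>; it depends on
  \<open>y\<close> only through its first \<open>n + 1\<close> entries.\<close>

fun action :: "('y, 'u) policy \<Rightarrow> (nat \<Rightarrow> 'y) \<Rightarrow> nat \<Rightarrow> 'u" where
  "action \<gamma> y n = \<gamma> n (restrict y {..n}, \<lambda>i\<in>{..<n}. action \<gamma> y i)"

declare action.simps [simp del]

text \<open>The law \<open>Q(dy|x) \<rho>(dx)\<close> of a state with law \<open>\<rho>\<close> and its measurement.\<close>

definition joint :: "('x::polish_space \<Rightarrow> 'y::polish_space measure) \<Rightarrow> 'x measure \<Rightarrow> ('x \<times> 'y) measure" where
  "joint Q \<rho> = \<rho> \<bind> (\<lambda>x. Q x \<bind> (\<lambda>y. return borel (x, y)))"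

text \<open>The conditional law of the state-measurement pair at time \<open>n\<close>, given the pairs
  \<open>h 0, \<dots>, h (n - 1)\<close>.\<close>

fun transition ::
  "('x::polish_space \<times> 'u::polish_space \<Rightarrow> 'x measure) \<Rightarrow> ('x \<Rightarrow> 'y::polish_space measure) \<Rightarrow>
   'x measure \<Rightarrow> ('y, 'u) policy \<Rightarrow> nat \<Rightarrow> (nat \<Rightarrow> 'x \<times> 'y) \<Rightarrow> ('x \<times> 'y) measure" where
  "transition T Q \<mu> \<gamma> 0 h = joint Q \<mu>"
| "transition T Q \<mu> \<gamma> (Suc n) h = joint Q (T (fst (h n), action \<gamma> (\<lambda>k. snd (h k)) n))"

text \<open>The Ionescu-Tulcea measure of these kernels, on sequences \<open>\<omega>\<close> with
  \<open>\<omega> n = (X\<^sub>n, Y\<^sub>n)\<close>. See \<open>strategic_measure_0\<close> and \<open>strategic_measure_Suc\<close>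
  below for its defining properties.\<close>

definition strategic_measure ::
  "('x::polish_space \<times> 'u::polish_space \<Rightarrow> 'x measure) \<Rightarrow> ('x \<Rightarrow> 'y::polish_space measure) \<Rightarrow>
   'x measure \<Rightarrow> ('y, 'u) policy \<Rightarrow> (nat \<Rightarrow> 'x \<times> 'y) measure" where
  "strategic_measure T Q \<mu> \<gamma> =
     projective_family.lim UNIV (Ionescu_Tulcea.CI (transition T Q \<mu> \<gamma>) (\<lambda>_. borel)) (\<lambda>_. borel)"

lemma action_cong:
  "(\<And>k. k \<le> n \<Longrightarrow> y k = y' k) \<Longrightarrow> action \<gamma> y n = action \<gamma> y' n"
proof (induction n rule: less_induct)
  case (less n)
  have "restrict y {..n} = restrict y' {..n}"
    by (rule restrict_fundef_cong) (auto simp: less.prems)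
  moreover have "(\<lambda>i\<in>{..<n}. action \<gamma> y i) = (\<lambda>i\<in>{..<n}. action \<gamma> y' i)"
    by (rule restrict_fundef_cong) (auto intro!: less.IH less.prems)
  ultimately show ?case
    by (simp add: action.simps[of _ _ n])
qed

lemma measurable_action:
  fixes \<gamma> :: "('y::polish_space, 'u::polish_space) policy"
  assumes \<gamma>: "\<gamma> \<in> admissible" and Y: "\<And>k. k \<le> n \<Longrightarrow> (\<lambda>w. Y w k) \<in> M \<rightarrow>\<^sub>M borel"
  shows "(\<lambda>w. action \<gamma> (Y w) n) \<in> M \<rightarrow>\<^sub>M borel"
  using Y
proof (induction n rule: less_induct)
  case (less n)
  have "\<gamma> n \<in> (\<Pi>\<^sub>M i\<in>{..n}. borel) \<Otimes>\<^sub>M (\<Pi>\<^sub>M i\<in>{..<n}. borel) \<rightarrow>\<^sub>M borel"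
    using \<gamma> by (simp add: admissible_def)
  moreover have "(\<lambda>w. (restrict (Y w) {..n}, \<lambda>i\<in>{..<n}. action \<gamma> (Y w) i))
      \<in> M \<rightarrow>\<^sub>M (\<Pi>\<^sub>M i\<in>{..n}. borel) \<Otimes>\<^sub>M (\<Pi>\<^sub>M i\<in>{..<n}. borel)"
    by (intro measurable_Pair measurable_restrict less.IH less.prems) auto
  ultimately show ?case
    unfolding action.simps[of _ _ n] by (rule measurable_compose_rev)
qed

lemma measurable_joint:
  fixes Q :: "'x::polish_space \<Rightarrow> 'y::polish_space measure"
  assumes Q [measurable]: "Q \<in> borel \<rightarrow>\<^sub>M prob_algebra borel"
  shows "joint Q \<in> prob_algebra borel \<rightarrow>\<^sub>M prob_algebra borel"
proof -
  have r: "(\<lambda>p. return borel (fst p, snd p)) \<in> (borel :: 'x measure) \<Otimes>\<^sub>M (borel :: 'y measure)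
      \<rightarrow>\<^sub>M prob_algebra borel"
    by (rule measurable_compose[OF _ measurable_return_prob_space]) (simp add: borel_prod)
  have k: "(\<lambda>x. Q x \<bind> (\<lambda>y. return borel (x, y))) \<in> borel \<rightarrow>\<^sub>M prob_algebra (borel :: ('x \<times> 'y) measure)"
    by (rule measurable_bind_prob_space2[OF Q]) (use r in \<open>simp add: split_beta\<close>)
  show ?thesis
    unfolding joint_def by (rule measurable_bind_prob_space[OF measurable_ident k, simplified id_def])
qed

lemma measurable_transition:
  fixes T :: "'x::polish_space \<times> 'u::polish_space \<Rightarrow> 'x measure"
    and Q :: "'x \<Rightarrow> 'y::polish_space measure"
  assumes T: "T \<in> borel \<Otimes>\<^sub>M borel \<rightarrow>\<^sub>M prob_algebra borel"
    and Q: "Q \<in> borel \<rightarrow>\<^sub>M prob_algebra borel"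
    and \<mu>: "\<mu> \<in> priors" and \<gamma>: "\<gamma> \<in> admissible"
  shows "transition T Q \<mu> \<gamma> n \<in> (\<Pi>\<^sub>M i\<in>{0..<n}. borel) \<rightarrow>\<^sub>M prob_algebra borel"
proof (cases n)
  case 0
  have "joint Q \<mu> \<in> priors"
    using measurable_space[OF measurable_joint[OF Q] \<mu>] .
  then have "(\<lambda>h. joint Q \<mu>) \<in> (\<Pi>\<^sub>M i\<in>{0..<n}. borel) \<rightarrow>\<^sub>M prob_algebra borel"
    by (rule measurable_const)
  then show ?thesis
    by (rule back_subst[where P = "\<lambda>f. f \<in> _"]) (use 0 in \<open>auto simp: fun_eq_iff\<close>)
next
  case (Suc m)
  have h: "(\<lambda>h. h k) \<in> (\<Pi>\<^sub>M i\<in>{0..<n}. borel :: ('x \<times> 'y) measure) \<rightarrow>\<^sub>M borel" if "k \<le> m" for k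
    by (rule measurable_component_singleton) (use that Suc in auto)
  have hf: "(\<lambda>h. fst (h m)) \<in> (\<Pi>\<^sub>M i\<in>{0..<n}. borel :: ('x \<times> 'y) measure) \<rightarrow>\<^sub>M borel"
    using h[of m] by (simp add: borel_prod[symmetric])
  have hs: "(\<lambda>h. snd (h k)) \<in> (\<Pi>\<^sub>M i\<in>{0..<n}. borel :: ('x \<times> 'y) measure) \<rightarrow>\<^sub>M borel"
    if "k \<le> m" for k
    using h[OF that] by (simp add: borel_prod[symmetric])
  have "(\<lambda>h. joint Q (T (fst (h m), action \<gamma> (\<lambda>k. snd (h k)) m)))
      \<in> (\<Pi>\<^sub>M i\<in>{0..<n}. borel) \<rightarrow>\<^sub>M prob_algebra borel"
    by (intro measurable_compose[OF _ measurable_joint[OF Q]] measurable_compose[OF _ T]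
        measurable_Pair hf measurable_action[OF \<gamma>] hs)
  then show ?thesis
    by (rule back_subst[where P = "\<lambda>f. f \<in> _"]) (use Suc in \<open>auto simp: fun_eq_iff\<close>)
qed

lemma Ionescu_Tulcea_transition:
  fixes T :: "'x::polish_space \<times> 'u::polish_space \<Rightarrow> 'x measure"
    and Q :: "'x \<Rightarrow> 'y::polish_space measure"
  assumes "T \<in> borel \<Otimes>\<^sub>M borel \<rightarrow>\<^sub>M prob_algebra borel"
    and "Q \<in> borel \<rightarrow>\<^sub>M prob_algebra borel"
    and "\<mu> \<in> priors" and "\<gamma> \<in> admissible"
  shows "Ionescu_Tulcea (transition T Q \<mu> \<gamma>) (\<lambda>_. borel)"
proof (rule Ionescu_Tulcea.intro)
  note tr = measurable_transition[OF assms]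
  show "transition T Q \<mu> \<gamma> i \<in> (\<Pi>\<^sub>M i\<in>{0..<i}. borel) \<rightarrow>\<^sub>M subprob_algebra borel" for i
    by (rule measurable_prob_algebraD[OF tr])
  show "prob_space (transition T Q \<mu> \<gamma> i h)" if "h \<in> space (\<Pi>\<^sub>M i\<in>{0..<i}. borel)" for i h
    using measurable_space[OF tr that] by (simp add: space_prob_algebra)
qed

lemma
  fixes T :: "'x::polish_space \<times> 'u::polish_space \<Rightarrow> 'x measure"
    and Q :: "'x \<Rightarrow> 'y::polish_space measure"
  assumes "T \<in> borel \<Otimes>\<^sub>M borel \<rightarrow>\<^sub>M prob_algebra borel"
    and "Q \<in> borel \<rightarrow>\<^sub>M prob_algebra borel"
    and "\<mu> \<in> priors" and "\<gamma> \<in> admissible"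
  shows prob_space_strategic_measure: "prob_space (strategic_measure T Q \<mu> \<gamma>)"
    and sets_strategic_measure: "sets (strategic_measure T Q \<mu> \<gamma>) = sets (\<Pi>\<^sub>M i\<in>UNIV. borel)"
    and strategic_measure_0: "distr (strategic_measure T Q \<mu> \<gamma>) borel (\<lambda>\<omega>. \<omega> 0) = joint Q \<mu>"
    and strategic_measure_Suc:
      "distr (strategic_measure T Q \<mu> \<gamma>) (\<Pi>\<^sub>M i\<in>{0..<Suc n}. borel) (\<lambda>\<omega>. restrict \<omega> {0..<Suc n}) =
       distr (strategic_measure T Q \<mu> \<gamma>) (\<Pi>\<^sub>M i\<in>{0..<n}. borel) (\<lambda>\<omega>. restrict \<omega> {0..<n}) \<bind>
         (\<lambda>h. distr (transition T Q \<mu> \<gamma> n h) (\<Pi>\<^sub>M i\<in>{0..<Suc n}. borel) (\<lambda>z. h(n := z)))"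
proof -
  interpret IT: Ionescu_Tulcea "transition T Q \<mu> \<gamma>" "\<lambda>_. borel"
    by (rule Ionescu_Tulcea_transition[OF assms])
  have P: "strategic_measure T Q \<mu> \<gamma> = IT.PF.lim"
    by (simp add: strategic_measure_def)
  show sets: "sets (strategic_measure T Q \<mu> \<gamma>) = sets (\<Pi>\<^sub>M i\<in>UNIV. borel)"
    by (simp add: P)
  have CI: "distr (strategic_measure T Q \<mu> \<gamma>) (\<Pi>\<^sub>M i\<in>{0..<n}. borel) (\<lambda>\<omega>. restrict \<omega> {0..<n}) =
      IT.C 0 n (\<lambda>_. undefined)" for n
  proof (rule measure_eqI)
    fix A assume "A \<in> sets (distr (strategic_measure T Q \<mu> \<gamma>) (\<Pi>\<^sub>M i\<in>{0..<n}. borel)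
      (\<lambda>\<omega>. restrict \<omega> {0..<n}))"
    then have A: "A \<in> sets (\<Pi>\<^sub>M i\<in>{0..<n}. (borel :: ('x \<times> 'y) measure))" by simp
    have "prod_emb {0..<n} (\<lambda>_. borel) {0..<n} A = A"
      using sets.sets_into_space[OF A] by (intro prod_emb_id) (simp add: space_PiM)
    then show "emeasure (distr (strategic_measure T Q \<mu> \<gamma>) (\<Pi>\<^sub>M i\<in>{0..<n}. borel)
        (\<lambda>\<omega>. restrict \<omega> {0..<n})) A = emeasure (IT.C 0 n (\<lambda>_. undefined)) A"
      unfolding P by (subst IT.distr_lim) (use A in \<open>auto simp: IT.emeasure_CI[of _ n]\<close>)
  qed (simp add: IT.sets_C)
  have restr: "(\<lambda>\<omega>. restrict \<omega> {0..<n}) \<in> strategic_measure T Q \<mu> \<gamma> \<rightarrow>\<^sub>M (\<Pi>\<^sub>M i\<in>{0..<n}. borel)" for n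
    unfolding measurable_cong_sets[OF sets refl] by (rule measurable_restrict_subset) simp
  show Suc: "distr (strategic_measure T Q \<mu> \<gamma>) (\<Pi>\<^sub>M i\<in>{0..<Suc n}. borel) (\<lambda>\<omega>. restrict \<omega> {0..<Suc n}) =
       distr (strategic_measure T Q \<mu> \<gamma>) (\<Pi>\<^sub>M i\<in>{0..<n}. borel) (\<lambda>\<omega>. restrict \<omega> {0..<n}) \<bind>
         (\<lambda>h. distr (transition T Q \<mu> \<gamma> n h) (\<Pi>\<^sub>M i\<in>{0..<Suc n}. borel) (\<lambda>z. h(n := z)))" for n
    unfolding CI by (simp add: IT.eP_def[abs_def])
  have "prob_space (distr (strategic_measure T Q \<mu> \<gamma>) (\<Pi>\<^sub>M i\<in>{0..<0}. borel) (\<lambda>\<omega>. restrict \<omega> {0..<0}))"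
    unfolding CI by (rule IT.prob_space_C) simp
  then show "prob_space (strategic_measure T Q \<mu> \<gamma>)"
    by (rule prob_space_distrD[OF restr])
  have s: "sets (joint Q \<mu>) = sets borel"
    using measurable_space[OF measurable_joint[OF assms(2)] assms(3)] by (simp add: space_prob_algebra)
  have "distr (strategic_measure T Q \<mu> \<gamma>) borel (\<lambda>\<omega>. \<omega> 0) =
      distr (distr (strategic_measure T Q \<mu> \<gamma>) (\<Pi>\<^sub>M i\<in>{0..<Suc 0}. borel)
        (\<lambda>\<omega>. restrict \<omega> {0..<Suc 0})) borel (\<lambda>h. h 0)"
    by (subst distr_distr[OF measurable_component_singleton restr]) (auto simp: comp_def)
  also have "\<dots> = distr (IT.eP 0 (\<lambda>_. undefined)) borel (\<lambda>h. h 0)"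
    unfolding CI by (simp add: bind_return[OF IT.measurable_eP[of 0, simplified]] space_PiM)
  also have "\<dots> = distr (joint Q \<mu>) borel (\<lambda>z. z)"
    unfolding IT.eP_def
    by (subst distr_distr)
       (auto simp: comp_def s cong: measurable_cong_sets
         intro!: measurable_fun_upd[where J = "{}"] measurable_component_singleton)
  also have "\<dots> = joint Q \<mu>"
    by (rule distr_id2[OF s[symmetric]])
  finally show "distr (strategic_measure T Q \<mu> \<gamma>) borel (\<lambda>\<omega>. \<omega> 0) = joint Q \<mu>" .
qed


section \<open>Filters, predictors, stability\<close>

text \<open>\<open>\<kappa>\<close> is a version of the regular conditional distribution \<open>P(X \<in> \<cdot> | Y)\<close>, as a function
  of the value of \<open>Y\<close>.\<close>

definition is_cond_distr ::
  "'w measure \<Rightarrow> ('w \<Rightarrow> 'x::polish_space) \<Rightarrow> 'h measure \<Rightarrow> ('w \<Rightarrow> 'h) \<Rightarrow> ('h \<Rightarrow> 'x measure) \<Rightarrow> bool" where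
  "is_cond_distr P X H Y \<kappa> \<longleftrightarrow>
     \<kappa> \<in> H \<rightarrow>\<^sub>M prob_algebra borel \<and>
     (\<forall>A\<in>sets borel. AE \<omega> in P.
        measure (\<kappa> (Y \<omega>)) A =
          real_cond_exp P (vimage_algebra (space P) Y H) (\<lambda>\<omega>. indicat_real A (X \<omega>)) \<omega>)"

definition is_filter ::
  "('x::polish_space \<times> 'u::polish_space \<Rightarrow> 'x measure) \<Rightarrow> ('x \<Rightarrow> 'y::polish_space measure) \<Rightarrow>
   'x measure \<Rightarrow> ('y, 'u) policy \<Rightarrow> nat \<Rightarrow> ((nat \<Rightarrow> 'y) \<Rightarrow> 'x measure) \<Rightarrow> bool" where
  "is_filter T Q \<mu> \<gamma> n \<pi> \<longleftrightarrow>
     is_cond_distr (strategic_measure T Q \<mu> \<gamma>) (\<lambda>\<omega>. fst (\<omega> n))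
       (\<Pi>\<^sub>M i\<in>{..n}. borel) (\<lambda>\<omega>. \<lambda>i\<in>{..n}. snd (\<omega> i)) \<pi>"

definition is_predictor ::
  "('x::polish_space \<times> 'u::polish_space \<Rightarrow> 'x measure) \<Rightarrow> ('x \<Rightarrow> 'y::polish_space measure) \<Rightarrow>
   'x measure \<Rightarrow> ('y, 'u) policy \<Rightarrow> nat \<Rightarrow> ((nat \<Rightarrow> 'y) \<Rightarrow> 'x measure) \<Rightarrow> bool" where
  "is_predictor T Q \<mu> \<gamma> n \<pi> \<longleftrightarrow>
     is_cond_distr (strategic_measure T Q \<mu> \<gamma>) (\<lambda>\<omega>. fst (\<omega> n))
       (\<Pi>\<^sub>M i\<in>{..<n}. borel) (\<lambda>\<omega>. \<lambda>i\<in>{..<n}. snd (\<omega> i)) \<pi>"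

definition tv_dist :: "'a::topological_space measure \<Rightarrow> 'a measure \<Rightarrow> real" where
  "tv_dist P P' = (SUP f\<in>{f \<in> borel_measurable borel. \<forall>x. \<bar>f x\<bar> \<le> 1}.
     \<bar>(\<integral>x. f x \<partial>P) - (\<integral>x. f x \<partial>P')\<bar>)"

text \<open>Since \<open>\<mu> \<lless> \<rho>\<close> implies that the strategic measure of \<open>\<mu>\<close> is absolutely continuous with
  respect to that of \<open>\<rho>\<close>, the expectation does not depend on the versions \<open>p\<close>, \<open>q\<close> of the two
  predictors.\<close>

definition predictor_universally_stable ::
  "('x::polish_space \<times> 'u::polish_space \<Rightarrow> 'x measure) \<Rightarrow> ('x \<Rightarrow> 'y::polish_space measure) \<Rightarrow>
   'x measure \<Rightarrow> bool" where
  "predictor_universally_stable T Q \<mu> \<longleftrightarrow>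
     (\<forall>\<gamma>\<in>admissible. \<forall>\<rho>\<in>priors. absolutely_continuous \<rho> \<mu> \<longrightarrow>
       (\<forall>p q. (\<forall>n\<ge>1. is_predictor T Q \<mu> \<gamma> n (p n) \<and> is_predictor T Q \<rho> \<gamma> n (q n)) \<longrightarrow>
         (\<lambda>n. \<integral>\<^sup>+\<omega>. ennreal (tv_dist (p n (\<lambda>i\<in>{..<n}. snd (\<omega> i))) (q n (\<lambda>i\<in>{..<n}. snd (\<omega> i))))
            \<partial>strategic_measure T Q \<mu> \<gamma>) \<longlonglongrightarrow> 0))"


section \<open>Average cost\<close>

definition avg_cost ::
  "('x::polish_space \<times> 'u::polish_space \<Rightarrow> 'x measure) \<Rightarrow> ('x \<Rightarrow> 'y::polish_space measure) \<Rightarrow>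
   ('x \<times> 'u \<Rightarrow> real) \<Rightarrow> 'x measure \<Rightarrow> ('y, 'u) policy \<Rightarrow> ereal" where
  "avg_cost T Q c \<mu> \<gamma> = limsup (\<lambda>N. ereal (1 / real N *
     (\<integral>\<omega>. (\<Sum>i<N. c (fst (\<omega> i), action \<gamma> (\<lambda>k. snd (\<omega> k)) i)) \<partial>strategic_measure T Q \<mu> \<gamma>)))"

definition opt_cost ::
  "('x::polish_space \<times> 'u::polish_space \<Rightarrow> 'x measure) \<Rightarrow> ('x \<Rightarrow> 'y::polish_space measure) \<Rightarrow>
   ('x \<times> 'u \<Rightarrow> real) \<Rightarrow> 'x measure \<Rightarrow> ereal" where
  "opt_cost T Q c \<mu> = (INF \<gamma>\<in>admissible. avg_cost T Q c \<mu> \<gamma>)"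

definition span_opt_cost ::
  "('x::polish_space \<times> 'u::polish_space \<Rightarrow> 'x measure) \<Rightarrow> ('x \<Rightarrow> 'y::polish_space measure) \<Rightarrow>
   ('x \<times> 'u \<Rightarrow> real) \<Rightarrow> ereal" where
  "span_opt_cost T Q c =
     (SUP \<mu>\<in>priors. opt_cost T Q c \<mu>) - (INF \<mu>\<in>priors. opt_cost T Q c \<mu>)"

text \<open>Under the prior \<open>\<rho>\<close>, the actions of \<open>\<gamma>\<close> are \<open>\<Phi>\<close> of the current filter, for some version
  \<open>\<pi>\<close> of the filter process.\<close>

definition filter_feedback ::
  "('x::polish_space \<times> 'u::polish_space \<Rightarrow> 'x measure) \<Rightarrow> ('x \<Rightarrow> 'y::polish_space measure) \<Rightarrow>
   ('x measure \<Rightarrow> 'u) \<Rightarrow> 'x measure \<Rightarrow> ('y, 'u) policy \<Rightarrow> bool" where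
  "filter_feedback T Q \<Phi> \<rho> \<gamma> \<longleftrightarrow>
     (\<exists>\<pi>. \<forall>n. is_filter T Q \<rho> \<gamma> n (\<pi> n) \<and> (\<forall>y. action \<gamma> y n = \<Phi> (\<pi> n (restrict y {..n}))))"

end

theory Submission
  imports Defs
begin

text \<open>Let \<open>J\<^sup>*\<close> be the optimal average cost and \<open>\<gamma>\<close> the policy that is optimal for \<open>\<nu>\<close>. Since
  \<open>J\<^sup>*(\<mu>) \<ge> inf J\<^sup>*\<close>, it suffices that \<open>\<gamma>\<close>, applied under the prior \<open>\<mu>\<close>, has average cost at most
  \<open>sup J\<^sup>*\<close>. Fix \<open>n \<ge> 1\<close> and condition on the measurements \<open>y = y\<^sub>0, \<dots>, y\<^bsub>n-1\<^esub>\<close>. From time \<open>n\<close> on,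
  \<open>\<gamma>\<close> acts as a policy \<open>\<gamma>\<^sup>y\<close> (\<open>continuation\<close>), and the state at time \<open>n\<close> has the law \<open>p(y)\<close>, the
  predictor under \<open>\<mu>\<close>. Hence the cost incurred from time \<open>n\<close> on is the average over \<open>y\<close> of the cost of
  \<open>\<gamma>\<^sup>y\<close> under the prior \<open>p(y)\<close> (\<open>markov_property\<close>). Three observations bound it.

  \<^item> Let \<open>q(y)\<close> be the predictor under \<open>\<nu>\<close>. The cost over \<open>N\<close> steps is the integral over the initial
    state of a function with values in \<open>[0, C N]\<close>, where \<open>C\<close> bounds the one-step cost. Replacing
    \<open>p(y)\<close> by \<open>q(y)\<close> therefore changes the cost per step by at most \<open>C\<close> times their total variation
    distance, uniformly in \<open>N\<close> (\<open>total_cost_le_tv_dist\<close>).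

  \<^item> For \<open>\<nu>\<close>-almost every \<open>y\<close>, hence for \<open>\<mu>\<close>-almost every \<open>y\<close>, the filters of \<open>\<gamma>\<close> under \<open>\<nu>\<close> from time
    \<open>n\<close> on are versions of the filters of \<open>\<gamma>\<^sup>y\<close> under the prior \<open>q(y)\<close>. So \<open>\<gamma>\<^sup>y\<close> applies \<open>\<Phi>\<close> to the
    filter that starts at \<open>q(y)\<close> (\<open>filter_feedback_continuation\<close>). So does the policy that is optimal
    for \<open>q(y)\<close>. The two may use different versions of the filter, but versions agree almost surely,
    so by induction on time both policies generate the same law and the same cost
    (\<open>filter_feedback_total_cost_unique\<close>). The average cost of \<open>\<gamma>\<^sup>y\<close> under \<open>q(y)\<close> is
    therefore \<open>J\<^sup>*(q(y)) \<le> sup J\<^sup>*\<close>.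

  \<^item> The first \<open>n\<close> steps do not affect an average cost, and the reverse Fatou lemma bounds the upper
    limit of an average over \<open>y\<close> by the average of the upper limits (\<open>limsup_mean_cost_restart\<close>).

  Together, the average cost of \<open>\<gamma>\<close> under \<open>\<mu>\<close> is at most \<open>sup J\<^sup>*\<close> plus \<open>C\<close> times the expected total
  variation distance of the two predictors at time \<open>n\<close>, which tends to \<open>0\<close> by stability.

  Stability says something only if predictors exist. The predictor under \<open>\<nu>\<close> is obtained by moving the
  filter, which is part of the assumption on \<open>\<gamma>\<close>, one step ahead (\<open>predictor_of_filter\<close>). The one
  under \<open>\<mu>\<close> is a reweighting of it by a Radon-Nikodym density (\<open>predictor_absolutely_continuous\<close>).

  All computations are done with integrals of nonnegative functions over histories of finite length:
  conditional laws enter through the identity \<open>disintegrates\<close>, and only finite-dimensional marginals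
  of the strategic measure matter.\<close>

section \<open>Disintegrations\<close>

lemma (in prob_space) nn_integral_bind_prob:
  assumes "f \<in> borel_measurable B" and "N \<in> M \<rightarrow>\<^sub>M prob_algebra B"
  shows "(\<integral>\<^sup>+x. f x \<partial>(M \<bind> N)) = (\<integral>\<^sup>+x. \<integral>\<^sup>+y. f y \<partial>N x \<partial>M)"
  by (rule nn_integral_bind[OF assms(1) measurable_prob_algebraD[OF assms(2)]])

lemma nn_integral_kernel_measurable:
  assumes "(\<lambda>(x, y). f x y) \<in> borel_measurable (M \<Otimes>\<^sub>M N)" and "L \<in> M \<rightarrow>\<^sub>M prob_algebra N"
  shows "(\<lambda>x. \<integral>\<^sup>+y. f x y \<partial>L x) \<in> borel_measurable M"
  by (rule nn_integral_measurable_subprob_algebra2[OF assms(1) measurable_prob_algebraD[OF assms(2)]])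

lemma kernel_space:
  assumes "L \<in> M \<rightarrow>\<^sub>M prob_algebra N" and "x \<in> space M"
  shows "prob_space (L x)" and "sets (L x) = sets N" and "space (L x) = space N"
  using measurable_space[OF assms] by (auto simp: space_prob_algebra dest: sets_eq_imp_space_eq)

text \<open>The conditional law of \<open>X\<close> given \<open>Y\<close>, characterised by integrals instead of conditional
  expectations. With the test functions in this generality, the Markov property and changes of
  measure become computations.\<close>

definition disintegrates ::
  "'w measure \<Rightarrow> ('w \<Rightarrow> 'x) \<Rightarrow> 'x measure \<Rightarrow> 'h measure \<Rightarrow> ('w \<Rightarrow> 'h) \<Rightarrow> ('h \<Rightarrow> 'x measure) \<Rightarrow> bool" where
  "disintegrates P X N H Y \<kappa> \<longleftrightarrow> \<kappa> \<in> H \<rightarrow>\<^sub>M prob_algebra N \<and>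
     (\<forall>F\<in>borel_measurable (H \<Otimes>\<^sub>M N).
        (\<integral>\<^sup>+\<omega>. F (Y \<omega>, X \<omega>) \<partial>P) = (\<integral>\<^sup>+\<omega>. \<integral>\<^sup>+x. F (Y \<omega>, x) \<partial>\<kappa> (Y \<omega>) \<partial>P))"

lemma disintegratesD:
  assumes "disintegrates P X N H Y \<kappa>" and "F \<in> borel_measurable (H \<Otimes>\<^sub>M N)"
  shows "(\<integral>\<^sup>+\<omega>. F (Y \<omega>, X \<omega>) \<partial>P) = (\<integral>\<^sup>+\<omega>. \<integral>\<^sup>+x. F (Y \<omega>, x) \<partial>\<kappa> (Y \<omega>) \<partial>P)"
  using assms by (simp add: disintegrates_def)

text \<open>Rectangles form a generator of the product sigma-algebra that is stable under intersections, so the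
  two laws of \<open>(Y, X)\<close> that are compared coincide once they agree on rectangles.\<close>

lemma disintegratesI_rectangles:
  assumes P: "prob_space P" and X [measurable]: "X \<in> P \<rightarrow>\<^sub>M N" and Y [measurable]: "Y \<in> P \<rightarrow>\<^sub>M H"
    and \<kappa> [measurable]: "\<kappa> \<in> H \<rightarrow>\<^sub>M prob_algebra N"
    and rect: "\<And>A B. A \<in> sets N \<Longrightarrow> B \<in> sets H \<Longrightarrow>
      emeasure P {\<omega>\<in>space P. X \<omega> \<in> A \<and> Y \<omega> \<in> B} =
        (\<integral>\<^sup>+\<omega>. emeasure (\<kappa> (Y \<omega>)) A * indicator B (Y \<omega>) \<partial>P)"
  shows "disintegrates P X N H Y \<kappa>"
  unfolding disintegrates_def
proof (intro conjI ballI \<kappa>)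
  interpret P: prob_space P by fact
  fix F :: "_ \<Rightarrow> ennreal" assume F [measurable]: "F \<in> borel_measurable (H \<Otimes>\<^sub>M N)"
  define M1 where "M1 = distr P (H \<Otimes>\<^sub>M N) (\<lambda>\<omega>. (Y \<omega>, X \<omega>))"
  define K where "K \<omega> = distr (\<kappa> (Y \<omega>)) (H \<Otimes>\<^sub>M N) (Pair (Y \<omega>))" for \<omega>
  have K [measurable]: "K \<in> P \<rightarrow>\<^sub>M prob_algebra (H \<Otimes>\<^sub>M N)"
    unfolding K_def by measurable
  have \<kappa>Y: "sets (\<kappa> (Y \<omega>)) = sets N" "space (\<kappa> (Y \<omega>)) = space N" "Y \<omega> \<in> space H" if "\<omega> \<in> space P" for \<omega>
    using kernel_space(2,3)[OF \<kappa> measurable_space[OF Y that]] measurable_space[OF Y that] by auto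
  have M1_rect: "emeasure M1 (B \<times> A) = emeasure P {\<omega>\<in>space P. X \<omega> \<in> A \<and> Y \<omega> \<in> B}"
    if [measurable]: "A \<in> sets N" "B \<in> sets H" for A B
    unfolding M1_def by (subst emeasure_distr) (auto intro!: arg_cong[where f = "emeasure P"])
  have M2_rect: "emeasure (P \<bind> K) (B \<times> A) = (\<integral>\<^sup>+\<omega>. emeasure (\<kappa> (Y \<omega>)) A * indicator B (Y \<omega>) \<partial>P)"
    if [measurable]: "A \<in> sets N" "B \<in> sets H" for A B
  proof -
    have "emeasure (K \<omega>) (B \<times> A) = emeasure (\<kappa> (Y \<omega>)) A * indicator B (Y \<omega>)" if "\<omega> \<in> space P" for \<omega>
    proof -
      have "Pair (Y \<omega>) \<in> \<kappa> (Y \<omega>) \<rightarrow>\<^sub>M H \<Otimes>\<^sub>M N"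
        unfolding measurable_cong_sets[OF \<kappa>Y(1)[OF that] refl] using \<kappa>Y(3)[OF that] by measurable
      moreover have "Pair (Y \<omega>) -` (B \<times> A) \<inter> space (\<kappa> (Y \<omega>)) = (if Y \<omega> \<in> B then A else {})"
        using sets.sets_into_space[OF \<open>A \<in> sets N\<close>] \<kappa>Y[OF that] by auto
      ultimately show ?thesis
        unfolding K_def by (subst emeasure_distr) auto
    qed
    then show ?thesis
      by (subst emeasure_bind[OF P.not_empty measurable_prob_algebraD[OF K]])
         (auto intro!: nn_integral_cong)
  qed
  have "M1 = P \<bind> K"
  proof (rule measure_eqI_generator_eq[where A = "\<lambda>_. space H \<times> space N"
        and E = "{b \<times> a | b a. b \<in> sets H \<and> a \<in> sets N}" and \<Omega> = "space H \<times> space N"])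
    show "Int_stable {b \<times> a | b a. b \<in> sets H \<and> a \<in> sets N}"
      by (rule Int_stable_pair_measure_generator)
    show "{b \<times> a | b a. b \<in> sets H \<and> a \<in> sets N} \<subseteq> Pow (space H \<times> space N)"
      by (auto dest: sets.sets_into_space)
    show "sets M1 = sigma_sets (space H \<times> space N) {b \<times> a | b a. b \<in> sets H \<and> a \<in> sets N}"
      by (simp add: M1_def sets_pair_measure)
    show "sets (P \<bind> K) = sigma_sets (space H \<times> space N) {b \<times> a | b a. b \<in> sets H \<and> a \<in> sets N}"
      by (subst sets_bind[where N = "H \<Otimes>\<^sub>M N"])
         (auto simp: sets_pair_measure K_def P.not_empty)
    show "emeasure M1 (space H \<times> space N) \<noteq> \<infinity>" for i :: nat
      unfolding M1_rect[OF sets.top sets.top] by simp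
  qed (auto simp: M1_rect M2_rect rect)
  have "(\<integral>\<^sup>+\<omega>. F (Y \<omega>, X \<omega>) \<partial>P) = (\<integral>\<^sup>+z. F z \<partial>M1)"
    unfolding M1_def by (subst nn_integral_distr) auto
  also have "\<dots> = (\<integral>\<^sup>+z. F z \<partial>(P \<bind> K))"
    by (simp only: \<open>M1 = P \<bind> K\<close>)
  also have "\<dots> = (\<integral>\<^sup>+\<omega>. \<integral>\<^sup>+x. F (Y \<omega>, x) \<partial>\<kappa> (Y \<omega>) \<partial>P)"
    unfolding P.nn_integral_bind_prob[OF F K]
  proof (rule nn_integral_cong)
    fix \<omega> assume \<omega>: "\<omega> \<in> space P"
    have "Pair (Y \<omega>) \<in> \<kappa> (Y \<omega>) \<rightarrow>\<^sub>M H \<Otimes>\<^sub>M N"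
      unfolding measurable_cong_sets[OF \<kappa>Y(1)[OF \<omega>] refl] using \<kappa>Y(3)[OF \<omega>] by measurable
    then show "(\<integral>\<^sup>+z. F z \<partial>K \<omega>) = (\<integral>\<^sup>+x. F (Y \<omega>, x) \<partial>\<kappa> (Y \<omega>))"
      unfolding K_def by (subst nn_integral_distr) auto
  qed
  finally show "(\<integral>\<^sup>+\<omega>. F (Y \<omega>, X \<omega>) \<partial>P) = (\<integral>\<^sup>+\<omega>. \<integral>\<^sup>+x. F (Y \<omega>, x) \<partial>\<kappa> (Y \<omega>) \<partial>P)" .
qed

text \<open>Every set of the sigma-algebra of \<open>Y\<close> has the form \<open>Y -` B\<close>, so the averaging property that defines
  the conditional expectation of \<open>indicator A (X \<omega>)\<close> is the disintegration identity on \<open>B \<times> A\<close>.\<close>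

lemma is_cond_distr_iff_disintegrates:
  fixes X :: "'w \<Rightarrow> 'x::polish_space"
  assumes P: "prob_space P" and X [measurable]: "X \<in> P \<rightarrow>\<^sub>M borel" and Y [measurable]: "Y \<in> P \<rightarrow>\<^sub>M H"
  shows "is_cond_distr P X H Y \<kappa> \<longleftrightarrow> disintegrates P X borel H Y \<kappa>"
proof -
  interpret P: prob_space P by fact
  define G where "G = vimage_algebra (space P) Y H"
  have YH: "Y \<in> space P \<rightarrow> space H"
    using measurable_space[OF Y] by auto
  have setsG: "sets G = {Y -` B \<inter> space P | B. B \<in> sets H}"
    unfolding G_def by (rule sets_vimage_algebra2[OF YH])
  have spG: "space G = space P"
    by (simp add: G_def)
  have sub: "subalgebra P G"
    unfolding subalgebra_def setsG spG by auto
  interpret sigma_finite_subalgebra P G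
    using sub P.finite_measure_axioms
    by (intro finite_measure_subalgebra_is_sigma_finite)
       (simp add: finite_measure_subalgebra_def finite_measure_subalgebra_axioms_def)
  have YG: "Y \<in> G \<rightarrow>\<^sub>M H"
    unfolding G_def by (rule measurable_vimage_algebra1[OF YH])
  have eqv: "(emeasure P {\<omega>\<in>space P. X \<omega> \<in> A \<and> Y \<omega> \<in> B} =
        (\<integral>\<^sup>+\<omega>. emeasure (\<kappa> (Y \<omega>)) A * indicator B (Y \<omega>) \<partial>P)) \<longleftrightarrow>
      (LINT \<omega>:Y -` B \<inter> space P|P. indicat_real A (X \<omega>)) =
      (LINT \<omega>:Y -` B \<inter> space P|P. measure (\<kappa> (Y \<omega>)) A)"
    if \<kappa> [measurable]: "\<kappa> \<in> H \<rightarrow>\<^sub>M prob_algebra borel" and [measurable]: "A \<in> sets borel" "B \<in> sets H"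
    for A :: "'x set" and B
  proof -
    have le1: "measure (\<kappa> (Y \<omega>)) A \<le> 1" "emeasure (\<kappa> (Y \<omega>)) A = ennreal (measure (\<kappa> (Y \<omega>)) A)"
      if "\<omega> \<in> space P" for \<omega>
    proof -
      interpret K: prob_space "\<kappa> (Y \<omega>)"
        by (rule kernel_space(1)[OF \<kappa> measurable_space[OF Y that]])
      show "measure (\<kappa> (Y \<omega>)) A \<le> 1" "emeasure (\<kappa> (Y \<omega>)) A = ennreal (measure (\<kappa> (Y \<omega>)) A)"
        by (simp_all add: K.emeasure_eq_measure)
    qed
    have m: "(\<lambda>\<omega>. measure (\<kappa> (Y \<omega>)) A) \<in> borel_measurable P" by measurable
    have int: "integrable P (\<lambda>\<omega>. indicator (Y -` B \<inter> space P) \<omega> *\<^sub>R measure (\<kappa> (Y \<omega>)) A)"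
      by (rule P.integrable_const_bound[where B = 1])
         (use le1 m in \<open>auto intro!: AE_I2 split: split_indicator\<close>)
    have "(\<integral>\<^sup>+\<omega>. emeasure (\<kappa> (Y \<omega>)) A * indicator B (Y \<omega>) \<partial>P) =
        (\<integral>\<^sup>+\<omega>. ennreal (indicator (Y -` B \<inter> space P) \<omega> *\<^sub>R measure (\<kappa> (Y \<omega>)) A) \<partial>P)"
      by (rule nn_integral_cong) (auto simp: le1 split: split_indicator)
    also have "\<dots> = ennreal (LINT \<omega>:Y -` B \<inter> space P|P. measure (\<kappa> (Y \<omega>)) A)"
      unfolding set_lebesgue_integral_def
      by (rule nn_integral_eq_integral[OF int]) (auto intro!: AE_I2)
    finally have r: "(\<integral>\<^sup>+\<omega>. emeasure (\<kappa> (Y \<omega>)) A * indicator B (Y \<omega>) \<partial>P) =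
      ennreal (LINT \<omega>:Y -` B \<inter> space P|P. measure (\<kappa> (Y \<omega>)) A)" .
    have "(LINT \<omega>:Y -` B \<inter> space P|P. indicat_real A (X \<omega>)) =
        (LINT \<omega>|P. indicat_real {\<omega>\<in>space P. X \<omega> \<in> A \<and> Y \<omega> \<in> B} \<omega>)"
      unfolding set_lebesgue_integral_def
      by (rule Bochner_Integration.integral_cong) (auto split: split_indicator)
    also have "\<dots> = measure P {\<omega>\<in>space P. X \<omega> \<in> A \<and> Y \<omega> \<in> B}"
      by (simp add: Int_absorb2 subset_eq)
    finally have l: "emeasure P {\<omega>\<in>space P. X \<omega> \<in> A \<and> Y \<omega> \<in> B} =
        ennreal (LINT \<omega>:Y -` B \<inter> space P|P. indicat_real A (X \<omega>))"
      by (simp add: P.emeasure_eq_measure)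
    show ?thesis
      unfolding l r
      by (rule ennreal_inj) (auto simp: set_lebesgue_integral_def intro!: integral_nonneg_AE AE_I2)
  qed
  have iX: "integrable P (\<lambda>\<omega>. indicat_real A (X \<omega>))" if [measurable]: "A \<in> sets borel" for A
    by (rule P.integrable_const_bound[where B = 1]) (auto split: split_indicator)
  show ?thesis
  proof
    assume "is_cond_distr P X H Y \<kappa>"
    then have \<kappa> [measurable]: "\<kappa> \<in> H \<rightarrow>\<^sub>M prob_algebra borel"
      and ae: "\<And>A. A \<in> sets borel \<Longrightarrow> AE \<omega> in P.
        measure (\<kappa> (Y \<omega>)) A = real_cond_exp P G (\<lambda>\<omega>. indicat_real A (X \<omega>)) \<omega>"
      by (auto simp: is_cond_distr_def G_def)
    show "disintegrates P X borel H Y \<kappa>"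
    proof (rule disintegratesI_rectangles[OF P X Y \<kappa>])
      fix A :: "'x set" and B assume A [measurable]: "A \<in> sets borel" and B [measurable]: "B \<in> sets H"
      have "(LINT \<omega>:Y -` B \<inter> space P|P. indicat_real A (X \<omega>)) =
          (LINT \<omega>:Y -` B \<inter> space P|P. real_cond_exp P G (\<lambda>\<omega>. indicat_real A (X \<omega>)) \<omega>)"
        by (rule real_cond_exp_intA[OF iX[OF A]]) (use B setsG in auto)
      also have "\<dots> = (LINT \<omega>:Y -` B \<inter> space P|P. measure (\<kappa> (Y \<omega>)) A)"
        unfolding set_lebesgue_integral_def
        by (rule integral_cong_AE) (use ae[OF A] in auto)
      finally show "emeasure P {\<omega>\<in>space P. X \<omega> \<in> A \<and> Y \<omega> \<in> B} =
          (\<integral>\<^sup>+\<omega>. emeasure (\<kappa> (Y \<omega>)) A * indicator B (Y \<omega>) \<partial>P)"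
        using eqv[OF \<kappa> A B] by blast
    qed
  next
    assume D: "disintegrates P X borel H Y \<kappa>"
    then have \<kappa> [measurable]: "\<kappa> \<in> H \<rightarrow>\<^sub>M prob_algebra borel"
      by (simp add: disintegrates_def)
    show "is_cond_distr P X H Y \<kappa>"
      unfolding is_cond_distr_def G_def[symmetric]
    proof (intro conjI ballI \<kappa>)
      fix A :: "'x set" assume A [measurable]: "A \<in> sets borel"
      have "AE \<omega> in P. real_cond_exp P G (\<lambda>\<omega>. indicat_real A (X \<omega>)) \<omega> = measure (\<kappa> (Y \<omega>)) A"
      proof (rule real_cond_exp_charact[OF _ iX[OF A]])
        fix C assume "C \<in> sets G"
        then obtain B where C: "C = Y -` B \<inter> space P" and B [measurable]: "B \<in> sets H"
          by (auto simp: setsG)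
        have "(\<integral>\<^sup>+\<omega>. indicator A (X \<omega>) * indicator B (Y \<omega>) \<partial>P) =
            (\<integral>\<^sup>+\<omega>. \<integral>\<^sup>+x. indicator A x * indicator B (Y \<omega>) \<partial>\<kappa> (Y \<omega>) \<partial>P)"
          using disintegratesD[OF D, of "\<lambda>(y, x). indicator A x * indicator B y"] by simp
        also have "\<dots> = (\<integral>\<^sup>+\<omega>. emeasure (\<kappa> (Y \<omega>)) A * indicator B (Y \<omega>) \<partial>P)"
          by (intro nn_integral_cong, subst nn_integral_multc)
             (simp_all add: kernel_space(2)[OF \<kappa> measurable_space[OF Y]] borel_measurable_indicator)
        also have "(\<integral>\<^sup>+\<omega>. indicator A (X \<omega>) * indicator B (Y \<omega>) \<partial>P) =
            (\<integral>\<^sup>+\<omega>. indicator {\<omega>\<in>space P. X \<omega> \<in> A \<and> Y \<omega> \<in> B} \<omega> \<partial>P)"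
          by (rule nn_integral_cong) (auto split: split_indicator)
        finally show "(LINT \<omega>:C|P. indicat_real A (X \<omega>)) = (LINT \<omega>:C|P. measure (\<kappa> (Y \<omega>)) A)"
          using eqv[OF \<kappa> A B] by (simp add: C)
      next
        show "integrable P (\<lambda>\<omega>. measure (\<kappa> (Y \<omega>)) A)"
          using prob_space.prob_le_1[OF kernel_space(1)[OF \<kappa> measurable_space[OF Y]]]
          by (intro P.integrable_const_bound[where B = 1]) auto
        show "(\<lambda>\<omega>. measure (\<kappa> (Y \<omega>)) A) \<in> borel_measurable G"
          by (rule measurable_compose[OF YG]) measurable
      qed
      then show "AE \<omega> in P. measure (\<kappa> (Y \<omega>)) A =
          real_cond_exp P G (\<lambda>\<omega>. indicat_real A (X \<omega>)) \<omega>"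
        by eventually_elim simp
    qed
  qed
qed

text \<open>Finite intersections of the members of a countable basis.\<close>

lemma countable_Int_stable_generator_borel:
  obtains E :: "'a::second_countable_topology set set"
  where "countable E" "Int_stable E" "UNIV \<in> E" "sets (borel :: 'a measure) = sigma_sets UNIV E"
proof -
  obtain B :: "'a set set" where B: "countable B" "topological_basis B"
    using ex_countable_basis by auto
  define E where "E = (\<lambda>F. \<Inter>F) ` {F. finite F \<and> F \<subseteq> B}"
  have "countable E"
    unfolding E_def using countable_Collect_finite_subset[OF B(1)]
    by (auto simp: conj_commute intro!: countable_image)
  moreover have "Int_stable E"
    unfolding Int_stable_def E_def
  proof clarify
    fix F G assume "finite F" "F \<subseteq> B" "finite G" "G \<subseteq> B"
    then show "\<Inter>F \<inter> \<Inter>G \<in> Inter ` {F. finite F \<and> F \<subseteq> B}"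
      by (intro image_eqI[where x = "F \<union> G"]) auto
  qed
  moreover have "UNIV \<in> E"
    unfolding E_def by (rule image_eqI[where x = "{}"]) auto
  moreover have "sets (borel :: 'a measure) = sigma_sets UNIV E"
  proof
    have "B \<subseteq> E"
      unfolding E_def by (auto intro!: image_eqI[where x = "{_}"])
    then have "sigma_sets UNIV B \<subseteq> sigma_sets UNIV E"
      by (rule sigma_sets_mono')
    then show "sets (borel :: 'a measure) \<subseteq> sigma_sets UNIV E"
      unfolding borel_eq_countable_basis[OF B] by simp
    have "E \<subseteq> sets borel"
      unfolding E_def using topological_basis_open[OF B(2)] by (auto intro!: borel_open open_Inter)
    then show "sigma_sets UNIV E \<subseteq> sets (borel :: 'a measure)"
      using sets.sigma_sets_subset[of E "borel :: 'a measure"] by simp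
  qed
  ultimately show ?thesis by (rule that)
qed

text \<open>For each single set the two kernels agree outside a null set. A countable generator that is stable
  under intersections makes one null set suffice for all sets, and two probability measures that
  agree on it are equal.\<close>

lemma kernel_AE_unique:
  fixes \<kappa> \<kappa>' :: "'h \<Rightarrow> 'a::second_countable_topology measure"
  assumes M: "prob_space M" and \<kappa> [measurable]: "\<kappa> \<in> M \<rightarrow>\<^sub>M prob_algebra borel"
    and \<kappa>' [measurable]: "\<kappa>' \<in> M \<rightarrow>\<^sub>M prob_algebra borel"
    and eq: "\<And>A C. A \<in> sets borel \<Longrightarrow> C \<in> sets M \<Longrightarrow>
      (\<integral>\<^sup>+h. emeasure (\<kappa> h) A * indicator C h \<partial>M) = (\<integral>\<^sup>+h. emeasure (\<kappa>' h) A * indicator C h \<partial>M)"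
  shows "AE h in M. \<kappa> h = \<kappa>' h"
proof -
  interpret M: prob_space M by fact
  obtain E :: "'a set set" where E: "countable E" "Int_stable E" "UNIV \<in> E"
    "sets (borel :: 'a measure) = sigma_sets UNIV E"
    by (rule countable_Int_stable_generator_borel)
  have "AE h in M. emeasure (\<kappa> h) A = emeasure (\<kappa>' h) A" if "A \<in> E" for A
  proof -
    have [measurable]: "A \<in> sets borel"
      unfolding E(4) using that by (rule sigma_sets.Basic)
    have m: "(\<lambda>h. emeasure (\<kappa> h) A) \<in> borel_measurable M" "(\<lambda>h. emeasure (\<kappa>' h) A) \<in> borel_measurable M"
      using measurable_emeasure_kernel[OF measurable_prob_algebraD[OF \<kappa>]]
        measurable_emeasure_kernel[OF measurable_prob_algebraD[OF \<kappa>']] by auto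
    moreover note m
    moreover have "(\<integral>\<^sup>+h. emeasure (\<kappa> h) A \<partial>M) \<noteq> \<infinity>"
    proof -
      have "(\<integral>\<^sup>+h. emeasure (\<kappa> h) A \<partial>M) \<le> (\<integral>\<^sup>+h. 1 \<partial>M)"
        by (intro nn_integral_mono prob_space.measure_le_1 kernel_space(1)[OF \<kappa>])
      also have "\<dots> < \<infinity>"
        by (simp add: M.emeasure_space_1)
      finally show ?thesis by simp
    qed
    ultimately have "density M (\<lambda>h. emeasure (\<kappa> h) A) = density M (\<lambda>h. emeasure (\<kappa>' h) A) \<longleftrightarrow> ?thesis"
      by (intro M.density_unique_iff)
    moreover have "density M (\<lambda>h. emeasure (\<kappa> h) A) = density M (\<lambda>h. emeasure (\<kappa>' h) A)"
    proof (rule measure_eqI)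
      fix C assume "C \<in> sets (density M (\<lambda>h. emeasure (\<kappa> h) A))"
      then have "C \<in> sets M" by simp
      then show "emeasure (density M (\<lambda>h. emeasure (\<kappa> h) A)) C =
          emeasure (density M (\<lambda>h. emeasure (\<kappa>' h) A)) C"
        using m by (simp add: emeasure_density eq)
    qed simp
    ultimately show ?thesis by blast
  qed
  then have "AE h in M. \<forall>A\<in>E. emeasure (\<kappa> h) A = emeasure (\<kappa>' h) A"
    by (subst AE_ball_countable[OF E(1)]) blast
  then show ?thesis
    using AE_space
  proof eventually_elim
    fix h assume *: "\<forall>A\<in>E. emeasure (\<kappa> h) A = emeasure (\<kappa>' h) A" and h: "h \<in> space M"
    interpret K: prob_space "\<kappa> h"
      by (rule kernel_space(1)[OF \<kappa> h])
    show "\<kappa> h = \<kappa>' h"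
      by (rule measure_eqI_generator_eq[OF E(2), where A = "\<lambda>_. UNIV" and \<Omega> = UNIV])
         (use * E(3,4) kernel_space(2)[OF \<kappa> h] kernel_space(2)[OF \<kappa>' h] in auto)
  qed
qed

text \<open>Versions of a conditional law agree almost surely. This is why it does not matter which version
  of the filter a policy uses.\<close>

lemma disintegrates_AE_unique:
  fixes X :: "'w \<Rightarrow> 'x::second_countable_topology"
  assumes P: "prob_space P" and Y: "Y \<in> P \<rightarrow>\<^sub>M H"
    and 1: "disintegrates P X borel H Y \<kappa>" and 2: "disintegrates P X borel H Y \<kappa>'"
  shows "AE \<omega> in P. \<kappa> (Y \<omega>) = \<kappa>' (Y \<omega>)"
proof -
  note \<kappa> = 1[unfolded disintegrates_def, THEN conjunct1] and \<kappa>' = 2[unfolded disintegrates_def, THEN conjunct1]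
  have int: "(\<integral>\<^sup>+y. emeasure (\<zeta> y) A * indicator C y \<partial>distr P H Y) = (\<integral>\<^sup>+\<omega>. indicator A (X \<omega>) * indicator C (Y \<omega>) \<partial>P)"
    if \<zeta>: "disintegrates P X borel H Y \<zeta>" and A [measurable]: "A \<in> sets borel" and C [measurable]: "C \<in> sets H" for \<zeta> A C
  proof -
    note \<zeta>m = \<zeta>[unfolded disintegrates_def, THEN conjunct1]
    have [measurable]: "(\<lambda>y. emeasure (\<zeta> y) A) \<in> borel_measurable H"
      by (rule measurable_emeasure_kernel[OF measurable_prob_algebraD[OF \<zeta>m] A])
    have "(\<integral>\<^sup>+y. emeasure (\<zeta> y) A * indicator C y \<partial>distr P H Y) = (\<integral>\<^sup>+\<omega>. emeasure (\<zeta> (Y \<omega>)) A * indicator C (Y \<omega>) \<partial>P)"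
      by (rule nn_integral_distr[OF Y]) measurable
    also have "\<dots> = (\<integral>\<^sup>+\<omega>. \<integral>\<^sup>+x. indicator A x * indicator C (Y \<omega>) \<partial>\<zeta> (Y \<omega>) \<partial>P)"
    proof (rule nn_integral_cong)
      fix \<omega> assume "\<omega> \<in> space P"
      then have "sets (\<zeta> (Y \<omega>)) = sets borel"
        using kernel_space(2)[OF \<zeta>m] measurable_space[OF Y] by auto
      then show "emeasure (\<zeta> (Y \<omega>)) A * indicator C (Y \<omega>) = (\<integral>\<^sup>+x. indicator A x * indicator C (Y \<omega>) \<partial>\<zeta> (Y \<omega>))"
        using A by (subst nn_integral_multc) (auto intro!: borel_measurable_indicator)
    qed
    also have "\<dots> = (\<integral>\<^sup>+\<omega>. indicator A (X \<omega>) * indicator C (Y \<omega>) \<partial>P)"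
      using disintegratesD[OF \<zeta>, of "\<lambda>(y, x). indicator A x * indicator C y"] by simp
    finally show ?thesis .
  qed
  have "AE y in distr P H Y. \<kappa> y = \<kappa>' y"
    by (rule kernel_AE_unique[OF prob_space.prob_space_distr[OF P Y]])
       (simp_all add: \<kappa> \<kappa>' int[OF 1] int[OF 2])
  then show ?thesis
    by (rule AE_distrD[OF Y])
qed

lemma disintegrates_distr:
  assumes R: "R \<in> P \<rightarrow>\<^sub>M M" and X: "X \<in> M \<rightarrow>\<^sub>M N" and Y: "Y \<in> M \<rightarrow>\<^sub>M H"
  shows "disintegrates (distr P M R) X N H Y \<kappa> \<longleftrightarrow> disintegrates P (\<lambda>\<omega>. X (R \<omega>)) N H (\<lambda>\<omega>. Y (R \<omega>)) \<kappa>"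
  unfolding disintegrates_def
proof (intro conj_cong ball_cong refl)
  fix F :: "_ \<Rightarrow> ennreal" assume \<kappa>: "\<kappa> \<in> H \<rightarrow>\<^sub>M prob_algebra N" and F [measurable]: "F \<in> borel_measurable (H \<Otimes>\<^sub>M N)"
  have "(\<lambda>h. F (Y h, X h)) \<in> borel_measurable M"
    using X Y by measurable
  then have 1: "(\<integral>\<^sup>+h. F (Y h, X h) \<partial>distr P M R) = (\<integral>\<^sup>+\<omega>. F (Y (R \<omega>), X (R \<omega>)) \<partial>P)"
    using R by (subst nn_integral_distr) auto
  have "(\<lambda>y. \<integral>\<^sup>+x. F (y, x) \<partial>\<kappa> y) \<in> borel_measurable H"
    by (rule nn_integral_kernel_measurable[OF _ \<kappa>]) simp
  then have "(\<lambda>h. \<integral>\<^sup>+x. F (Y h, x) \<partial>\<kappa> (Y h)) \<in> borel_measurable M"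
    by (rule measurable_compose[OF Y])
  then have 2: "(\<integral>\<^sup>+h. \<integral>\<^sup>+x. F (Y h, x) \<partial>\<kappa> (Y h) \<partial>distr P M R) = (\<integral>\<^sup>+\<omega>. \<integral>\<^sup>+x. F (Y (R \<omega>), x) \<partial>\<kappa> (Y (R \<omega>)) \<partial>P)"
    using R by (subst nn_integral_distr) auto
  show "(\<integral>\<^sup>+h. F (Y h, X h) \<partial>distr P M R) = (\<integral>\<^sup>+h. \<integral>\<^sup>+x. F (Y h, x) \<partial>\<kappa> (Y h) \<partial>distr P M R) \<longleftrightarrow>
      (\<integral>\<^sup>+\<omega>. F (Y (R \<omega>), X (R \<omega>)) \<partial>P) = (\<integral>\<^sup>+\<omega>. \<integral>\<^sup>+x. F (Y (R \<omega>), x) \<partial>\<kappa> (Y (R \<omega>)) \<partial>P)"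
    unfolding 1 2 ..
qed

text \<open>Bayes' rule. If \<open>f\<close> is a density of the law of \<open>(Y, X)\<close> under \<open>P\<close> with respect to its law under
  \<open>P'\<close>, then the conditional law under \<open>P\<close> is \<open>f(y, x) \<kappa>(y, dx)\<close> divided by its mass \<open>Z(y)\<close>. In this
  way conditional laws exist under \<open>P\<close> as soon as they exist under \<open>P'\<close>, whatever the space of values
  of \<open>X\<close>. Where \<open>Z(y)\<close> is \<open>0\<close> or infinite, \<open>\<kappa>(y)\<close> itself is used as a default; this concerns only a
  null set of \<open>P\<close>.\<close>

lemma disintegrates_absolutely_continuous:
  assumes P: "prob_space P" and P': "prob_space P'" and sets [measurable_cong]: "sets P = sets P'"
    and ac: "absolutely_continuous P' P"
    and X [measurable]: "X \<in> P' \<rightarrow>\<^sub>M N" and Y [measurable]: "Y \<in> P' \<rightarrow>\<^sub>M H"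
    and dis: "disintegrates P' X N H Y \<kappa>"
  obtains \<kappa>' where "disintegrates P X N H Y \<kappa>'"
proof -
  interpret P: prob_space P by fact
  interpret P': prob_space P' by fact
  note \<kappa> = dis[unfolded disintegrates_def, THEN conjunct1]
  define M where "M = distr P' (H \<Otimes>\<^sub>M N) (\<lambda>\<omega>. (Y \<omega>, X \<omega>))"
  define M1 where "M1 = distr P (H \<Otimes>\<^sub>M N) (\<lambda>\<omega>. (Y \<omega>, X \<omega>))"
  have YX: "(\<lambda>\<omega>. (Y \<omega>, X \<omega>)) \<in> P' \<rightarrow>\<^sub>M H \<Otimes>\<^sub>M N" "(\<lambda>\<omega>. (Y \<omega>, X \<omega>)) \<in> P \<rightarrow>\<^sub>M H \<Otimes>\<^sub>M N"
    by measurable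
  have sp: "space P = space P'"
    using sets by (rule sets_eq_imp_space_eq)
  interpret M: prob_space M
    unfolding M_def by (rule P'.prob_space_distr[OF YX(1)])
  have "absolutely_continuous M M1"
    unfolding absolutely_continuous_def
  proof
    fix A assume "A \<in> null_sets M"
    then have A: "A \<in> sets (H \<Otimes>\<^sub>M N)" and "(\<lambda>\<omega>. (Y \<omega>, X \<omega>)) -` A \<inter> space P' \<in> null_sets P'"
      using YX by (auto simp: M_def null_sets_distr_iff)
    then have "(\<lambda>\<omega>. (Y \<omega>, X \<omega>)) -` A \<inter> space P \<in> null_sets P"
      using ac by (auto simp: absolutely_continuous_def sp)
    then show "A \<in> null_sets M1"
      using A YX by (simp add: M1_def null_sets_distr_iff)
  qed
  moreover have "sets M1 = sets M"
    by (simp add: M_def M1_def)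
  ultimately obtain f where f': "f \<in> borel_measurable M" and M1: "density M f = M1"
    using M.Radon_Nikodym by blast
  have f [measurable]: "f \<in> borel_measurable (H \<Otimes>\<^sub>M N)"
    using f' by (simp add: M_def)
  have change: "(\<integral>\<^sup>+\<omega>. F (Y \<omega>, X \<omega>) \<partial>P) = (\<integral>\<^sup>+\<omega>. \<integral>\<^sup>+x. f (Y \<omega>, x) * F (Y \<omega>, x) \<partial>\<kappa> (Y \<omega>) \<partial>P')"
    if F [measurable]: "F \<in> borel_measurable (H \<Otimes>\<^sub>M N)" for F
  proof -
    have "(\<integral>\<^sup>+\<omega>. F (Y \<omega>, X \<omega>) \<partial>P) = (\<integral>\<^sup>+z. F z \<partial>M1)"
      unfolding M1_def using YX by (subst nn_integral_distr) auto
    also have "\<dots> = (\<integral>\<^sup>+z. f z * F z \<partial>M)"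
      unfolding M1[symmetric] by (rule nn_integral_density[OF f']) (simp add: M_def)
    also have "\<dots> = (\<integral>\<^sup>+\<omega>. f (Y \<omega>, X \<omega>) * F (Y \<omega>, X \<omega>) \<partial>P')"
      unfolding M_def using YX by (subst nn_integral_distr) auto
    also have "\<dots> = (\<integral>\<^sup>+\<omega>. \<integral>\<^sup>+x. f (Y \<omega>, x) * F (Y \<omega>, x) \<partial>\<kappa> (Y \<omega>) \<partial>P')"
      using disintegratesD[OF dis, of "\<lambda>z. f z * F z"] by simp
    finally show ?thesis .
  qed
  define Z where "Z y = (\<integral>\<^sup>+x. f (y, x) \<partial>\<kappa> y)" for y
  have Z [measurable]: "Z \<in> borel_measurable H"
    unfolding Z_def by (rule nn_integral_kernel_measurable[OF _ \<kappa>]) simp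
  define D where "D = {y \<in> space H. 0 < Z y \<and> Z y < \<top>}"
  have D [measurable]: "D \<in> sets H"
    unfolding D_def by measurable
  define \<kappa>' where "\<kappa>' y = (if y \<in> D then density (\<kappa> y) (\<lambda>x. f (y, x) / Z y) else \<kappa> y)" for y
  have fy: "(\<lambda>x. f (y, x)) \<in> borel_measurable (\<kappa> y)" if "y \<in> space H" for y
    using measurable_compose[OF measurable_Pair1'[OF that] f]
    by (simp add: measurable_cong_sets[OF kernel_space(2)[OF \<kappa> that] refl])
  have sets': "sets (\<kappa>' y) = sets N" if "y \<in> space H" for y
    using kernel_space(2)[OF \<kappa> that] by (simp add: \<kappa>'_def)
  have prob': "prob_space (\<kappa>' y)" if y: "y \<in> space H" for y
  proof (cases "y \<in> D")
    case True
    have "emeasure (density (\<kappa> y) (\<lambda>x. f (y, x) / Z y)) (space (\<kappa> y)) = (\<integral>\<^sup>+x. f (y, x) / Z y \<partial>\<kappa> y)"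
      using fy[OF y] by (subst emeasure_density) (auto intro!: nn_integral_cong)
    also have "\<dots> = Z y / Z y"
      unfolding Z_def by (rule nn_integral_divide[OF fy[OF y]])
    also have "\<dots> = 1"
      using True by (intro ennreal_divide_self) (auto simp: D_def)
    finally show ?thesis
      using True by (auto simp: \<kappa>'_def intro!: prob_spaceI)
  qed (use kernel_space(1)[OF \<kappa> y] in \<open>simp add: \<kappa>'_def\<close>)
  have em': "emeasure (\<kappa>' y) A =
      (if y \<in> D then (\<integral>\<^sup>+x. f (y, x) / Z y * indicator A x \<partial>\<kappa> y) else emeasure (\<kappa> y) A)"
    if "y \<in> space H" "A \<in> sets N" for y A
    using that fy[OF that(1)] kernel_space(2)[OF \<kappa> that(1)] by (simp add: \<kappa>'_def emeasure_density)
  have \<kappa>': "\<kappa>' \<in> H \<rightarrow>\<^sub>M prob_algebra N"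
  proof (rule measurable_prob_algebraI[OF prob' measurable_subprob_algebra])
    fix A assume A [measurable]: "A \<in> sets N"
    have "(\<lambda>y. \<integral>\<^sup>+x. f (y, x) / Z y * indicator A x \<partial>\<kappa> y) \<in> borel_measurable H"
      by (rule nn_integral_kernel_measurable[OF _ \<kappa>]) measurable
    moreover have "(\<lambda>y. emeasure (\<kappa> y) A) \<in> borel_measurable H"
      by (rule measurable_emeasure_kernel[OF measurable_prob_algebraD[OF \<kappa>] A])
    ultimately have "(\<lambda>y. if y \<in> D then (\<integral>\<^sup>+x. f (y, x) / Z y * indicator A x \<partial>\<kappa> y) else emeasure (\<kappa> y) A)
        \<in> borel_measurable H"
      by measurable
    then show "(\<lambda>y. emeasure (\<kappa>' y) A) \<in> borel_measurable H"
      by (rule measurable_cong[THEN iffD1, rotated]) (simp add: em'[OF _ A])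
  qed (simp_all add: prob' sets' prob_space_imp_subprob_space)
  have "(\<integral>\<^sup>+\<omega>. F (Y \<omega>, X \<omega>) \<partial>P) = (\<integral>\<^sup>+\<omega>. \<integral>\<^sup>+x. F (Y \<omega>, x) \<partial>\<kappa>' (Y \<omega>) \<partial>P)"
    if F [measurable]: "F \<in> borel_measurable (H \<Otimes>\<^sub>M N)" for F
  proof -
    define g where "g y = (\<integral>\<^sup>+x. F (y, x) \<partial>\<kappa>' y)" for y
    have g [measurable]: "g \<in> borel_measurable H"
      unfolding g_def by (rule nn_integral_kernel_measurable[OF _ \<kappa>']) simp
    have "(\<integral>\<^sup>+\<omega>. Z (Y \<omega>) \<partial>P') = (\<integral>\<^sup>+\<omega>. 1 \<partial>P)"
      using change[of "\<lambda>_. 1"] by (simp add: Z_def)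
    then have "(\<integral>\<^sup>+\<omega>. Z (Y \<omega>) \<partial>P') \<noteq> \<infinity>"
      by (simp add: P.emeasure_space_1)
    then have "AE \<omega> in P'. Z (Y \<omega>) \<noteq> \<infinity>"
      by (intro nn_integral_PInf_AE) measurable
    then have ae: "AE \<omega> in P'. (\<integral>\<^sup>+x. f (Y \<omega>, x) * F (Y \<omega>, x) \<partial>\<kappa> (Y \<omega>)) = (\<integral>\<^sup>+x. f (Y \<omega>, x) * g (Y \<omega>) \<partial>\<kappa> (Y \<omega>))"
      using AE_space
    proof eventually_elim
      fix \<omega> assume fin: "Z (Y \<omega>) \<noteq> \<infinity>" and \<omega>: "\<omega> \<in> space P'"
      define y where "y = Y \<omega>"
      have y: "y \<in> space H"
        using measurable_space[OF Y \<omega>] by (simp add: y_def)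
      have Fy: "(\<lambda>x. F (y, x)) \<in> borel_measurable (\<kappa> y)"
        using measurable_compose[OF measurable_Pair1'[OF y] F]
        by (simp add: measurable_cong_sets[OF kernel_space(2)[OF \<kappa> y] refl])
      have r: "(\<integral>\<^sup>+x. f (y, x) * g y \<partial>\<kappa> y) = Z y * g y"
        unfolding Z_def by (rule nn_integral_multc[OF fy[OF y]])
      have "(\<integral>\<^sup>+x. f (y, x) * F (y, x) \<partial>\<kappa> y) = Z y * g y"
      proof (cases "Z y = 0")
        case True
        then have "AE x in \<kappa> y. f (y, x) = 0"
          using fy[OF y] by (simp add: Z_def nn_integral_0_iff_AE)
        then have "(\<integral>\<^sup>+x. f (y, x) * F (y, x) \<partial>\<kappa> y) = (\<integral>\<^sup>+x. 0 \<partial>\<kappa> y)"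
          by (intro nn_integral_cong_AE) auto
        then show ?thesis using True by simp
      next
        case False
        then have Zy: "0 < Z y" "Z y < \<top>"
          using fin by (auto simp: y_def less_top zero_less_iff_neq_zero)
        then have "y \<in> D"
          using y by (simp add: D_def)
        then have "g y = (\<integral>\<^sup>+x. f (y, x) / Z y * F (y, x) \<partial>\<kappa> y)"
          using fy[OF y] Fy by (simp add: g_def \<kappa>'_def nn_integral_density)
        then have "Z y * g y = (\<integral>\<^sup>+x. Z y * (f (y, x) / Z y * F (y, x)) \<partial>\<kappa> y)"
          using fy[OF y] Fy by (simp add: nn_integral_cmult)
        also have "\<dots> = (\<integral>\<^sup>+x. f (y, x) * F (y, x) \<partial>\<kappa> y)"
        proof (rule nn_integral_cong)
          fix x
          have "Z y * (f (y, x) / Z y) = f (y, x)"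
            using Zy by (simp add: ennreal_times_divide mult.commute[of "Z y"] mult_divide_eq_ennreal)
          then show "Z y * (f (y, x) / Z y * F (y, x)) = f (y, x) * F (y, x)"
            by (simp add: mult.assoc[symmetric])
        qed
        finally show ?thesis by simp
      qed
      then show "(\<integral>\<^sup>+x. f (Y \<omega>, x) * F (Y \<omega>, x) \<partial>\<kappa> (Y \<omega>)) = (\<integral>\<^sup>+x. f (Y \<omega>, x) * g (Y \<omega>) \<partial>\<kappa> (Y \<omega>))"
        using r by (simp add: y_def)
    qed
    have "(\<integral>\<^sup>+\<omega>. F (Y \<omega>, X \<omega>) \<partial>P) = (\<integral>\<^sup>+\<omega>. \<integral>\<^sup>+x. f (Y \<omega>, x) * g (Y \<omega>) \<partial>\<kappa> (Y \<omega>) \<partial>P')"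
      unfolding change[OF F] by (rule nn_integral_cong_AE[OF ae])
    also have "\<dots> = (\<integral>\<^sup>+\<omega>. g (Y \<omega>) \<partial>P)"
      using change[of "\<lambda>z. g (fst z)"] by simp
    finally show ?thesis
      by (simp add: g_def)
  qed
  then have "disintegrates P X N H Y \<kappa>'"
    using \<kappa>' by (simp add: disintegrates_def)
  then show ?thesis by (rule that)
qed

section \<open>Total variation\<close>

text \<open>The function \<open>g / B\<close> has values in \<open>[0, 1]\<close>, so it competes in the supremum that defines the
  distance.\<close>

lemma nn_integral_le_tv_dist:
  fixes g :: "'a::topological_space \<Rightarrow> ennreal"
  assumes p: "p \<in> priors" and q: "q \<in> priors" and g: "g \<in> borel_measurable borel"
    and B: "\<And>x. g x \<le> ennreal B" "0 \<le> B"
  shows "(\<integral>\<^sup>+x. g x \<partial>p) \<le> (\<integral>\<^sup>+x. g x \<partial>q) + ennreal (B * tv_dist p q)"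
proof (cases "B = 0")
  case True
  then show ?thesis using B by (simp add: nn_integral_0_iff_AE)
next
  case False
  then have B0: "B > 0" using B by simp
  interpret p: prob_space p using p by (simp add: space_prob_algebra)
  interpret q: prob_space q using q by (simp add: space_prob_algebra)
  have s [measurable_cong]: "sets p = sets borel" "sets q = sets borel"
    using p q by (auto simp: space_prob_algebra)
  define f where "f x = enn2real (g x) / B" for x
  have f [measurable]: "f \<in> borel_measurable borel"
    unfolding f_def using g by measurable
  have gr: "g x = ennreal (B * f x)" for x
    using le_less_trans[OF B(1)[of x] ennreal_less_top] B0 by (simp add: f_def)
  have f01: "0 \<le> f x" "f x \<le> 1" for x
  proof -
    show "0 \<le> f x" using B0 by (simp add: f_def)
    show "f x \<le> 1"
      using B(1)[of x] B0 enn2real_leI[of B "g x"] by (simp add: f_def)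
  qed
  have bdd: "bdd_above ((\<lambda>f :: 'a \<Rightarrow> real. \<bar>(\<integral>x. f x \<partial>p) - (\<integral>x. f x \<partial>q)\<bar>) `
      {f \<in> borel_measurable borel. \<forall>x. \<bar>f x\<bar> \<le> 1})"
  proof (rule bdd_aboveI[where M = "2 :: real"], safe)
    fix f :: "'a \<Rightarrow> real"
    assume f [measurable]: "f \<in> borel_measurable borel" and "\<forall>x. \<bar>f x\<bar> \<le> 1"
    then have 1: "\<bar>f x\<bar> \<le> 1" for x by simp
    have "integrable p f" "integrable q f"
      by (auto intro!: p.integrable_const_bound[where B = 1] q.integrable_const_bound[where B = 1] simp: 1)
    then have "\<bar>\<integral>x. f x \<partial>p\<bar> \<le> 1" "\<bar>\<integral>x. f x \<partial>q\<bar> \<le> 1"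
      using p.integral_le_const[of "\<lambda>x. \<bar>f x\<bar>" 1] q.integral_le_const[of "\<lambda>x. \<bar>f x\<bar>" 1]
      by (auto simp: 1 intro: order_trans[OF integral_abs_bound])
    then show "\<bar>(\<integral>x. f x \<partial>p) - (\<integral>x. f x \<partial>q)\<bar> \<le> 2" by linarith
  qed
  have int: "integrable p f" "integrable q f"
    by (auto intro!: p.integrable_const_bound[where B = 1] q.integrable_const_bound[where B = 1] simp: f01)
  have "\<bar>(\<integral>x. f x \<partial>p) - (\<integral>x. f x \<partial>q)\<bar> \<le> tv_dist p q"
    unfolding tv_dist_def by (rule cSUP_upper[OF _ bdd]) (auto simp: f01)
  then have "B * (\<integral>x. f x \<partial>p) \<le> B * (\<integral>x. f x \<partial>q) + B * tv_dist p q"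
    using B0 by (simp flip: distrib_left)
  moreover have "(\<integral>\<^sup>+x. g x \<partial>p) = ennreal (B * (\<integral>x. f x \<partial>p))" "(\<integral>\<^sup>+x. g x \<partial>q) = ennreal (B * (\<integral>x. f x \<partial>q))"
    unfolding gr using int B0
    by (auto intro!: nn_integral_eq_integral[THEN trans] AE_I2 simp: f01)
  moreover have "0 \<le> (\<integral>x. f x \<partial>q)" "0 \<le> tv_dist p q"
    using \<open>\<bar>(\<integral>x. f x \<partial>p) - (\<integral>x. f x \<partial>q)\<bar> \<le> tv_dist p q\<close> by (auto simp: f01 intro!: integral_nonneg_AE AE_I2)
  ultimately show ?thesis
    using B0 by (simp flip: ennreal_plus add: ennreal_leI)
qed

section \<open>Laws of finite histories\<close>

abbreviation seqs :: "nat \<Rightarrow> (nat \<Rightarrow> 'a::topological_space) measure" where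
  "seqs m \<equiv> \<Pi>\<^sub>M i\<in>{..<m}. borel"

definition obs :: "nat \<Rightarrow> (nat \<Rightarrow> 'x \<times> 'y) \<Rightarrow> nat \<Rightarrow> 'y" where
  "obs m h = (\<lambda>i\<in>{..<m}. snd (h i))"

lemma measurable_fst_snd_borel:
  "fst \<in> (borel :: ('x::polish_space \<times> 'y::polish_space) measure) \<rightarrow>\<^sub>M borel"
  "snd \<in> (borel :: ('x::polish_space \<times> 'y::polish_space) measure) \<rightarrow>\<^sub>M borel"
  by (simp_all add: borel_prod[symmetric])

lemma measurable_obs:
  assumes "\<And>i. i < m \<Longrightarrow> (\<lambda>\<omega>. h \<omega> i) \<in> M \<rightarrow>\<^sub>M (borel :: ('x::polish_space \<times> 'y::polish_space) measure)"
  shows "(\<lambda>\<omega>. obs m (h \<omega>)) \<in> M \<rightarrow>\<^sub>M seqs m"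
  unfolding obs_def
  by (intro measurable_restrict measurable_compose[OF _ measurable_fst_snd_borel(2)] assms) simp

lemma measurable_obs_seqs [measurable]:
  "m \<le> m' \<Longrightarrow> obs m \<in> (seqs m' :: (nat \<Rightarrow> 'x::polish_space \<times> 'y::polish_space) measure) \<rightarrow>\<^sub>M seqs m"
  by (rule measurable_obs) auto

lemma action_obs:
  assumes "k < m" shows "action \<gamma> (obs m h) k = action \<gamma> (\<lambda>i. snd (h i)) k"
  by (rule action_cong) (use assms in \<open>auto simp: obs_def\<close>)

lemma measurable_append_seq:
  "(\<lambda>(h, z). h(m := z)) \<in> seqs m \<Otimes>\<^sub>M borel \<rightarrow>\<^sub>M seqs (Suc m)"
proof -
  have "(\<lambda>(h, z). h(m := z)) \<in> seqs m \<Otimes>\<^sub>M borel \<rightarrow>\<^sub>M (\<Pi>\<^sub>M i\<in>insert m {..<m}. borel)"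
    by (rule measurable_add_dim)
  then show ?thesis by (simp add: lessThan_Suc)
qed

text \<open>A finite sequence is extended by the constant \<open>undefined\<close>, so it is a point of the Polish space of
  all sequences. This embedding makes the uniqueness of kernels into a second countable space
  available for kernels into histories.\<close>

lemma measurable_seqs_borel:
  "(\<lambda>y. y) \<in> (seqs m :: (nat \<Rightarrow> 'a::polish_space) measure) \<rightarrow>\<^sub>M borel"
proof -
  have "(\<lambda>y. y) \<in> (seqs m :: (nat \<Rightarrow> 'a) measure) \<rightarrow>\<^sub>M (\<Pi>\<^sub>M i\<in>UNIV. borel)"
  proof (rule measurable_PiM_single')
    fix i :: nat
    show "(\<lambda>y. y i) \<in> (seqs m :: (nat \<Rightarrow> 'a) measure) \<rightarrow>\<^sub>M borel"
    proof (cases "i < m")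
      case True
      then show ?thesis by simp
    next
      case False
      have "(\<lambda>y. undefined) \<in> (seqs m :: (nat \<Rightarrow> 'a) measure) \<rightarrow>\<^sub>M borel"
        by simp
      then show ?thesis
        by (rule measurable_cong[THEN iffD1, rotated])
           (use False in \<open>auto simp: space_PiM PiE_def extensional_def\<close>)
    qed
  qed auto
  then show ?thesis
    by (simp add: measurable_cong_sets[OF refl sets_PiM_equal_borel])
qed

text \<open>Joint measurability in the parameter is required of the actions, as functions of the measurements,
  rather than of the policy itself, which also takes the past actions as an argument.\<close>

definition measurable_policy_family ::
  "'p measure \<Rightarrow> ('p \<Rightarrow> ('y::polish_space, 'u::polish_space) policy) \<Rightarrow> bool" where
  "measurable_policy_family N \<gamma> \<longleftrightarrow> (\<forall>p\<in>space N. \<gamma> p \<in> admissible) \<and>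
     (\<forall>k. (\<lambda>(p, y). action (\<gamma> p) y k) \<in> N \<Otimes>\<^sub>M seqs (Suc k) \<rightarrow>\<^sub>M borel)"

lemma measurable_policy_family_const:
  assumes "\<gamma> \<in> admissible" shows "measurable_policy_family N (\<lambda>_. \<gamma>)"
  unfolding measurable_policy_family_def split_beta
  by (intro conjI ballI allI assms measurable_action) auto

locale pomdp =
  fixes T :: "'x::polish_space \<times> 'u::polish_space \<Rightarrow> 'x measure"
    and Q :: "'x \<Rightarrow> 'y::polish_space measure"
  assumes T [measurable]: "T \<in> borel \<Otimes>\<^sub>M borel \<rightarrow>\<^sub>M prob_algebra borel"
    and Q [measurable]: "Q \<in> borel \<rightarrow>\<^sub>M prob_algebra borel"
begin

lemma joint_in_priors: "\<rho> \<in> priors \<Longrightarrow> joint Q \<rho> \<in> priors"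
  using measurable_space[OF measurable_joint[OF Q]] .

lemma nn_integral_joint:
  assumes \<rho>: "\<rho> \<in> priors" and F [measurable]: "F \<in> borel_measurable borel"
  shows "(\<integral>\<^sup>+z. F z \<partial>joint Q \<rho>) = (\<integral>\<^sup>+x. \<integral>\<^sup>+y. F (x, y) \<partial>Q x \<partial>\<rho>)"
proof -
  have r [measurable]: "(\<lambda>(x, y). return borel (x, y)) \<in> borel \<Otimes>\<^sub>M borel
      \<rightarrow>\<^sub>M prob_algebra (borel :: ('x \<times> 'y) measure)"
    unfolding split_beta
    by (rule measurable_compose[OF _ measurable_return_prob_space]) (simp add: borel_prod)
  have k: "(\<lambda>x. Q x \<bind> (\<lambda>y. return borel (x, y))) \<in> borel \<rightarrow>\<^sub>M prob_algebra (borel :: ('x \<times> 'y) measure)"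
    by measurable
  have [measurable_cong]: "sets \<rho> = sets borel" and p: "prob_space \<rho>"
    using \<rho> by (auto simp: space_prob_algebra)
  have "(\<integral>\<^sup>+z. F z \<partial>joint Q \<rho>) = (\<integral>\<^sup>+x. \<integral>\<^sup>+z. F z \<partial>(Q x \<bind> (\<lambda>y. return borel (x, y))) \<partial>\<rho>)"
    unfolding joint_def
    by (rule prob_space.nn_integral_bind_prob[OF p F]) (use k in measurable)
  also have "\<dots> = (\<integral>\<^sup>+x. \<integral>\<^sup>+y. F (x, y) \<partial>Q x \<partial>\<rho>)"
  proof (rule nn_integral_cong)
    fix x
    have Qx [measurable_cong]: "sets (Q x) = sets borel" and pQ: "prob_space (Q x)"
      using kernel_space[OF Q] by auto
    have rx: "(\<lambda>y. return borel (x, y)) \<in> Q x \<rightarrow>\<^sub>M prob_algebra borel"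
      using measurable_compose[OF measurable_Pair1'[of x borel "borel :: 'y measure"] r]
      by (simp add: measurable_cong_sets[OF Qx refl])
    show "(\<integral>\<^sup>+z. F z \<partial>(Q x \<bind> (\<lambda>y. return borel (x, y)))) = (\<integral>\<^sup>+y. F (x, y) \<partial>Q x)"
      unfolding prob_space.nn_integral_bind_prob[OF pQ F rx]
      by (intro nn_integral_cong nn_integral_return) auto
  qed
  finally show ?thesis .
qed

definition law :: "'x measure \<Rightarrow> ('y, 'u) policy \<Rightarrow> nat \<Rightarrow> (nat \<Rightarrow> 'x \<times> 'y) measure" where
  "law \<rho> \<gamma> m = distr (strategic_measure T Q \<rho> \<gamma>) (seqs m) (\<lambda>\<omega>. restrict \<omega> {..<m})"

context
  fixes \<rho> :: "'x measure" and \<gamma> :: "('y, 'u) policy"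
  assumes \<rho>: "\<rho> \<in> priors" and \<gamma>: "\<gamma> \<in> admissible"
begin

lemma measurable_coordinate: "(\<lambda>\<omega>. \<omega> i) \<in> strategic_measure T Q \<rho> \<gamma> \<rightarrow>\<^sub>M borel"
  unfolding measurable_cong_sets[OF sets_strategic_measure[OF T Q \<rho> \<gamma>] refl] by measurable

lemma measurable_restrict_strategic:
  "(\<lambda>\<omega>. restrict \<omega> {..<m}) \<in> strategic_measure T Q \<rho> \<gamma> \<rightarrow>\<^sub>M seqs m"
  by (intro measurable_restrict measurable_coordinate)

lemma law_prob_space: "prob_space (law \<rho> \<gamma> m)"
  unfolding law_def
  by (rule prob_space.prob_space_distr[OF prob_space_strategic_measure[OF T Q \<rho> \<gamma>]
        measurable_restrict_strategic])

lemma sets_law [simp]: "sets (law \<rho> \<gamma> m) = sets (seqs m)"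
  by (simp add: law_def)

lemma space_law: "space (law \<rho> \<gamma> m) = space (seqs m)"
  by (rule sets_eq_imp_space_eq) simp

lemma nn_integral_law:
  assumes "F \<in> borel_measurable (seqs m)"
  shows "(\<integral>\<^sup>+h. F h \<partial>law \<rho> \<gamma> m) = (\<integral>\<^sup>+\<omega>. F (restrict \<omega> {..<m}) \<partial>strategic_measure T Q \<rho> \<gamma>)"
  unfolding law_def by (rule nn_integral_distr[OF measurable_restrict_strategic]) (use assms in simp)

lemma measurable_transition_seqs:
  "transition T Q \<rho> \<gamma> m \<in> seqs m \<rightarrow>\<^sub>M prob_algebra borel"
  using measurable_transition[OF T Q \<rho> \<gamma>] by (simp add: atLeast0LessThan)

lemma law_0: "law \<rho> \<gamma> 0 = return (seqs 0) (\<lambda>_. undefined)"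
proof (rule measure_eqI)
  fix A assume "A \<in> sets (law \<rho> \<gamma> 0)"
  then have "A = {} \<or> A = space (law \<rho> \<gamma> 0)"
    unfolding space_law by (auto simp: PiM_empty space_PiM)
  then show "emeasure (law \<rho> \<gamma> 0) A = emeasure (return (seqs 0) (\<lambda>_. undefined)) A"
    using prob_space.emeasure_space_1[OF law_prob_space[of 0]]
    by (auto simp: space_law)
qed simp

lemma measurable_append_transition:
  "(\<lambda>h. distr (transition T Q \<rho> \<gamma> m h) (seqs (Suc m)) (\<lambda>z. h(m := z))) \<in> seqs m \<rightarrow>\<^sub>M prob_algebra (seqs (Suc m))"
  by (rule measurable_distr_prob_space2[OF measurable_transition_seqs measurable_append_seq])

lemma law_Suc:
  "law \<rho> \<gamma> (Suc m) = law \<rho> \<gamma> m \<bind> (\<lambda>h. distr (transition T Q \<rho> \<gamma> m h) (seqs (Suc m)) (\<lambda>z. h(m := z)))"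
  using strategic_measure_Suc[OF T Q \<rho> \<gamma>, of m] by (simp add: law_def atLeast0LessThan)

lemma nn_integral_law_Suc:
  assumes F [measurable]: "F \<in> borel_measurable (seqs (Suc m))"
  shows "(\<integral>\<^sup>+h. F h \<partial>law \<rho> \<gamma> (Suc m)) =
    (\<integral>\<^sup>+h. \<integral>\<^sup>+z. F (h(m := z)) \<partial>transition T Q \<rho> \<gamma> m h \<partial>law \<rho> \<gamma> m)"
proof -
  have "(\<integral>\<^sup>+h. F h \<partial>law \<rho> \<gamma> (Suc m)) = (\<integral>\<^sup>+h. \<integral>\<^sup>+h'. F h'
      \<partial>distr (transition T Q \<rho> \<gamma> m h) (seqs (Suc m)) (\<lambda>z. h(m := z)) \<partial>law \<rho> \<gamma> m)"
    unfolding law_Suc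
    by (rule prob_space.nn_integral_bind_prob[OF law_prob_space F])
       (simp add: measurable_cong_sets[OF sets_law refl] measurable_append_transition)
  also have "\<dots> = (\<integral>\<^sup>+h. \<integral>\<^sup>+z. F (h(m := z)) \<partial>transition T Q \<rho> \<gamma> m h \<partial>law \<rho> \<gamma> m)"
  proof (rule nn_integral_cong)
    fix h assume "h \<in> space (law \<rho> \<gamma> m)"
    then have h: "h \<in> space (seqs m)" by (simp add: space_law)
    have "(\<lambda>z. h(m := z)) \<in> borel \<rightarrow>\<^sub>M seqs (Suc m)"
      using measurable_compose[OF measurable_Pair1'[OF h] measurable_append_seq] by simp
    then show "(\<integral>\<^sup>+h'. F h' \<partial>distr (transition T Q \<rho> \<gamma> m h) (seqs (Suc m)) (\<lambda>z. h(m := z))) =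
        (\<integral>\<^sup>+z. F (h(m := z)) \<partial>transition T Q \<rho> \<gamma> m h)"
      by (intro nn_integral_distr)
         (simp_all add: measurable_cong_sets[OF kernel_space(2)[OF measurable_transition_seqs h] refl])
  qed
  finally show ?thesis .
qed

end

lemma transition_prior_irrelevant:
  "0 < m \<Longrightarrow> transition T Q \<rho> \<gamma> m h = transition T Q \<rho>' \<gamma> m h"
  by (cases m) auto

lemma measurable_transition_family:
  assumes \<rho>: "\<rho> \<in> N \<rightarrow>\<^sub>M prob_algebra borel" and \<gamma>: "measurable_policy_family N \<gamma>"
  shows "(\<lambda>(p, h). transition T Q (\<rho> p) (\<gamma> p) m h) \<in> N \<Otimes>\<^sub>M seqs m \<rightarrow>\<^sub>M prob_algebra borel"
proof (cases m)
  case 0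
  show ?thesis
    unfolding 0 transition.simps split_beta
    by (rule measurable_compose[OF measurable_compose[OF measurable_fst \<rho>] measurable_joint[OF Q]])
next
  case (Suc k)
  have a [measurable]: "(\<lambda>(p, y). action (\<gamma> p) y k) \<in> N \<Otimes>\<^sub>M seqs (Suc k) \<rightarrow>\<^sub>M borel"
    using \<gamma> by (simp add: measurable_policy_family_def)
  have "(\<lambda>w. (fst w, obs (Suc k) (snd w))) \<in> N \<Otimes>\<^sub>M (seqs m :: (nat \<Rightarrow> 'x \<times> 'y) measure) \<rightarrow>\<^sub>M N \<Otimes>\<^sub>M seqs (Suc k)"
    using Suc by (intro measurable_Pair measurable_fst measurable_compose[OF measurable_snd measurable_obs_seqs]) simp
  then have "(\<lambda>w. action (\<gamma> (fst w)) (obs (Suc k) (snd w)) k) \<in> N \<Otimes>\<^sub>M (seqs m :: (nat \<Rightarrow> 'x \<times> 'y) measure) \<rightarrow>\<^sub>M borel"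
    using measurable_compose[OF _ a] by fastforce
  moreover have "(\<lambda>w. fst (snd w k)) \<in> N \<Otimes>\<^sub>M (seqs m :: (nat \<Rightarrow> 'x \<times> 'y) measure) \<rightarrow>\<^sub>M (borel :: 'x measure)"
    by (rule measurable_compose[OF _ measurable_fst_snd_borel(1)],
        rule measurable_compose[OF measurable_snd], rule measurable_component_singleton) (simp add: Suc)
  ultimately show ?thesis
    unfolding Suc transition.simps split_beta action_obs[of k "Suc k", OF lessI, symmetric]
    by (intro measurable_compose[OF _ measurable_joint[OF Q]] measurable_compose[OF _ T] measurable_Pair)
qed

text \<open>The instances that matter are the family of the point masses, with a fixed policy, and the family of
  the restarted policies, with the predictors as priors.\<close>

lemma measurable_law:
  assumes \<rho>: "\<rho> \<in> N \<rightarrow>\<^sub>M prob_algebra borel" and \<gamma>: "measurable_policy_family N \<gamma>"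
  shows "(\<lambda>p. law (\<rho> p) (\<gamma> p) m) \<in> N \<rightarrow>\<^sub>M prob_algebra (seqs m)"
proof (induction m)
  have *: "\<rho> p \<in> priors" "\<gamma> p \<in> admissible" if "p \<in> space N" for p
    using that measurable_space[OF \<rho>] \<gamma> by (auto simp: measurable_policy_family_def)
  case 0
  have "(\<lambda>p. return (seqs 0) (\<lambda>_. undefined)) \<in> N \<rightarrow>\<^sub>M prob_algebra (seqs 0)"
    by (rule measurable_const) (auto simp: space_prob_algebra space_PiM intro!: prob_space_return)
  then show ?case
    by (rule measurable_cong[THEN iffD1, rotated]) (simp add: law_0[OF *])
next
  have *: "\<rho> p \<in> priors" "\<gamma> p \<in> admissible" if "p \<in> space N" for p
    using that measurable_space[OF \<rho>] \<gamma> by (auto simp: measurable_policy_family_def)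
  case (Suc m)
  have "(\<lambda>p. law (\<rho> p) (\<gamma> p) m \<bind> (\<lambda>h. distr (transition T Q (\<rho> p) (\<gamma> p) m h) (seqs (Suc m)) (\<lambda>z. h(m := z))))
      \<in> N \<rightarrow>\<^sub>M prob_algebra (seqs (Suc m))"
  proof (rule measurable_bind_prob_space2[OF Suc])
    have "(\<lambda>w. distr (case w of (p, h) \<Rightarrow> transition T Q (\<rho> p) (\<gamma> p) m h) (seqs (Suc m)) (\<lambda>z. (snd w)(m := z)))
        \<in> N \<Otimes>\<^sub>M seqs m \<rightarrow>\<^sub>M prob_algebra (seqs (Suc m))"
    proof (rule measurable_distr_prob_space2[OF measurable_transition_family[OF \<rho> \<gamma>]])
      show "(\<lambda>(w, z). (snd w)(m := z)) \<in> (N \<Otimes>\<^sub>M seqs m) \<Otimes>\<^sub>M borel \<rightarrow>\<^sub>M seqs (Suc m)"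
        using measurable_compose[OF _ measurable_append_seq,
            of "\<lambda>v. (snd (fst v), snd v)" "(N \<Otimes>\<^sub>M seqs m) \<Otimes>\<^sub>M borel" m]
        by (simp add: case_prod_unfold)
    qed
    then show "(\<lambda>(p, h). distr (transition T Q (\<rho> p) (\<gamma> p) m h) (seqs (Suc m)) (\<lambda>z. h(m := z)))
        \<in> N \<Otimes>\<^sub>M seqs m \<rightarrow>\<^sub>M prob_algebra (seqs (Suc m))"
      by (simp add: split_beta)
  qed
  then show ?case
    by (rule measurable_cong[THEN iffD1, rotated]) (simp add: law_Suc[OF *])
qed

lemma nn_integral_law_0:
  assumes "\<rho> \<in> priors" "\<gamma> \<in> admissible" and "F \<in> borel_measurable (seqs 0)"
  shows "(\<integral>\<^sup>+h. F h \<partial>law \<rho> \<gamma> 0) = F (\<lambda>_. undefined)"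
  unfolding law_0[OF assms(1,2)] by (rule nn_integral_return) (use assms in \<open>auto simp: space_PiM\<close>)

lemma dirac_prior: "return borel x \<in> (priors :: 'x measure set)"
  by (simp add: space_prob_algebra prob_space_return)

lemma measurable_law_dirac:
  assumes "\<gamma> \<in> admissible"
  shows "(\<lambda>x. law (return borel x) \<gamma> m) \<in> borel \<rightarrow>\<^sub>M prob_algebra (seqs m)"
  by (rule measurable_law[OF measurable_return_prob_space measurable_policy_family_const[OF assms]])

lemma measurable_append_integrand:
  assumes "F \<in> borel_measurable (seqs (Suc m))"
  shows "(\<lambda>(h, z). F (h(m := z))) \<in> borel_measurable (seqs m \<Otimes>\<^sub>M borel)"
  using measurable_compose[OF measurable_append_seq assms] by (simp add: case_prod_unfold)

lemma measurable_first_entry: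
  assumes "F \<in> borel_measurable (seqs (Suc 0))"
  shows "(\<lambda>z. F ((\<lambda>_. undefined)(0 := z))) \<in> borel_measurable (borel :: ('x \<times> 'y) measure)"
proof -
  have u: "(\<lambda>_. undefined) \<in> space (seqs 0 :: (nat \<Rightarrow> 'x \<times> 'y) measure)"
    by (simp add: space_PiM)
  show ?thesis
    using measurable_compose[OF measurable_Pair1'[OF u] measurable_append_integrand[OF assms]] by simp
qed

lemma nn_integral_law_1:
  assumes \<rho>: "\<rho> \<in> priors" and \<gamma>: "\<gamma> \<in> admissible" and F: "F \<in> borel_measurable (seqs (Suc 0))"
  shows "(\<integral>\<^sup>+h. F h \<partial>law \<rho> \<gamma> (Suc 0)) = (\<integral>\<^sup>+x. \<integral>\<^sup>+y. F ((\<lambda>_. undefined)(0 := (x, y))) \<partial>Q x \<partial>\<rho>)"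
proof -
  have "(\<lambda>h. \<integral>\<^sup>+z. F (h(0 := z)) \<partial>joint Q \<rho>) \<in> borel_measurable (seqs 0)"
    by (rule nn_integral_kernel_measurable[OF measurable_append_integrand[OF F]
          measurable_const[OF joint_in_priors[OF \<rho>]]])
  from nn_integral_law_0[OF \<rho> \<gamma> this] show ?thesis
    using nn_integral_law_Suc[OF \<rho> \<gamma> F] nn_integral_joint[OF \<rho> measurable_first_entry[OF F]]
    unfolding transition.simps by (simp only:)
qed

text \<open>The prior enters the dynamics only through the initial state, so the law under \<open>\<rho>\<close> is the mixture
  over \<open>\<rho>\<close> of the laws started from a point. The comparison of priors in total variation and
  the absolute continuity of the laws both rest on this.\<close>

lemma nn_integral_law_mixture:
  assumes \<rho>: "\<rho> \<in> priors" and \<gamma>: "\<gamma> \<in> admissible" and F: "F \<in> borel_measurable (seqs m)"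
  shows "(\<integral>\<^sup>+h. F h \<partial>law \<rho> \<gamma> m) = (\<integral>\<^sup>+x. \<integral>\<^sup>+h. F h \<partial>law (return borel x) \<gamma> m \<partial>\<rho>)"
  using F
proof (induction m arbitrary: F)
  case 0
  moreover have "emeasure \<rho> (space \<rho>) = 1"
    using \<rho> by (simp add: space_prob_algebra prob_space.emeasure_space_1)
  ultimately show ?case
    by (simp add: nn_integral_law_0[OF \<rho> \<gamma>] nn_integral_law_0[OF dirac_prior \<gamma>])
next
  case (Suc m)
  note F = Suc.prems
  show ?case
  proof (cases "m = 0")
    case True
    have "(\<lambda>(x, y). F ((\<lambda>_. undefined)(0 := (x, y)))) = (\<lambda>z. F ((\<lambda>_. undefined)(0 := z)))"
      by auto
    then have "(\<lambda>x. \<integral>\<^sup>+y. F ((\<lambda>_. undefined)(0 := (x, y))) \<partial>Q x) \<in> borel_measurable borel"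
      by (intro nn_integral_kernel_measurable[OF _ Q])
         (simp only: borel_prod measurable_first_entry[OF F[unfolded True]])
    then show ?thesis
      unfolding True nn_integral_law_1[OF \<rho> \<gamma> F[unfolded True]]
        nn_integral_law_1[OF dirac_prior \<gamma> F[unfolded True]] by (simp add: nn_integral_return)
  next
    case False
    define G where "G h = (\<integral>\<^sup>+z. F (h(m := z)) \<partial>transition T Q \<rho> \<gamma> m h)" for h
    have G: "G \<in> borel_measurable (seqs m)"
      unfolding G_def
      by (rule nn_integral_kernel_measurable[OF measurable_append_integrand[OF F] measurable_transition_seqs[OF \<rho> \<gamma>]])
    have 1: "(\<integral>\<^sup>+h. F h \<partial>law \<sigma> \<gamma> (Suc m)) = (\<integral>\<^sup>+h. G h \<partial>law \<sigma> \<gamma> m)" if \<sigma>: "\<sigma> \<in> priors" for \<sigma>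
      unfolding nn_integral_law_Suc[OF \<sigma> \<gamma> F] G_def
      using transition_prior_irrelevant[of m \<rho> \<gamma> _ \<sigma>] False by simp
    show ?thesis
      unfolding 1[OF \<rho>] 1[OF dirac_prior] by (rule Suc.IH[OF G])
  qed
qed

lemma law_absolutely_continuous:
  assumes \<mu>: "\<mu> \<in> priors" and \<nu>: "\<nu> \<in> priors" and \<gamma>: "\<gamma> \<in> admissible"
    and ac: "absolutely_continuous \<nu> \<mu>"
  shows "absolutely_continuous (law \<nu> \<gamma> m) (law \<mu> \<gamma> m)"
  unfolding absolutely_continuous_def
proof
  fix A assume "A \<in> null_sets (law \<nu> \<gamma> m)"
  then have A [measurable]: "A \<in> sets (seqs m)" and 0: "emeasure (law \<nu> \<gamma> m) A = 0"
    by (auto simp: \<nu> \<gamma>)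
  define g where "g x = emeasure (law (return borel x) \<gamma> m) A" for x
  have g: "g \<in> borel_measurable borel"
    unfolding g_def
    by (rule measurable_emeasure_kernel[OF measurable_prob_algebraD[OF measurable_law_dirac[OF \<gamma>]] A])
  have mix: "emeasure (law \<sigma> \<gamma> m) A = (\<integral>\<^sup>+x. g x \<partial>\<sigma>)" if \<sigma>: "\<sigma> \<in> priors" for \<sigma>
    using nn_integral_law_mixture[OF \<sigma> \<gamma>, of "indicator A" m] A
    by (simp add: g_def \<sigma> \<gamma> dirac_prior)
  have s: "sets \<mu> = sets borel" "sets \<nu> = sets borel"
    using \<mu> \<nu> by (auto simp: space_prob_algebra)
  have "AE x in \<nu>. g x = 0"
    using 0 mix[OF \<nu>] g by (simp add: nn_integral_0_iff_AE measurable_cong_sets[OF s(2) refl])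
  then have "AE x in \<mu>. g x = 0"
    using ac s by (intro absolutely_continuous_AE[of \<mu> \<nu>]) auto
  then have "emeasure (law \<mu> \<gamma> m) A = 0"
    unfolding mix[OF \<mu>] using g s by (subst nn_integral_0_iff_AE) (auto simp: measurable_cong_sets[OF s(1) refl])
  then show "A \<in> null_sets (law \<mu> \<gamma> m)"
    using A by (auto simp: null_sets_def \<mu> \<gamma>)
qed

section \<open>Filters and predictors\<close>

lemma obs_restrict: "m \<le> m' \<Longrightarrow> obs m (restrict h {..<m'}) = obs m h"
  by (auto simp: obs_def fun_eq_iff)

lemma measurable_state:
  assumes "n < m"
  shows "(\<lambda>h. fst (h n)) \<in> (seqs m :: (nat \<Rightarrow> 'x \<times> 'y) measure) \<rightarrow>\<^sub>M borel"
  by (rule measurable_compose[OF _ measurable_fst_snd_borel(1)], rule measurable_component_singleton)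
     (use assms in simp)

lemma cond_distr_law_iff:
  assumes \<rho>: "\<rho> \<in> priors" and \<gamma>: "\<gamma> \<in> admissible" and "m \<le> Suc n"
  shows "is_cond_distr (strategic_measure T Q \<rho> \<gamma>) (\<lambda>\<omega>. fst (\<omega> n)) (seqs m) (obs m) \<pi> \<longleftrightarrow>
    disintegrates (law \<rho> \<gamma> (Suc n)) (\<lambda>h. fst (h n)) borel (seqs m) (obs m) \<pi>"
proof -
  have "is_cond_distr (strategic_measure T Q \<rho> \<gamma>) (\<lambda>\<omega>. fst (\<omega> n)) (seqs m) (obs m) \<pi> \<longleftrightarrow>
      disintegrates (strategic_measure T Q \<rho> \<gamma>) (\<lambda>\<omega>. fst (\<omega> n)) borel (seqs m) (obs m) \<pi>"
    by (intro is_cond_distr_iff_disintegrates prob_space_strategic_measure[OF T Q \<rho> \<gamma>]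
          measurable_compose[OF measurable_coordinate[OF \<rho> \<gamma>] measurable_fst_snd_borel(1)] measurable_obs
          measurable_coordinate[OF \<rho> \<gamma>])
  also have "\<dots> \<longleftrightarrow> disintegrates (law \<rho> \<gamma> (Suc n)) (\<lambda>h. fst (h n)) borel (seqs m) (obs m) \<pi>"
    unfolding law_def
    by (subst disintegrates_distr[OF measurable_restrict_strategic[OF \<rho> \<gamma>] measurable_state
        measurable_obs_seqs[OF assms(3)]]) (auto simp: obs_restrict[OF assms(3)])
  finally show ?thesis .
qed

text \<open>\<open>is_filter\<close> indexes the measurements by \<open>{..n}\<close>, which is \<open>{..<Suc n}\<close>.\<close>

lemma is_filter_iff:
  assumes "\<rho> \<in> priors" and "\<gamma> \<in> admissible"
  shows "is_filter T Q \<rho> \<gamma> n \<pi> \<longleftrightarrow>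
    disintegrates (law \<rho> \<gamma> (Suc n)) (\<lambda>h. fst (h n)) borel (seqs (Suc n)) (obs (Suc n)) \<pi>"
  using cond_distr_law_iff[OF assms order.refl, of n \<pi>]
  by (simp add: is_filter_def obs_def[abs_def] lessThan_Suc_atMost)

lemma is_predictor_iff:
  assumes "\<rho> \<in> priors" and "\<gamma> \<in> admissible"
  shows "is_predictor T Q \<rho> \<gamma> n \<pi> \<longleftrightarrow>
    disintegrates (law \<rho> \<gamma> (Suc n)) (\<lambda>h. fst (h n)) borel (seqs n) (obs n) \<pi>"
  using cond_distr_law_iff[OF assms, of n n \<pi>] by (simp add: is_predictor_def obs_def[abs_def])

lemma nn_integral_law_marginal:
  assumes \<rho>: "\<rho> \<in> priors" and \<gamma>: "\<gamma> \<in> admissible" and m: "m \<le> m'"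
    and F: "F \<in> borel_measurable (seqs m)"
  shows "(\<integral>\<^sup>+h. F (restrict h {..<m}) \<partial>law \<rho> \<gamma> m') = (\<integral>\<^sup>+h. F h \<partial>law \<rho> \<gamma> m)"
proof -
  have "(\<lambda>h. F (restrict h {..<m})) \<in> borel_measurable (seqs m')"
    by (rule measurable_compose[OF measurable_restrict_subset F]) (use m in auto)
  moreover have "restrict (restrict \<omega> {..<m'}) {..<m} = restrict \<omega> {..<m}" for \<omega> :: "nat \<Rightarrow> 'x \<times> 'y"
    using m by (auto simp: fun_eq_iff)
  ultimately show ?thesis
    by (simp add: nn_integral_law[OF \<rho> \<gamma>] F)
qed

text \<open>The action at time \<open>k\<close> is a function of the measurements that the filter conditions on. Given these,
  the next state is therefore distributed as the filter, moved by the transition kernel with this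
  action.\<close>

lemma predictor_of_filter:
  assumes \<rho>: "\<rho> \<in> priors" and \<gamma>: "\<gamma> \<in> admissible" and \<pi>: "is_filter T Q \<rho> \<gamma> k \<pi>"
  shows "is_predictor T Q \<rho> \<gamma> (Suc k) (\<lambda>y. \<pi> y \<bind> (\<lambda>x. T (x, action \<gamma> y k)))"
proof -
  have dis: "disintegrates (law \<rho> \<gamma> (Suc k)) (\<lambda>h. fst (h k)) borel (seqs (Suc k)) (obs (Suc k)) \<pi>"
    using \<pi> by (simp add: is_filter_iff[OF \<rho> \<gamma>])
  note \<pi>m = dis[unfolded disintegrates_def, THEN conjunct1]
  have a: "(\<lambda>y. action \<gamma> y k) \<in> seqs (Suc k) \<rightarrow>\<^sub>M borel"
    by (rule measurable_action[OF \<gamma>]) auto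
  have Tk: "(\<lambda>(y, x). T (x, action \<gamma> y k)) \<in> seqs (Suc k) \<Otimes>\<^sub>M borel \<rightarrow>\<^sub>M prob_algebra borel"
    unfolding split_beta
    by (intro measurable_compose[OF _ T] measurable_Pair measurable_snd measurable_compose[OF measurable_fst a])
  define q where "q y = \<pi> y \<bind> (\<lambda>x. T (x, action \<gamma> y k))" for y
  have q: "q \<in> seqs (Suc k) \<rightarrow>\<^sub>M prob_algebra borel"
    unfolding q_def by (rule measurable_bind_prob_space2[OF \<pi>m Tk])
  have "(\<integral>\<^sup>+h. F (obs (Suc k) h, fst (h (Suc k))) \<partial>law \<rho> \<gamma> (Suc (Suc k))) =
      (\<integral>\<^sup>+h. \<integral>\<^sup>+x. F (obs (Suc k) h, x) \<partial>q (obs (Suc k) h) \<partial>law \<rho> \<gamma> (Suc (Suc k)))"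
    if F [measurable]: "F \<in> borel_measurable (seqs (Suc k) \<Otimes>\<^sub>M borel)" for F
  proof -
    define G where "G = (\<lambda>(y, x). \<integral>\<^sup>+x'. F (y, x') \<partial>T (x, action \<gamma> y k))"
    have G: "G \<in> borel_measurable (seqs (Suc k) \<Otimes>\<^sub>M borel)"
      using nn_integral_kernel_measurable[OF _ Tk, of "\<lambda>w x'. F (fst w, x')"]
      by (simp add: G_def case_prod_unfold)
    have Fq: "(\<lambda>y. \<integral>\<^sup>+x. F (y, x) \<partial>q y) \<in> borel_measurable (seqs (Suc k))"
      by (rule nn_integral_kernel_measurable[OF _ q]) simp
    have "(\<lambda>h. F (obs (Suc k) h, fst (h (Suc k)))) \<in> borel_measurable (seqs (Suc (Suc k)))"
      by (rule measurable_compose[OF measurable_Pair[OF measurable_obs_seqs measurable_state] F]) auto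
    then have "(\<integral>\<^sup>+h. F (obs (Suc k) h, fst (h (Suc k))) \<partial>law \<rho> \<gamma> (Suc (Suc k))) =
        (\<integral>\<^sup>+h. \<integral>\<^sup>+z. F (obs (Suc k) h, fst z) \<partial>transition T Q \<rho> \<gamma> (Suc k) h \<partial>law \<rho> \<gamma> (Suc k))"
      by (subst nn_integral_law_Suc[OF \<rho> \<gamma>]) (auto simp: obs_def cong: restrict_cong)
    also have "\<dots> = (\<integral>\<^sup>+h. G (obs (Suc k) h, fst (h k)) \<partial>law \<rho> \<gamma> (Suc k))"
    proof (rule nn_integral_cong)
      fix h assume "h \<in> space (law \<rho> \<gamma> (Suc k))"
      then have h: "h \<in> space (seqs (Suc k))" by (simp add: space_law[OF \<rho> \<gamma>])
      have y: "obs (Suc k) h \<in> space (seqs (Suc k))"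
        by (rule measurable_space[OF measurable_obs_seqs[OF order.refl] h])
      let ?t = "T (fst (h k), action \<gamma> (obs (Suc k) h) k)"
      have t: "?t \<in> priors"
        by (rule measurable_space[OF T]) (simp add: space_pair_measure)
      have Fy: "(\<lambda>x. F (obs (Suc k) h, x)) \<in> borel_measurable borel"
        by (rule measurable_compose[OF measurable_Pair1'[OF y] F])
      show "(\<integral>\<^sup>+z. F (obs (Suc k) h, fst z) \<partial>transition T Q \<rho> \<gamma> (Suc k) h) = G (obs (Suc k) h, fst (h k))"
        unfolding transition.simps action_obs[OF lessI, symmetric]
        by (subst nn_integral_joint[OF t measurable_compose[OF measurable_fst_snd_borel(1) Fy]])
           (simp add: G_def prob_space.emeasure_space_1[OF kernel_space(1)[OF Q]])
    qed
    also have "\<dots> = (\<integral>\<^sup>+h. \<integral>\<^sup>+x. G (obs (Suc k) h, x) \<partial>\<pi> (obs (Suc k) h) \<partial>law \<rho> \<gamma> (Suc k))"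
      by (rule disintegratesD[OF dis G])
    also have "\<dots> = (\<integral>\<^sup>+h. \<integral>\<^sup>+x. F (obs (Suc k) h, x) \<partial>q (obs (Suc k) h) \<partial>law \<rho> \<gamma> (Suc k))"
    proof (rule nn_integral_cong)
      fix h assume "h \<in> space (law \<rho> \<gamma> (Suc k))"
      then have h: "h \<in> space (seqs (Suc k))" by (simp add: space_law[OF \<rho> \<gamma>])
      have y: "obs (Suc k) h \<in> space (seqs (Suc k))"
        by (rule measurable_space[OF measurable_obs_seqs[OF order.refl] h])
      have Ty: "(\<lambda>x. T (x, action \<gamma> (obs (Suc k) h) k)) \<in> \<pi> (obs (Suc k) h) \<rightarrow>\<^sub>M prob_algebra borel"
        unfolding measurable_cong_sets[OF kernel_space(2)[OF \<pi>m y] refl]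
        using measurable_compose[OF measurable_Pair1'[OF y] Tk] by simp
      have Fy: "(\<lambda>x. F (obs (Suc k) h, x)) \<in> borel_measurable borel"
        by (rule measurable_compose[OF measurable_Pair1'[OF y] F])
      show "(\<integral>\<^sup>+x. G (obs (Suc k) h, x) \<partial>\<pi> (obs (Suc k) h)) =
          (\<integral>\<^sup>+x. F (obs (Suc k) h, x) \<partial>q (obs (Suc k) h))"
        unfolding q_def prob_space.nn_integral_bind_prob[OF kernel_space(1)[OF \<pi>m y] Fy Ty]
        by (simp add: G_def)
    qed
    also have "\<dots> = (\<integral>\<^sup>+h. \<integral>\<^sup>+x. F (obs (Suc k) h, x) \<partial>q (obs (Suc k) h) \<partial>law \<rho> \<gamma> (Suc (Suc k)))"
      using nn_integral_law_marginal[OF \<rho> \<gamma> _ measurable_compose[OF measurable_obs_seqs[OF order.refl] Fq],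
          of "Suc (Suc k)"]
      by (simp add: obs_restrict)
    finally show ?thesis .
  qed
  then show ?thesis
    unfolding is_predictor_iff[OF \<rho> \<gamma>] disintegrates_def q_def[abs_def, symmetric] using q by blast
qed

lemma predictor_absolutely_continuous:
  assumes \<mu>: "\<mu> \<in> priors" and \<nu>: "\<nu> \<in> priors" and \<gamma>: "\<gamma> \<in> admissible"
    and ac: "absolutely_continuous \<nu> \<mu>" and q: "is_predictor T Q \<nu> \<gamma> n q"
  obtains p where "is_predictor T Q \<mu> \<gamma> n p"
proof (rule disintegrates_absolutely_continuous)
  show "prob_space (law \<mu> \<gamma> (Suc n))" "prob_space (law \<nu> \<gamma> (Suc n))"
    by (rule law_prob_space; fact)+
  show "sets (law \<mu> \<gamma> (Suc n)) = sets (law \<nu> \<gamma> (Suc n))"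
    using \<mu> \<nu> \<gamma> by simp
  show "absolutely_continuous (law \<nu> \<gamma> (Suc n)) (law \<mu> \<gamma> (Suc n))"
    by (rule law_absolutely_continuous; fact)
  show "(\<lambda>h. fst (h n)) \<in> law \<nu> \<gamma> (Suc n) \<rightarrow>\<^sub>M borel" "obs n \<in> law \<nu> \<gamma> (Suc n) \<rightarrow>\<^sub>M seqs n"
    unfolding measurable_cong_sets[OF sets_law[OF \<nu> \<gamma>] refl]
    by (simp_all add: measurable_state measurable_obs_seqs)
  show "disintegrates (law \<nu> \<gamma> (Suc n)) (\<lambda>h. fst (h n)) borel (seqs n) (obs n) q"
    using q is_predictor_iff[OF \<nu> \<gamma>] by blast
qed (use that is_predictor_iff[OF \<mu> \<gamma>] in blast)

end

section \<open>Restarting a policy\<close>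

definition splice_seq :: "nat \<Rightarrow> (nat \<Rightarrow> 'a) \<Rightarrow> (nat \<Rightarrow> 'a) \<Rightarrow> nat \<Rightarrow> 'a" where
  "splice_seq n y y' = (\<lambda>i. if i < n then y i else y' (i - n))"

definition future :: "nat \<Rightarrow> nat \<Rightarrow> (nat \<Rightarrow> 'a) \<Rightarrow> nat \<Rightarrow> 'a" where
  "future n m h = (\<lambda>i\<in>{..<m}. h (n + i))"

text \<open>The policy that remains to be played once the first \<open>n\<close> measurements \<open>y\<close> are known. It ignores its
  second argument, the past actions, because \<open>action\<close> recomputes them from the measurements.\<close>

definition continuation :: "('y, 'u) policy \<Rightarrow> nat \<Rightarrow> (nat \<Rightarrow> 'y) \<Rightarrow> ('y, 'u) policy" where
  "continuation \<gamma> n y = (\<lambda>k (y', _). action \<gamma> (splice_seq n y y') (n + k))"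

lemma action_continuation: "action (continuation \<gamma> n y) y' k = action \<gamma> (splice_seq n y y') (n + k)"
  by (subst action.simps, simp add: continuation_def, rule action_cong) (auto simp: splice_seq_def)

lemma measurable_splice_seq_action:
  assumes \<gamma>: "\<gamma> \<in> admissible" and Y: "\<And>i. i < n \<Longrightarrow> (\<lambda>w. Y w i) \<in> M \<rightarrow>\<^sub>M borel"
    and Y': "\<And>i. i \<le> k \<Longrightarrow> (\<lambda>w. Y' w i) \<in> M \<rightarrow>\<^sub>M borel"
  shows "(\<lambda>w. action \<gamma> (splice_seq n (Y w) (Y' w)) (n + k)) \<in> M \<rightarrow>\<^sub>M borel"
proof (rule measurable_action[OF \<gamma>])
  fix i assume "i \<le> n + k"
  then show "(\<lambda>w. splice_seq n (Y w) (Y' w) i) \<in> M \<rightarrow>\<^sub>M borel"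
    by (cases "i < n") (auto simp: splice_seq_def intro: Y Y')
qed

lemma continuation_admissible:
  assumes \<gamma>: "\<gamma> \<in> admissible" shows "continuation \<gamma> n y \<in> admissible"
  unfolding admissible_def
proof (intro CollectI allI)
  fix k
  have "(\<lambda>w. action \<gamma> (splice_seq n y (fst w)) (n + k)) \<in>
      (\<Pi>\<^sub>M i\<in>{..k}. borel) \<Otimes>\<^sub>M (\<Pi>\<^sub>M i\<in>{..<k}. (borel :: 'b measure)) \<rightarrow>\<^sub>M borel"
    by (rule measurable_splice_seq_action[OF \<gamma>], simp)
       (rule measurable_compose[OF measurable_fst], rule measurable_component_singleton, simp)
  then show "continuation \<gamma> n y k \<in> (\<Pi>\<^sub>M i\<in>{..k}. borel) \<Otimes>\<^sub>M (\<Pi>\<^sub>M i\<in>{..<k}. borel) \<rightarrow>\<^sub>M borel"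
    by (simp add: continuation_def case_prod_unfold)
qed

lemma measurable_policy_family_continuation:
  assumes \<gamma>: "\<gamma> \<in> admissible" shows "measurable_policy_family (seqs n) (continuation \<gamma> n)"
  unfolding measurable_policy_family_def action_continuation case_prod_unfold
proof (intro conjI ballI allI continuation_admissible[OF \<gamma>])
  show "(\<lambda>w. action \<gamma> (splice_seq n (fst w) (snd w)) (n + k)) \<in> seqs n \<Otimes>\<^sub>M seqs (Suc k) \<rightarrow>\<^sub>M borel" for k
    by (rule measurable_splice_seq_action[OF \<gamma>])
       (rule measurable_compose[OF measurable_fst] measurable_compose[OF measurable_snd],
        rule measurable_component_singleton, simp)+
qed

lemma measurable_future:
  "n + m \<le> m' \<Longrightarrow> future n m \<in> seqs m' \<rightarrow>\<^sub>M seqs m"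
  unfolding future_def by (intro measurable_restrict measurable_component_singleton) auto

text \<open>The first \<open>n\<close> measurements and the later ones together are the original measurements.\<close>

lemma splice_seq_future_action:
  assumes "k < m"
  shows "action \<gamma> (splice_seq n (obs n h) (\<lambda>i. snd (future n m h i))) (n + k) = action \<gamma> (\<lambda>i. snd (h i)) (n + k)"
  by (rule action_cong) (use assms in \<open>auto simp: splice_seq_def obs_def future_def\<close>)

context pomdp
begin

text \<open>Given the state at time \<open>n\<close>, the measurement at time \<open>n\<close> is independent of the past. It can
  therefore be drawn afresh from \<open>Q\<close> without changing the law.\<close>

lemma nn_integral_resample_observation:
  assumes \<rho>: "\<rho> \<in> priors" and \<gamma>: "\<gamma> \<in> admissible"
    and F [measurable]: "F \<in> borel_measurable (seqs n \<Otimes>\<^sub>M borel)"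
  shows "(\<integral>\<^sup>+h. F (restrict h {..<n}, h n) \<partial>law \<rho> \<gamma> (Suc n)) =
    (\<integral>\<^sup>+h. \<integral>\<^sup>+y. F (restrict h {..<n}, (fst (h n), y)) \<partial>Q (fst (h n)) \<partial>law \<rho> \<gamma> (Suc n))"
proof -
  let ?tr = "transition T Q \<rho> \<gamma> n"
  define G where "G = (\<lambda>(h, z :: 'x \<times> 'y). \<integral>\<^sup>+y. F (h, (fst z, y)) \<partial>Q (fst z))"
  have "(\<lambda>w. (fst (snd (fst w)), snd w)) \<in>
      ((seqs n :: (nat \<Rightarrow> 'x \<times> 'y) measure) \<Otimes>\<^sub>M (borel :: ('x \<times> 'y) measure)) \<Otimes>\<^sub>M (borel :: 'y measure)
      \<rightarrow>\<^sub>M borel \<Otimes>\<^sub>M borel"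
    by (intro measurable_Pair measurable_snd
        measurable_compose[OF measurable_compose[OF measurable_fst measurable_snd] measurable_fst_snd_borel(1)])
  then have "(\<lambda>w. F (fst (fst w), (fst (snd (fst w)), snd w))) \<in>
      borel_measurable ((seqs n \<Otimes>\<^sub>M (borel :: ('x \<times> 'y) measure)) \<Otimes>\<^sub>M borel)"
    unfolding borel_prod
    by (intro measurable_compose[OF _ F] measurable_Pair measurable_compose[OF measurable_fst measurable_fst])
  moreover have "(\<lambda>w. Q (fst (snd w))) \<in> (seqs n :: (nat \<Rightarrow> 'x \<times> 'y) measure) \<Otimes>\<^sub>M (borel :: ('x \<times> 'y) measure) \<rightarrow>\<^sub>M prob_algebra borel"
    by (intro measurable_compose[OF _ Q] measurable_compose[OF measurable_snd measurable_fst_snd_borel(1)])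
  ultimately have G: "G \<in> borel_measurable (seqs n \<Otimes>\<^sub>M borel)"
    using nn_integral_kernel_measurable[of "\<lambda>w y. F ((fst w, (fst (snd w), y)))"
        "seqs n \<Otimes>\<^sub>M borel" borel "\<lambda>w. Q (fst (snd w))"]
    by (simp add: G_def case_prod_unfold)
  have step: "(\<integral>\<^sup>+h. K (restrict h {..<n}, h n) \<partial>law \<rho> \<gamma> (Suc n)) = (\<integral>\<^sup>+h. \<integral>\<^sup>+z. K (h, z) \<partial>?tr h \<partial>law \<rho> \<gamma> n)"
    if K: "K \<in> borel_measurable (seqs n \<Otimes>\<^sub>M borel)" for K
  proof -
    have "(\<lambda>h. K (restrict h {..<n}, h n)) \<in> borel_measurable (seqs (Suc n))"
      by (rule measurable_compose[OF measurable_Pair[OF measurable_restrict_subset measurable_component_singleton] K]) auto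
    then have "(\<integral>\<^sup>+h. K (restrict h {..<n}, h n) \<partial>law \<rho> \<gamma> (Suc n)) =
        (\<integral>\<^sup>+h. \<integral>\<^sup>+z. K (restrict (h(n := z)) {..<n}, z) \<partial>?tr h \<partial>law \<rho> \<gamma> n)"
      by (subst nn_integral_law_Suc[OF \<rho> \<gamma>]) auto
    also have "\<dots> = (\<integral>\<^sup>+h. \<integral>\<^sup>+z. K (h, z) \<partial>?tr h \<partial>law \<rho> \<gamma> n)"
    proof (rule nn_integral_cong)
      fix h assume "h \<in> space (law \<rho> \<gamma> n)"
      then have "restrict h {..<n} = h"
        by (auto simp: space_law[OF \<rho> \<gamma>] space_PiM PiE_def extensional_restrict)
      moreover have "restrict (h(n := z)) {..<n} = restrict h {..<n}" for z
        by (auto simp: fun_eq_iff)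
      ultimately show "(\<integral>\<^sup>+z. K (restrict (h(n := z)) {..<n}, z) \<partial>?tr h) = (\<integral>\<^sup>+z. K (h, z) \<partial>?tr h)"
        by simp
    qed
    finally show ?thesis .
  qed
  have "(\<integral>\<^sup>+z. F (h, z) \<partial>?tr h) = (\<integral>\<^sup>+z. G (h, z) \<partial>?tr h)" if h: "h \<in> space (seqs n)" for h
  proof -
    obtain \<sigma> where \<sigma>: "\<sigma> \<in> priors" "?tr h = joint Q \<sigma>"
    proof (cases n)
      case 0
      then show ?thesis using that \<rho> by simp
    next
      case (Suc k)
      have "T (fst (h k), action \<gamma> (\<lambda>i. snd (h i)) k) \<in> priors"
        by (rule measurable_space[OF T]) (simp add: space_pair_measure)
      then show ?thesis using that Suc by simp
    qed
    have "(\<lambda>z. F (h, z)) \<in> borel_measurable borel" "(\<lambda>z. G (h, z)) \<in> borel_measurable borel"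
      by (rule measurable_compose[OF measurable_Pair1'[OF h]]; fact)+
    then show ?thesis
      unfolding \<sigma>(2) using prob_space.emeasure_space_1[OF kernel_space(1)[OF Q]]
      by (simp add: nn_integral_joint[OF \<sigma>(1)] G_def)
  qed
  then have "(\<integral>\<^sup>+h. \<integral>\<^sup>+z. F (h, z) \<partial>?tr h \<partial>law \<rho> \<gamma> n) = (\<integral>\<^sup>+h. \<integral>\<^sup>+z. G (h, z) \<partial>?tr h \<partial>law \<rho> \<gamma> n)"
    by (rule nn_integral_cong) (simp add: space_law[OF \<rho> \<gamma>])
  then show ?thesis
    unfolding step[OF F] step[OF G, symmetric] by (simp add: G_def)
qed

text \<open>Given the first \<open>n\<close> measurements, the process from time \<open>n\<close> on is the controlled process that starts
  from the predictor and follows the restarted policy. The induction is on the number \<open>m\<close> of later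
  steps. The first of them combines the defining property of the predictor with a fresh draw of the
  measurement; all further ones use that the transition at time \<open>n + m\<close> depends on the past only
  through the measurements and the last state.\<close>

theorem markov_property:
  assumes \<rho>: "\<rho> \<in> priors" and \<gamma>: "\<gamma> \<in> admissible" and p: "is_predictor T Q \<rho> \<gamma> n p"
    and F: "F \<in> borel_measurable (seqs n \<Otimes>\<^sub>M seqs m)" and n: "0 < n"
  shows "(\<integral>\<^sup>+h. F (obs n h, future n m h) \<partial>law \<rho> \<gamma> (n + m)) =
    (\<integral>\<^sup>+h. \<integral>\<^sup>+h'. F (obs n h, h') \<partial>law (p (obs n h)) (continuation \<gamma> n (obs n h)) m \<partial>law \<rho> \<gamma> n)"
  using F
proof (induction m arbitrary: F)
  have dis: "disintegrates (law \<rho> \<gamma> (Suc n)) (\<lambda>h. fst (h n)) borel (seqs n) (obs n) p"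
    using p by (simp add: is_predictor_iff[OF \<rho> \<gamma>])
  note pm = dis[unfolded disintegrates_def, THEN conjunct1]
  have y: "obs n h \<in> space (seqs n)" "p (obs n h) \<in> priors" if "h \<in> space (law \<rho> \<gamma> n)" for h
    using measurable_space[OF measurable_obs_seqs[OF order.refl], of h n] measurable_space[OF pm] that
    by (auto simp: space_law[OF \<rho> \<gamma>])
  note adm = continuation_admissible[OF \<gamma>]
  have Fy: "(\<lambda>h'. F (y, h')) \<in> borel_measurable (seqs k)"
    if "F \<in> borel_measurable (seqs n \<Otimes>\<^sub>M seqs k)" "y \<in> space (seqs n)" for F :: "_ \<Rightarrow> ennreal" and k y
    by (rule measurable_compose[OF measurable_Pair1'[OF that(2)] that(1)])
  {
    case 0
    have "future n 0 h = (\<lambda>_. undefined)" for h :: "nat \<Rightarrow> 'x \<times> 'y"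
      by (simp add: future_def fun_eq_iff)
    then show ?case
      using nn_integral_law_0[OF y(2) adm Fy[OF 0 y(1)]]
      by (simp only: add_0_right) (rule nn_integral_cong, simp)
  next
    case (Suc m)
    note F = Suc.prems
    show ?case
    proof (cases "m = 0")
      case True
      note F1 = F[unfolded True]
      let ?one = "\<lambda>z. (\<lambda>_. undefined)(0 := z)"
      have one: "?one \<in> borel \<rightarrow>\<^sub>M (seqs (Suc 0) :: (nat \<Rightarrow> 'x \<times> 'y) measure)"
        using measurable_compose[OF measurable_Pair1' measurable_append_seq, of "\<lambda>_. undefined" 0]
        by (simp add: space_PiM)
      have sh: "future n (Suc 0) h = ?one (h n)" for h :: "nat \<Rightarrow> 'x \<times> 'y"
        by (auto simp: future_def fun_eq_iff)
      have rs: "obs n (restrict h {..<n}) = obs n h" for h :: "nat \<Rightarrow> 'x \<times> 'y"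
        by (rule obs_restrict) simp
      define G where "G = (\<lambda>(y, x). \<integral>\<^sup>+y'. F (y, ?one (x, y')) \<partial>Q x)"
      have "(\<lambda>w. (snd (fst w), snd w)) \<in> ((seqs n :: (nat \<Rightarrow> 'y) measure) \<Otimes>\<^sub>M (borel :: 'x measure)) \<Otimes>\<^sub>M (borel :: 'y measure)
          \<rightarrow>\<^sub>M borel \<Otimes>\<^sub>M borel"
        by (intro measurable_Pair measurable_snd measurable_compose[OF measurable_fst measurable_snd])
      then have "(\<lambda>w. F (fst (fst w), ?one (snd (fst w), snd w))) \<in> borel_measurable ((seqs n \<Otimes>\<^sub>M borel) \<Otimes>\<^sub>M borel)"
        unfolding borel_prod
        by (intro measurable_compose[OF _ F1] measurable_Pair measurable_compose[OF _ one]
            measurable_compose[OF measurable_fst measurable_fst])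
      then have G: "G \<in> borel_measurable (seqs n \<Otimes>\<^sub>M borel)"
        using nn_integral_kernel_measurable[OF _ measurable_compose[OF measurable_snd Q],
            of "\<lambda>w y'. F (fst w, ?one (snd w, y'))" "seqs n"]
        by (simp add: G_def case_prod_unfold)
      have Gp: "(\<lambda>y. \<integral>\<^sup>+x. G (y, x) \<partial>p y) \<in> borel_measurable (seqs n)"
        by (rule nn_integral_kernel_measurable[OF _ pm]) (use G in simp)
      have FK: "(\<lambda>(h :: nat \<Rightarrow> 'x \<times> 'y, z). F (obs n h, ?one z)) \<in> borel_measurable (seqs n \<Otimes>\<^sub>M borel)"
        unfolding case_prod_unfold
        by (intro measurable_compose[OF _ F1] measurable_Pair measurable_compose[OF measurable_snd one]
            measurable_compose[OF measurable_fst measurable_obs_seqs]) simp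
      have "(\<integral>\<^sup>+h. F (obs n h, future n (Suc m) h) \<partial>law \<rho> \<gamma> (n + Suc m)) =
          (\<integral>\<^sup>+h. G (obs n h, fst (h n)) \<partial>law \<rho> \<gamma> (Suc n))"
        using nn_integral_resample_observation[OF \<rho> \<gamma> FK] by (simp add: True sh rs G_def)
      also have "\<dots> = (\<integral>\<^sup>+h. \<integral>\<^sup>+x. G (obs n h, x) \<partial>p (obs n h) \<partial>law \<rho> \<gamma> (Suc n))"
        by (rule disintegratesD[OF dis G])
      also have "\<dots> = (\<integral>\<^sup>+h. \<integral>\<^sup>+x. G (obs n h, x) \<partial>p (obs n h) \<partial>law \<rho> \<gamma> n)"
        using nn_integral_law_marginal[OF \<rho> \<gamma> _ measurable_compose[OF measurable_obs_seqs[OF order.refl] Gp],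
          of "Suc n"] by (simp add: rs)
      also have "\<dots> = (\<integral>\<^sup>+h. \<integral>\<^sup>+h'. F (obs n h, h') \<partial>law (p (obs n h)) (continuation \<gamma> n (obs n h)) (Suc m) \<partial>law \<rho> \<gamma> n)"
        using nn_integral_law_1[OF y(2) adm Fy[OF F1 y(1)]]
        by (simp only: True, intro nn_integral_cong[of "law \<rho> \<gamma> n"]) (simp add: G_def)
      finally show ?thesis .
    next
      case False
      let ?tr = "\<lambda>y. transition T Q (p y) (continuation \<gamma> n y) m"
      define G where "G = (\<lambda>(y, h'). \<integral>\<^sup>+z. F (y, h'(m := z)) \<partial>?tr y h')"
      have app: "(\<lambda>w. (snd (fst w))(m := snd w)) \<in> ((seqs n :: (nat \<Rightarrow> 'y) measure) \<Otimes>\<^sub>M seqs m) \<Otimes>\<^sub>M borel \<rightarrow>\<^sub>M (seqs (Suc m) :: (nat \<Rightarrow> 'x \<times> 'y) measure)"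
        using measurable_compose[OF _ measurable_append_seq, of "\<lambda>w. (snd (fst w), snd w)"
            "((seqs n :: (nat \<Rightarrow> 'y) measure) \<Otimes>\<^sub>M seqs m) \<Otimes>\<^sub>M borel" m]
        by (simp add: case_prod_unfold)
      have "(\<lambda>w. F (fst (fst w), (snd (fst w))(m := snd w))) \<in> borel_measurable ((seqs n \<Otimes>\<^sub>M seqs m) \<Otimes>\<^sub>M borel)"
        by (intro measurable_compose[OF _ F] measurable_Pair app) simp
      then have G: "G \<in> borel_measurable (seqs n \<Otimes>\<^sub>M seqs m)"
        using nn_integral_kernel_measurable[OF _ measurable_transition_family[OF pm
            measurable_policy_family_continuation[OF \<gamma>]], of "\<lambda>w z. F (fst w, (snd w)(m := z))" m]
        by (simp add: G_def case_prod_unfold)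
      have tr: "transition T Q \<rho> \<gamma> (n + m) h = ?tr (obs n h) (future n m h)" for h
      proof -
        obtain k where k: "m = Suc k" using False by (cases m) auto
        have "action (continuation \<gamma> n (obs n h)) (\<lambda>i. snd (future n m h i)) k = action \<gamma> (\<lambda>i. snd (h i)) (n + k)"
          unfolding action_continuation by (rule splice_seq_future_action) (simp add: k)
        then show ?thesis
          by (simp add: k) (simp add: future_def)
      qed
      have up: "obs n (h(n + m := z)) = obs n h" "future n (Suc m) (h(n + m := z)) = (future n m h)(m := z)"
        for h :: "nat \<Rightarrow> 'x \<times> 'y" and z
        by (auto simp: obs_def future_def fun_eq_iff)
      have "(\<lambda>h. F (obs n h, future n (Suc m) h)) \<in> borel_measurable (seqs (Suc (n + m)))"
        by (intro measurable_compose[OF _ F] measurable_Pair measurable_obs_seqs measurable_future) auto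
      then have "(\<integral>\<^sup>+h. F (obs n h, future n (Suc m) h) \<partial>law \<rho> \<gamma> (n + Suc m)) =
          (\<integral>\<^sup>+h. \<integral>\<^sup>+z. F (obs n h, (future n m h)(m := z)) \<partial>transition T Q \<rho> \<gamma> (n + m) h \<partial>law \<rho> \<gamma> (n + m))"
        using nn_integral_law_Suc[OF \<rho> \<gamma>] by (simp add: up)
      also have "\<dots> = (\<integral>\<^sup>+h. G (obs n h, future n m h) \<partial>law \<rho> \<gamma> (n + m))"
        by (simp add: tr G_def)
      also have "\<dots> = (\<integral>\<^sup>+h. \<integral>\<^sup>+h'. G (obs n h, h') \<partial>law (p (obs n h)) (continuation \<gamma> n (obs n h)) m \<partial>law \<rho> \<gamma> n)"
        by (rule Suc.IH[OF G])
      also have "\<dots> = (\<integral>\<^sup>+h. \<integral>\<^sup>+h'. F (obs n h, h') \<partial>law (p (obs n h)) (continuation \<gamma> n (obs n h)) (Suc m) \<partial>law \<rho> \<gamma> n)"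
        using nn_integral_law_Suc[OF y(2) adm Fy[OF F y(1)]]
        by (intro nn_integral_cong[of "law \<rho> \<gamma> n"]) (simp add: G_def)
      finally show ?thesis .
    qed
  }
qed

section \<open>Uniqueness of filter feedback\<close>

lemma law_marginal:
  assumes \<rho>: "\<rho> \<in> priors" and \<gamma>: "\<gamma> \<in> admissible" and m: "m \<le> m'"
  shows "distr (law \<rho> \<gamma> m') (seqs m) (\<lambda>h. restrict h {..<m}) = law \<rho> \<gamma> m"
proof -
  have "(\<lambda>h. restrict h {..<m}) \<in> seqs m' \<rightarrow>\<^sub>M (seqs m :: (nat \<Rightarrow> 'x \<times> 'y) measure)"
    by (rule measurable_restrict_subset) (use m in auto)
  moreover have "restrict (restrict \<omega> {..<m'}) {..<m} = restrict \<omega> {..<m}" for \<omega> :: "nat \<Rightarrow> 'x \<times> 'y"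
    using m by (auto simp: fun_eq_iff)
  ultimately show ?thesis
    unfolding law_def
    by (subst distr_distr[OF _ measurable_restrict_strategic[OF \<rho> \<gamma>]]) (auto simp: comp_def)
qed

text \<open>Two versions of the filter on the same law agree almost surely, and both policies apply the same
  \<open>\<Phi>\<close>.\<close>

lemma filter_feedback_AE_action_eq:
  assumes \<rho>: "\<rho> \<in> priors" and \<gamma>: "\<gamma> \<in> admissible" and \<gamma>': "\<gamma>' \<in> admissible"
    and fb: "filter_feedback T Q \<Phi> \<rho> \<gamma>" and fb': "filter_feedback T Q \<Phi> \<rho> \<gamma>'"
    and eq: "law \<rho> \<gamma> (Suc k) = law \<rho> \<gamma>' (Suc k)"
  shows "AE h in law \<rho> \<gamma> (Suc k). action \<gamma> (\<lambda>i. snd (h i)) k = action \<gamma>' (\<lambda>i. snd (h i)) k"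
proof -
  obtain \<pi> where \<pi>: "is_filter T Q \<rho> \<gamma> k \<pi>" "\<And>y. action \<gamma> y k = \<Phi> (\<pi> (restrict y {..<Suc k}))"
    using fb by (auto simp: filter_feedback_def lessThan_Suc_atMost)
  obtain \<pi>' where \<pi>': "is_filter T Q \<rho> \<gamma>' k \<pi>'" "\<And>y. action \<gamma>' y k = \<Phi> (\<pi>' (restrict y {..<Suc k}))"
    using fb' by (auto simp: filter_feedback_def lessThan_Suc_atMost)
  have "obs (Suc k) \<in> law \<rho> \<gamma> (Suc k) \<rightarrow>\<^sub>M seqs (Suc k)"
    by (simp add: measurable_cong_sets[OF sets_law[OF \<rho> \<gamma>] refl] measurable_obs_seqs)
  then have "AE h in law \<rho> \<gamma> (Suc k). \<pi> (obs (Suc k) h) = \<pi>' (obs (Suc k) h)"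
    by (rule disintegrates_AE_unique[OF law_prob_space[OF \<rho> \<gamma>]])
       (use \<pi>(1) \<pi>'(1) in \<open>simp_all add: is_filter_iff \<rho> \<gamma> \<gamma>' eq\<close>)
  then show ?thesis
    by eventually_elim (simp add: \<pi>(2) \<pi>'(2) obs_def)
qed

text \<open>The law of the first \<open>k + 1\<close> pairs determines the filter at time \<open>k\<close> up to null sets, the filter
  determines the action, and the action determines the law of the next pair.\<close>

lemma filter_feedback_law_unique:
  assumes \<rho>: "\<rho> \<in> priors" and \<gamma>: "\<gamma> \<in> admissible" and \<gamma>': "\<gamma>' \<in> admissible"
    and fb: "filter_feedback T Q \<Phi> \<rho> \<gamma>" and fb': "filter_feedback T Q \<Phi> \<rho> \<gamma>'"
  shows "law \<rho> \<gamma> m = law \<rho> \<gamma>' m"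
proof (induction m)
  case 0
  show ?case by (simp add: law_0 \<rho> \<gamma> \<gamma>')
next
  case (Suc m)
  have "AE h in law \<rho> \<gamma> m. transition T Q \<rho> \<gamma> m h = transition T Q \<rho> \<gamma>' m h"
  proof (cases m)
    case (Suc k)
    then show ?thesis
      using filter_feedback_AE_action_eq[OF \<rho> \<gamma> \<gamma>' fb fb', of k] Suc.IH by auto
  qed simp
  then have eq: "(\<integral>\<^sup>+h. \<integral>\<^sup>+z. F (h(m := z)) \<partial>transition T Q \<rho> \<gamma> m h \<partial>law \<rho> \<gamma> m) =
      (\<integral>\<^sup>+h. \<integral>\<^sup>+z. F (h(m := z)) \<partial>transition T Q \<rho> \<gamma>' m h \<partial>law \<rho> \<gamma>' m)" for F :: "_ \<Rightarrow> ennreal"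
    unfolding Suc.IH[symmetric] by (intro nn_integral_cong_AE) auto
  show ?case
  proof (rule measure_eqI)
    fix A assume "A \<in> sets (law \<rho> \<gamma> (Suc m))"
    then have A: "A \<in> sets (seqs (Suc m))" by (simp add: \<rho> \<gamma>)
    then show "emeasure (law \<rho> \<gamma> (Suc m)) A = emeasure (law \<rho> \<gamma>' (Suc m)) A"
      using nn_integral_law_Suc[OF \<rho> \<gamma>, of "indicator A" m] nn_integral_law_Suc[OF \<rho> \<gamma>', of "indicator A" m] eq[of "indicator A"]
      by (simp add: \<rho> \<gamma> \<gamma>')
  qed (simp add: \<rho> \<gamma> \<gamma>')
qed

definition path_cost :: "('x \<times> 'u \<Rightarrow> real) \<Rightarrow> ('y, 'u) policy \<Rightarrow> nat \<Rightarrow> (nat \<Rightarrow> 'x \<times> 'y) \<Rightarrow> ennreal" where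
  "path_cost c \<gamma> m h = (\<Sum>i<m. ennreal (c (fst (h i), action \<gamma> (\<lambda>k. snd (h k)) i)))"

definition total_cost :: "('x \<times> 'u \<Rightarrow> real) \<Rightarrow> 'x measure \<Rightarrow> ('y, 'u) policy \<Rightarrow> nat \<Rightarrow> ennreal" where
  "total_cost c \<rho> \<gamma> m = (\<integral>\<^sup>+h. path_cost c \<gamma> m h \<partial>law \<rho> \<gamma> m)"

theorem filter_feedback_total_cost_unique:
  assumes \<rho>: "\<rho> \<in> priors" and \<gamma>: "\<gamma> \<in> admissible" and \<gamma>': "\<gamma>' \<in> admissible"
    and fb: "filter_feedback T Q \<Phi> \<rho> \<gamma>" and fb': "filter_feedback T Q \<Phi> \<rho> \<gamma>'"
  shows "total_cost c \<rho> \<gamma> m = total_cost c \<rho> \<gamma>' m"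
proof -
  note law_eq = filter_feedback_law_unique[OF assms]
  have "AE h in law \<rho> \<gamma> m. action \<gamma> (\<lambda>i. snd (h i)) k = action \<gamma>' (\<lambda>i. snd (h i)) k" if k: "k < m" for k
  proof -
    have r: "(\<lambda>h. restrict h {..<Suc k}) \<in> law \<rho> \<gamma> m \<rightarrow>\<^sub>M seqs (Suc k)"
      unfolding measurable_cong_sets[OF sets_law[OF \<rho> \<gamma>] refl]
      by (rule measurable_restrict_subset) (use k in auto)
    have "AE h in distr (law \<rho> \<gamma> m) (seqs (Suc k)) (\<lambda>h. restrict h {..<Suc k}).
        action \<gamma> (\<lambda>i. snd (h i)) k = action \<gamma>' (\<lambda>i. snd (h i)) k"
      unfolding law_marginal[OF \<rho> \<gamma> Suc_leI[OF k]] by (rule filter_feedback_AE_action_eq[OF assms law_eq])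
    from AE_distrD[OF r this]
    show ?thesis
    proof eventually_elim
      fix h assume *: "action \<gamma> (\<lambda>i. snd (restrict h {..<Suc k} i)) k = action \<gamma>' (\<lambda>i. snd (restrict h {..<Suc k} i)) k"
      have "action \<beta> (\<lambda>i. snd (restrict h {..<Suc k} i)) k = action \<beta> (\<lambda>i. snd (h i)) k" for \<beta> :: "('y, 'u) policy"
        by (rule action_cong) auto
      then show "action \<gamma> (\<lambda>i. snd (h i)) k = action \<gamma>' (\<lambda>i. snd (h i)) k"
        using * by simp
    qed
  qed
  then have "AE h in law \<rho> \<gamma> m. \<forall>k\<in>{..<m}. action \<gamma> (\<lambda>i. snd (h i)) k = action \<gamma>' (\<lambda>i. snd (h i)) k"
    by (subst AE_ball_countable) auto
  then have "AE h in law \<rho> \<gamma> m. path_cost c \<gamma> m h = path_cost c \<gamma>' m h"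
    by eventually_elim (simp add: path_cost_def)
  then show ?thesis
    unfolding total_cost_def law_eq[symmetric] by (rule nn_integral_cong_AE)
qed

section \<open>Restarting a filter feedback policy\<close>

lemma measurable_join:
  "(\<lambda>(y, y'). restrict (splice_seq n y y') {..<n + m}) \<in> seqs n \<Otimes>\<^sub>M seqs m \<rightarrow>\<^sub>M seqs (n + m)"
  unfolding case_prod_unfold
proof (rule measurable_restrict)
  fix i assume "i \<in> {..<n + m}"
  then show "(\<lambda>w. splice_seq n (fst w) (snd w) i) \<in> seqs n \<Otimes>\<^sub>M seqs m \<rightarrow>\<^sub>M borel"
    by (cases "i < n")
       (auto simp: splice_seq_def intro: measurable_compose[OF measurable_fst measurable_component_singleton]
         measurable_compose[OF measurable_snd measurable_component_singleton])
qed

lemma join_obs: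
  "restrict (splice_seq n (obs n h) (obs m (future n m h))) {..<n + m} = obs (n + m) h"
  by (auto simp: splice_seq_def obs_def future_def fun_eq_iff)

lemma obs_future: "obs m (future n m h) = future n m (obs (n + m) h)"
  by (auto simp: obs_def future_def fun_eq_iff)

text \<open>The filters of the original process, with the first \<open>n\<close> measurements fixed to \<open>y\<close>, are filters of the
  restarted process. For fixed \<open>k\<close> this compares two kernels in \<open>y\<close> with values in the laws of the
  pair of the state at time \<open>k\<close> and the measurements up to then: \<open>\<kappa>1\<close> is the actual law under the
  restarted process, \<open>\<kappa>2\<close> is its disintegration by the original filter. By the Markov property,
  integrating either over \<open>y\<close> gives a quantity of the original process at time \<open>n + k\<close>, and the filter
  property of \<open>\<pi>\<close> at that time says that the two quantities are equal. Hence \<open>\<kappa>1\<close> and \<open>\<kappa>2\<close> agree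
  almost everywhere.\<close>

lemma filter_continuation:
  assumes \<nu>: "\<nu> \<in> priors" and \<gamma>: "\<gamma> \<in> admissible" and q: "is_predictor T Q \<nu> \<gamma> n q" and n: "0 < n"
    and \<pi>: "is_filter T Q \<nu> \<gamma> (n + k) \<pi>"
  shows "AE h in law \<nu> \<gamma> n. is_filter T Q (q (obs n h)) (continuation \<gamma> n (obs n h)) k
    (\<lambda>y'. \<pi> (restrict (splice_seq n (obs n h) y') {..<n + Suc k}))"
proof -
  let ?K = "Suc k"
  let ?H = "seqs n :: (nat \<Rightarrow> 'y) measure"
  let ?S = "seqs (Suc k) :: (nat \<Rightarrow> 'x \<times> 'y) measure"
  let ?L = "\<lambda>y. law (q y) (continuation \<gamma> n y) ?K"
  let ?\<pi> = "\<lambda>y y'. \<pi> (restrict (splice_seq n y y') {..<n + ?K})"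
  note adm = continuation_admissible[OF \<gamma>]
  have dis: "disintegrates (law \<nu> \<gamma> (Suc n)) (\<lambda>h. fst (h n)) borel ?H (obs n) q"
    using q by (simp add: is_predictor_iff[OF \<nu> \<gamma>])
  note qm = dis[unfolded disintegrates_def, THEN conjunct1]
  have qp: "q y \<in> priors" if "y \<in> space ?H" for y
    by (rule measurable_space[OF qm that])
  have disf: "disintegrates (law \<nu> \<gamma> (n + ?K)) (\<lambda>h. fst (h (n + k))) borel (seqs (n + ?K)) (obs (n + ?K)) \<pi>"
    using \<pi> by (simp add: is_filter_iff[OF \<nu> \<gamma>])
  note \<pi>m = disf[unfolded disintegrates_def, THEN conjunct1]
  have \<pi>j: "(\<lambda>w. ?\<pi> (fst w) (snd w)) \<in> ?H \<Otimes>\<^sub>M seqs ?K \<rightarrow>\<^sub>M prob_algebra borel"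
    using measurable_compose[OF measurable_join \<pi>m] by (simp add: case_prod_unfold)
  have obsK: "obs ?K \<in> ?S \<rightarrow>\<^sub>M (seqs ?K :: (nat \<Rightarrow> 'y) measure)"
    by (rule measurable_obs_seqs) simp
  have pair: "(\<lambda>(x, y'). (x, y')) \<in> borel \<Otimes>\<^sub>M (seqs ?K :: (nat \<Rightarrow> 'y) measure) \<rightarrow>\<^sub>M (borel :: ('x \<times> (nat \<Rightarrow> 'y)) measure)"
    unfolding borel_prod[symmetric] case_prod_unfold
    by (intro measurable_Pair measurable_fst measurable_compose[OF measurable_snd measurable_seqs_borel])
  have J: "(\<lambda>h. (fst (h k), obs ?K h)) \<in> seqs ?K \<rightarrow>\<^sub>M (borel :: ('x \<times> (nat \<Rightarrow> 'y)) measure)"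
    using measurable_compose[OF measurable_Pair[OF measurable_state[OF lessI] obsK] pair] by simp
  have Lm: "?L \<in> ?H \<rightarrow>\<^sub>M prob_algebra (seqs ?K)"
    by (rule measurable_law[OF qm measurable_policy_family_continuation[OF \<gamma>]])
  have \<pi>obs: "(\<lambda>w. ?\<pi> (fst w) (obs ?K (snd w))) \<in> ?H \<Otimes>\<^sub>M ?S \<rightarrow>\<^sub>M prob_algebra borel"
    using measurable_compose[OF measurable_Pair[OF measurable_fst measurable_compose[OF measurable_snd obsK]] \<pi>j]
    by simp
  \<comment> \<open>\<open>K2 y h\<close> keeps the measurements of \<open>h\<close> and draws the state from the original filter.\<close>
  define K2 where "K2 y h = distr (?\<pi> y (obs ?K h)) borel (\<lambda>x. (x, obs ?K h))" for y and h :: "nat \<Rightarrow> 'x \<times> 'y"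
  define \<kappa>1 where "\<kappa>1 y = distr (?L y) borel (\<lambda>h. (fst (h k), obs ?K h))" for y
  define \<kappa>2 where "\<kappa>2 y = ?L y \<bind> K2 y" for y
  have emb: "(\<lambda>(w, x). (x, obs ?K (snd w))) \<in> (?H \<Otimes>\<^sub>M ?S) \<Otimes>\<^sub>M borel \<rightarrow>\<^sub>M (borel :: ('x \<times> (nat \<Rightarrow> 'y)) measure)"
    using measurable_compose[OF measurable_Pair[OF measurable_snd
        measurable_compose[OF measurable_compose[OF measurable_fst measurable_snd] obsK]] pair]
    by (simp add: case_prod_unfold)
  have K2m: "(\<lambda>(y, h). K2 y h) \<in> ?H \<Otimes>\<^sub>M seqs ?K \<rightarrow>\<^sub>M prob_algebra borel"
    using measurable_distr_prob_space2[OF \<pi>obs emb] by (simp add: K2_def case_prod_unfold)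
  have \<kappa>1: "\<kappa>1 \<in> ?H \<rightarrow>\<^sub>M prob_algebra borel"
    unfolding \<kappa>1_def by (rule measurable_compose[OF Lm measurable_distr_prob_space[OF J]])
  have \<kappa>2: "\<kappa>2 \<in> ?H \<rightarrow>\<^sub>M prob_algebra borel"
    unfolding \<kappa>2_def by (rule measurable_bind_prob_space2[OF Lm K2m])
  have int1: "(\<integral>\<^sup>+z. F z \<partial>\<kappa>1 y) = (\<integral>\<^sup>+h. F (fst (h k), obs ?K h) \<partial>?L y)"
    if y: "y \<in> space ?H" and F: "F \<in> borel_measurable borel" for F y
    unfolding \<kappa>1_def
    by (rule nn_integral_distr) (use J F in \<open>simp_all add: measurable_cong_sets[OF sets_law[OF qp[OF y] adm] refl]\<close>)
  have int2: "(\<integral>\<^sup>+z. F z \<partial>\<kappa>2 y) = (\<integral>\<^sup>+h. \<integral>\<^sup>+x. F (x, obs ?K h) \<partial>?\<pi> y (obs ?K h) \<partial>?L y)"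
    if y: "y \<in> space ?H" and F: "F \<in> borel_measurable borel" for F y
  proof -
    have K2y: "K2 y \<in> ?L y \<rightarrow>\<^sub>M prob_algebra borel"
      unfolding measurable_cong_sets[OF sets_law[OF qp[OF y] adm] refl]
      using measurable_compose[OF measurable_Pair1'[OF y] K2m] by simp
    have "(\<integral>\<^sup>+z. F z \<partial>\<kappa>2 y) = (\<integral>\<^sup>+h. \<integral>\<^sup>+z. F z \<partial>K2 y h \<partial>?L y)"
      unfolding \<kappa>2_def
      by (rule prob_space.nn_integral_bind_prob[OF law_prob_space[OF qp[OF y] adm] F K2y])
    also have "\<dots> = (\<integral>\<^sup>+h. \<integral>\<^sup>+x. F (x, obs ?K h) \<partial>?\<pi> y (obs ?K h) \<partial>?L y)"
    proof (rule nn_integral_cong)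
      fix h assume "h \<in> space (?L y)"
      then have h: "h \<in> space (seqs ?K)" by (simp add: space_law[OF qp[OF y] adm])
      have w: "(y, h) \<in> space (?H \<Otimes>\<^sub>M seqs ?K)"
        using y h by (simp add: space_pair_measure)
      have "(\<lambda>x. (x, obs ?K h)) \<in> ?\<pi> y (obs ?K h) \<rightarrow>\<^sub>M borel"
        using measurable_compose[OF measurable_Pair1'[OF w] emb] kernel_space(2)[OF \<pi>obs w]
        by (simp cong: measurable_cong_sets)
      then show "(\<integral>\<^sup>+z. F z \<partial>K2 y h) = (\<integral>\<^sup>+x. F (x, obs ?K h) \<partial>?\<pi> y (obs ?K h))"
        unfolding K2_def using F by (intro nn_integral_distr) auto
    qed
    finally show ?thesis .
  qed
  have obsn: "obs n \<in> law \<nu> \<gamma> n \<rightarrow>\<^sub>M ?H"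
    by (simp add: measurable_cong_sets[OF sets_law[OF \<nu> \<gamma>] refl] measurable_obs_seqs)
  have "AE y in distr (law \<nu> \<gamma> n) ?H (obs n). \<kappa>1 y = \<kappa>2 y"
  proof (rule kernel_AE_unique)
    show "prob_space (distr (law \<nu> \<gamma> n) ?H (obs n))"
      by (rule prob_space.prob_space_distr[OF law_prob_space[OF \<nu> \<gamma>] obsn])
    fix A :: "('x \<times> (nat \<Rightarrow> 'y)) set" and C
    assume A: "A \<in> sets borel" and "C \<in> sets (distr (law \<nu> \<gamma> n) ?H (obs n))"
    then have C: "C \<in> sets ?H" by simp
    have Ai: "indicator A \<in> borel_measurable borel"
      using A by simp
    \<comment> \<open>\<open>F1\<close> and \<open>F2\<close> are the integrands that the Markov property turns into integrals over the
      original process.\<close>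
    define F1 where "F1 = (\<lambda>(y, h :: nat \<Rightarrow> 'x \<times> 'y). indicator A (fst (h k), obs ?K h) * indicator C y :: ennreal)"
    define F2 where "F2 = (\<lambda>(y, h :: nat \<Rightarrow> 'x \<times> 'y).
      (\<integral>\<^sup>+x. indicator A (x, obs ?K h) \<partial>?\<pi> y (obs ?K h)) * indicator C y :: ennreal)"
    have Cy: "(\<lambda>w. indicator C (fst w) :: ennreal) \<in> borel_measurable (?H \<Otimes>\<^sub>M N)" for N :: "'z measure"
      by (rule measurable_compose[OF measurable_fst borel_measurable_indicator[OF C]])
    have F1: "F1 \<in> borel_measurable (?H \<Otimes>\<^sub>M seqs ?K)"
      unfolding F1_def case_prod_unfold
      by (intro borel_measurable_times_ennreal Cy measurable_compose[OF measurable_compose[OF measurable_snd J] Ai])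
    have m2: "(\<lambda>w. \<integral>\<^sup>+x. indicator A (x, obs ?K (snd w)) \<partial>?\<pi> (fst w) (obs ?K (snd w))) \<in> borel_measurable (?H \<Otimes>\<^sub>M ?S)"
      by (rule nn_integral_kernel_measurable[OF _ \<pi>obs])
         (use measurable_compose[OF emb Ai] in \<open>simp add: case_prod_unfold\<close>)
    then have F2: "F2 \<in> borel_measurable (?H \<Otimes>\<^sub>M seqs ?K)"
      unfolding F2_def case_prod_unfold by (intro borel_measurable_times_ennreal Cy)
    have kap: "(\<lambda>y. emeasure (\<kappa>1 y) A) \<in> borel_measurable ?H" "(\<lambda>y. emeasure (\<kappa>2 y) A) \<in> borel_measurable ?H"
      by (rule measurable_emeasure_kernel[OF measurable_prob_algebraD A], fact)+
    have pull: "(\<integral>\<^sup>+y. emeasure (\<zeta> y) A * indicator C y \<partial>distr (law \<nu> \<gamma> n) ?H (obs n)) =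
        (\<integral>\<^sup>+h. F (obs n h, future n ?K h) \<partial>law \<nu> \<gamma> (n + ?K))"
      if \<zeta>: "(\<lambda>y. emeasure (\<zeta> y) A) \<in> borel_measurable ?H" and F: "F \<in> borel_measurable (?H \<Otimes>\<^sub>M seqs ?K)"
        and eq: "\<And>y. y \<in> space ?H \<Longrightarrow> emeasure (\<zeta> y) A * indicator C y = (\<integral>\<^sup>+h. F (y, h) \<partial>?L y)"
      for F :: "_ \<Rightarrow> ennreal" and \<zeta> :: "_ \<Rightarrow> ('x \<times> (nat \<Rightarrow> 'y)) measure"
    proof -
      have "(\<lambda>y. emeasure (\<zeta> y) A * indicator C y) \<in> borel_measurable ?H"
        by (intro borel_measurable_times_ennreal \<zeta> borel_measurable_indicator C)
      then have "(\<integral>\<^sup>+y. emeasure (\<zeta> y) A * indicator C y \<partial>distr (law \<nu> \<gamma> n) ?H (obs n)) =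
          (\<integral>\<^sup>+h. emeasure (\<zeta> (obs n h)) A * indicator C (obs n h) \<partial>law \<nu> \<gamma> n)"
        by (intro nn_integral_distr[OF obsn]) simp
      also have "\<dots> = (\<integral>\<^sup>+h. \<integral>\<^sup>+h'. F (obs n h, h') \<partial>?L (obs n h) \<partial>law \<nu> \<gamma> n)"
        by (rule nn_integral_cong, rule eq, rule measurable_space[OF obsn])
      also have "\<dots> = (\<integral>\<^sup>+h. F (obs n h, future n ?K h) \<partial>law \<nu> \<gamma> (n + ?K))"
        by (rule markov_property[OF \<nu> \<gamma> q F n, symmetric])
      finally show ?thesis .
    qed
    have p1: "(\<integral>\<^sup>+y. emeasure (\<kappa>1 y) A * indicator C y \<partial>distr (law \<nu> \<gamma> n) ?H (obs n)) =
        (\<integral>\<^sup>+h. F1 (obs n h, future n ?K h) \<partial>law \<nu> \<gamma> (n + ?K))"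
    proof (rule pull[OF kap(1) F1])
      fix y assume y: "y \<in> space ?H"
      have "(\<lambda>h. indicator A (fst (h k), obs ?K h) :: ennreal) \<in> borel_measurable (?L y)"
        using measurable_compose[OF J Ai] by (simp add: measurable_cong_sets[OF sets_law[OF qp[OF y] adm] refl])
      then show "emeasure (\<kappa>1 y) A * indicator C y = (\<integral>\<^sup>+h. F1 (y, h) \<partial>?L y)"
        using int1[OF y Ai] kernel_space(2)[OF \<kappa>1 y] A by (simp add: F1_def nn_integral_multc)
    qed
    have p2: "(\<integral>\<^sup>+y. emeasure (\<kappa>2 y) A * indicator C y \<partial>distr (law \<nu> \<gamma> n) ?H (obs n)) =
        (\<integral>\<^sup>+h. F2 (obs n h, future n ?K h) \<partial>law \<nu> \<gamma> (n + ?K))"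
    proof (rule pull[OF kap(2) F2])
      fix y assume y: "y \<in> space ?H"
      have "(\<lambda>h. \<integral>\<^sup>+x. indicator A (x, obs ?K h) \<partial>?\<pi> y (obs ?K h)) \<in> borel_measurable (?L y)"
        using measurable_compose[OF measurable_Pair1'[OF y] m2]
        by (simp add: measurable_cong_sets[OF sets_law[OF qp[OF y] adm] refl])
      then show "emeasure (\<kappa>2 y) A * indicator C y = (\<integral>\<^sup>+h. F2 (y, h) \<partial>?L y)"
        using int2[OF y Ai] kernel_space(2)[OF \<kappa>2 y] A by (simp add: F2_def nn_integral_multc)
    qed
    \<comment> \<open>The same event, as a test function for the filter at time \<open>n + k\<close>.\<close>
    define F where "F = (\<lambda>(y, x :: 'x). indicator A (x, future n ?K y) * indicator C (restrict y {..<n}) :: ennreal)"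
    have "F \<in> borel_measurable (seqs (n + ?K) \<Otimes>\<^sub>M borel)"
      unfolding F_def case_prod_unfold
    proof (intro borel_measurable_times_ennreal)
      show "(\<lambda>w. indicator A (snd w, future n ?K (fst w)) :: ennreal) \<in> borel_measurable (seqs (n + ?K) \<Otimes>\<^sub>M borel)"
        using measurable_compose[OF measurable_compose[OF measurable_Pair[OF measurable_snd
          measurable_compose[OF measurable_fst measurable_future[OF order.refl]]] pair] Ai] by simp
      have "(\<lambda>y. restrict y {..<n}) \<in> seqs (n + ?K) \<rightarrow>\<^sub>M ?H"
        by (rule measurable_restrict_subset) auto
      then show "(\<lambda>w. indicator C (restrict (fst w) {..<n}) :: ennreal) \<in> borel_measurable (seqs (n + ?K) \<Otimes>\<^sub>M borel)"
        by (rule measurable_compose[OF measurable_compose[OF measurable_fst] borel_measurable_indicator[OF C]])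
    qed
    note D = disintegratesD[OF disf this]
    have r: "restrict (obs (n + ?K) h) {..<n} = obs n h" for h :: "nat \<Rightarrow> 'x \<times> 'y"
      by (auto simp: obs_def fun_eq_iff)
    have s: "future n ?K h k = h (n + k)" for h :: "nat \<Rightarrow> 'x \<times> 'y"
      by (simp add: future_def)
    have "F1 (obs n h, future n ?K h) = F (obs (n + ?K) h, fst (h (n + k)))" for h
      by (simp only: F1_def F_def prod.case obs_future r s)
    moreover have "F2 (obs n h, future n ?K h) = (\<integral>\<^sup>+x. F (obs (n + ?K) h, x) \<partial>\<pi> (obs (n + ?K) h))" for h
      unfolding F2_def F_def prod.case join_obs unfolding obs_future r by (cases "obs n h \<in> C") simp_all
    ultimately have "(\<integral>\<^sup>+h. F1 (obs n h, future n ?K h) \<partial>law \<nu> \<gamma> (n + ?K)) = (\<integral>\<^sup>+h. F2 (obs n h, future n ?K h) \<partial>law \<nu> \<gamma> (n + ?K))"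
      using D by (simp only:)
    then show "(\<integral>\<^sup>+y. emeasure (\<kappa>1 y) A * indicator C y \<partial>distr (law \<nu> \<gamma> n) ?H (obs n)) =
        (\<integral>\<^sup>+y. emeasure (\<kappa>2 y) A * indicator C y \<partial>distr (law \<nu> \<gamma> n) ?H (obs n))"
      unfolding p1 p2 .
  qed (simp_all add: \<kappa>1 \<kappa>2)
  from AE_distrD[OF obsn this] AE_space show ?thesis
  proof eventually_elim
    fix h assume eq: "\<kappa>1 (obs n h) = \<kappa>2 (obs n h)" and "h \<in> space (law \<nu> \<gamma> n)"
    then have y: "obs n h \<in> space ?H"
      by (intro measurable_space[OF obsn])
    have "(\<integral>\<^sup>+h'. F (obs ?K h', fst (h' k)) \<partial>?L (obs n h)) =
        (\<integral>\<^sup>+h'. \<integral>\<^sup>+x. F (obs ?K h', x) \<partial>?\<pi> (obs n h) (obs ?K h') \<partial>?L (obs n h))"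
      if F: "F \<in> borel_measurable (seqs ?K \<Otimes>\<^sub>M borel)" for F
    proof -
      \<comment> \<open>Restriction undoes the extension of a finite sequence to a point of the Polish space.\<close>
      define G where "G z = F (restrict (snd z) {..<?K}, fst z)" for z :: "'x \<times> (nat \<Rightarrow> 'y)"
      have "(\<lambda>y. restrict y {..<?K}) \<in> (borel :: (nat \<Rightarrow> 'y) measure) \<rightarrow>\<^sub>M seqs ?K"
        unfolding measurable_cong_sets[OF sets_PiM_equal_borel[symmetric] refl]
        by (rule measurable_restrict_subset) simp
      then have "(\<lambda>z :: 'x \<times> (nat \<Rightarrow> 'y). (restrict (snd z) {..<?K}, fst z)) \<in> borel \<Otimes>\<^sub>M borel \<rightarrow>\<^sub>M seqs ?K \<Otimes>\<^sub>M borel"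
        by (intro measurable_Pair measurable_fst measurable_compose[OF measurable_snd])
      then have G: "G \<in> borel_measurable borel"
        unfolding G_def[abs_def] borel_prod by (rule measurable_compose[OF _ F])
      have r: "restrict (obs ?K h') {..<?K} = obs ?K h'" for h' :: "nat \<Rightarrow> 'x \<times> 'y"
        by (simp add: obs_def)
      show ?thesis
        using int1[OF y G] int2[OF y G] eq by (simp add: G_def r)
    qed
    moreover have "?\<pi> (obs n h) \<in> seqs ?K \<rightarrow>\<^sub>M prob_algebra borel"
      using measurable_compose[OF measurable_Pair1'[OF y] \<pi>j] by simp
    ultimately show "is_filter T Q (q (obs n h)) (continuation \<gamma> n (obs n h)) k (?\<pi> (obs n h))"
      unfolding is_filter_iff[OF qp[OF y] adm] by (simp add: disintegrates_def)
  qed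
qed

lemma filter_feedback_continuation:
  assumes \<nu>: "\<nu> \<in> priors" and \<gamma>: "\<gamma> \<in> admissible" and q: "is_predictor T Q \<nu> \<gamma> n q" and n: "0 < n"
    and fb: "filter_feedback T Q \<Phi> \<nu> \<gamma>"
  shows "AE h in law \<nu> \<gamma> n. filter_feedback T Q \<Phi> (q (obs n h)) (continuation \<gamma> n (obs n h))"
proof -
  obtain \<pi> where \<pi>: "\<And>k. is_filter T Q \<nu> \<gamma> k (\<pi> k)" "\<And>y k. action \<gamma> y k = \<Phi> (\<pi> k (restrict y {..k}))"
    using fb by (auto simp: filter_feedback_def)
  have "AE h in law \<nu> \<gamma> n. \<forall>k. is_filter T Q (q (obs n h)) (continuation \<gamma> n (obs n h)) k
      (\<lambda>y'. \<pi> (n + k) (restrict (splice_seq n (obs n h) y') {..<n + Suc k}))"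
    unfolding AE_all_countable by (intro allI filter_continuation[OF \<nu> \<gamma> q n \<pi>(1)])
  then show ?thesis
  proof eventually_elim
    fix h :: "nat \<Rightarrow> 'x \<times> 'y"
    assume *: "\<forall>k. is_filter T Q (q (obs n h)) (continuation \<gamma> n (obs n h)) k
      (\<lambda>y'. \<pi> (n + k) (restrict (splice_seq n (obs n h) y') {..<n + Suc k}))"
    have "action (continuation \<gamma> n (obs n h)) y k =
        \<Phi> (\<pi> (n + k) (restrict (splice_seq n (obs n h) (restrict y {..k})) {..<n + Suc k}))" for y k
    proof -
      have "restrict (splice_seq n (obs n h) (restrict y {..k})) {..<n + Suc k} = restrict (splice_seq n (obs n h) y) {..n + k}"
        by (auto simp: splice_seq_def fun_eq_iff)
      then show ?thesis
        by (simp add: action_continuation \<pi>(2))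
    qed
    with * show "filter_feedback T Q \<Phi> (q (obs n h)) (continuation \<gamma> n (obs n h))"
      unfolding filter_feedback_def
      by (intro exI[of _ "\<lambda>k y'. \<pi> (n + k) (restrict (splice_seq n (obs n h) y') {..<n + Suc k})"]) blast
  qed
qed

section \<open>Average cost\<close>

text \<open>At \<open>N = 0\<close> this is \<open>0\<close>, as is the term with index \<open>0\<close> in the definition of the average cost.\<close>

definition mean_cost :: "('x \<times> 'u \<Rightarrow> real) \<Rightarrow> 'x measure \<Rightarrow> ('y, 'u) policy \<Rightarrow> nat \<Rightarrow> ennreal" where
  "mean_cost c \<rho> \<gamma> N = ennreal (1 / real N) * total_cost c \<rho> \<gamma> N"

context
  fixes c :: "'x \<times> 'u \<Rightarrow> real" and C :: real
  assumes c_meas: "c \<in> borel_measurable (borel \<Otimes>\<^sub>M borel)"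
    and c_nonneg: "\<And>z. 0 \<le> c z" and c_le: "\<And>z. c z \<le> C"
begin

lemma cost_bound_nonneg: "0 \<le> C"
  using c_nonneg c_le order_trans by blast

lemma measurable_path_cost_family:
  assumes \<gamma>: "measurable_policy_family N \<gamma>"
  shows "(\<lambda>(p, h). path_cost c (\<gamma> p) m h) \<in> borel_measurable (N \<Otimes>\<^sub>M seqs m)"
  unfolding path_cost_def case_prod_unfold
proof (rule borel_measurable_sum)
  fix i assume "i \<in> {..<m}"
  then have i: "i < m" by simp
  have a: "(\<lambda>(p, y). action (\<gamma> p) y i) \<in> N \<Otimes>\<^sub>M seqs (Suc i) \<rightarrow>\<^sub>M borel"
    using \<gamma> by (simp add: measurable_policy_family_def)
  have "(\<lambda>w. (fst w, obs (Suc i) (snd w))) \<in> N \<Otimes>\<^sub>M (seqs m :: (nat \<Rightarrow> 'x \<times> 'y) measure) \<rightarrow>\<^sub>M N \<Otimes>\<^sub>M seqs (Suc i)"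
    using i by (intro measurable_Pair measurable_fst measurable_compose[OF measurable_snd measurable_obs_seqs]) simp
  from measurable_compose[OF this a]
  have "(\<lambda>w. action (\<gamma> (fst w)) (obs (Suc i) (snd w)) i) \<in> N \<Otimes>\<^sub>M (seqs m :: (nat \<Rightarrow> 'x \<times> 'y) measure) \<rightarrow>\<^sub>M borel"
    by simp
  from measurable_compose[OF measurable_compose[OF measurable_Pair[OF
      measurable_compose[OF measurable_snd measurable_state[OF i]] this] c_meas] measurable_ennreal]
  show "(\<lambda>w. ennreal (c (fst (snd w i), action (\<gamma> (fst w)) (\<lambda>k. snd (snd w k)) i))) \<in> borel_measurable (N \<Otimes>\<^sub>M seqs m)"
    by (simp add: action_obs)
qed

lemma measurable_path_cost:
  assumes "\<gamma> \<in> admissible"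
  shows "path_cost c \<gamma> m \<in> borel_measurable (seqs m)"
  using measurable_compose[OF measurable_Pair1'[of "()" "count_space UNIV"]
      measurable_path_cost_family[OF measurable_policy_family_const[OF assms]]] by simp

lemma measurable_total_cost_family:
  assumes "\<rho> \<in> N \<rightarrow>\<^sub>M prob_algebra borel" and "measurable_policy_family N \<gamma>"
  shows "(\<lambda>p. total_cost c (\<rho> p) (\<gamma> p) m) \<in> borel_measurable N"
  unfolding total_cost_def
  by (rule nn_integral_kernel_measurable[OF measurable_path_cost_family[OF assms(2)] measurable_law[OF assms]])

lemma path_cost_le: "path_cost c \<gamma> m h \<le> ennreal (C * real m)"
proof -
  have "path_cost c \<gamma> m h \<le> (\<Sum>i<m. ennreal C)"
    unfolding path_cost_def by (intro sum_mono ennreal_leI c_le)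
  also have "\<dots> = ennreal (C * real m)"
    using cost_bound_nonneg by (simp add: ennreal_of_nat_eq_real_of_nat ennreal_mult' mult.commute)
  finally show ?thesis .
qed

lemma total_cost_le:
  assumes "\<rho> \<in> priors" "\<gamma> \<in> admissible"
  shows "total_cost c \<rho> \<gamma> m \<le> ennreal (C * real m)"
proof -
  have "total_cost c \<rho> \<gamma> m \<le> (\<integral>\<^sup>+h. ennreal (C * real m) \<partial>law \<rho> \<gamma> m)"
    unfolding total_cost_def by (intro nn_integral_mono path_cost_le)
  then show ?thesis
    by (simp add: prob_space.emeasure_space_1[OF law_prob_space[OF assms]])
qed

lemma mean_cost_le:
  assumes "\<rho> \<in> priors" "\<gamma> \<in> admissible"
  shows "mean_cost c \<rho> \<gamma> m \<le> ennreal C"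
proof -
  have "mean_cost c \<rho> \<gamma> m \<le> ennreal (1 / real m) * ennreal (C * real m)"
    unfolding mean_cost_def by (intro mult_left_mono total_cost_le assms) simp
  also have "\<dots> \<le> ennreal C"
    using cost_bound_nonneg by (cases "m = 0") (simp_all flip: ennreal_mult)
  finally show ?thesis .
qed

lemma total_cost_mixture:
  assumes \<rho>: "\<rho> \<in> priors" and \<gamma>: "\<gamma> \<in> admissible"
  shows "total_cost c \<rho> \<gamma> m = (\<integral>\<^sup>+x. total_cost c (return borel x) \<gamma> m \<partial>\<rho>)"
  unfolding total_cost_def by (rule nn_integral_law_mixture[OF \<rho> \<gamma> measurable_path_cost[OF \<gamma>]])

lemma total_cost_le_tv_dist:
  assumes \<rho>: "\<rho> \<in> priors" and \<rho>': "\<rho>' \<in> priors" and \<gamma>: "\<gamma> \<in> admissible"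
  shows "total_cost c \<rho> \<gamma> m \<le> total_cost c \<rho>' \<gamma> m + ennreal (C * real m * tv_dist \<rho> \<rho>')"
proof -
  have "(\<lambda>x. total_cost c (return borel x) \<gamma> m) \<in> borel_measurable borel"
    by (rule measurable_total_cost_family[OF measurable_return_prob_space measurable_policy_family_const[OF \<gamma>]])
  then have "(\<integral>\<^sup>+x. total_cost c (return borel x) \<gamma> m \<partial>\<rho>) \<le>
      (\<integral>\<^sup>+x. total_cost c (return borel x) \<gamma> m \<partial>\<rho>') + ennreal (C * real m * tv_dist \<rho> \<rho>')"
    by (rule nn_integral_le_tv_dist[OF \<rho> \<rho>' _ total_cost_le[OF dirac_prior \<gamma>]]) (simp add: cost_bound_nonneg)
  then show ?thesis
    by (simp only: total_cost_mixture[OF \<rho> \<gamma>] total_cost_mixture[OF \<rho>' \<gamma>])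
qed

lemma avg_cost_eq:
  assumes \<rho>: "\<rho> \<in> priors" and \<gamma>: "\<gamma> \<in> admissible"
  shows "avg_cost T Q c \<rho> \<gamma> = enn2ereal (limsup (mean_cost c \<rho> \<gamma>))"
proof -
  let ?S = "strategic_measure T Q \<rho> \<gamma>"
  interpret S: prob_space ?S
    by (rule prob_space_strategic_measure[OF T Q \<rho> \<gamma>])
  have "ereal (1 / real N * (\<integral>\<omega>. (\<Sum>i<N. c (fst (\<omega> i), action \<gamma> (\<lambda>k. snd (\<omega> k)) i)) \<partial>?S)) =
      enn2ereal (mean_cost c \<rho> \<gamma> N)" for N
  proof -
    let ?f = "\<lambda>\<omega>. \<Sum>i<N. c (fst (\<omega> i), action \<gamma> (\<lambda>k. snd (\<omega> k)) i)"
    have f0: "0 \<le> ?f \<omega>" for \<omega>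
      by (intro sum_nonneg c_nonneg)
    have f1: "?f \<omega> \<le> C * real N" for \<omega>
      using sum_bounded_above[of "{..<N}" "\<lambda>i. c (fst (\<omega> i), action \<gamma> (\<lambda>k. snd (\<omega> k)) i)" C]
      by (simp add: c_le mult.commute)
    have m: "?f \<in> borel_measurable ?S"
      by (intro borel_measurable_sum measurable_compose[OF _ c_meas] measurable_Pair
          measurable_action[OF \<gamma>] measurable_compose[OF measurable_coordinate[OF \<rho> \<gamma>] measurable_fst_snd_borel(1)]
          measurable_compose[OF measurable_coordinate[OF \<rho> \<gamma>] measurable_fst_snd_borel(2)])
    have "path_cost c \<gamma> N (restrict \<omega> {..<N}) = ennreal (?f \<omega>)" for \<omega>
    proof -
      have "action \<gamma> (\<lambda>k. snd (restrict \<omega> {..<N} k)) i = action \<gamma> (\<lambda>k. snd (\<omega> k)) i" if "i < N" for i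
        by (rule action_cong) (use that in auto)
      then show ?thesis
        unfolding path_cost_def by (subst sum_ennreal[symmetric]) (auto simp: c_nonneg)
    qed
    then have "total_cost c \<rho> \<gamma> N = (\<integral>\<^sup>+\<omega>. ennreal (?f \<omega>) \<partial>?S)"
      unfolding total_cost_def by (subst nn_integral_law[OF \<rho> \<gamma> measurable_path_cost[OF \<gamma>]]) simp
    also have "\<dots> = ennreal (\<integral>\<omega>. ?f \<omega> \<partial>?S)"
      by (rule nn_integral_eq_integral, rule S.integrable_const_bound[where B = "C * real N"])
         (use m f0 f1 in \<open>auto intro!: AE_I2\<close>)
    finally have "mean_cost c \<rho> \<gamma> N = ennreal (1 / real N * (\<integral>\<omega>. ?f \<omega> \<partial>?S))"
      by (subst ennreal_mult') (simp_all add: mean_cost_def)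
    then show ?thesis
      using f0 by (simp add: enn2ereal_ennreal)
  qed
  then have "avg_cost T Q c \<rho> \<gamma> = limsup (\<lambda>N. enn2ereal (mean_cost c \<rho> \<gamma> N))"
    by (simp add: avg_cost_def)
  also have "\<dots> = enn2ereal (limsup (mean_cost c \<rho> \<gamma>))"
    by (rule Limsup_compose_continuous_mono[OF continuous_on_enn2ereal])
       (auto simp: mono_def less_eq_ennreal.rep_eq)
  finally show ?thesis .
qed

lemma path_cost_split:
  "path_cost c \<gamma> (n + m) h = path_cost c \<gamma> n h + path_cost c (continuation \<gamma> n (obs n h)) m (future n m h)"
proof -
  have "(\<Sum>i<n + m. f i) = (\<Sum>i<n. f i) + (\<Sum>i<m. f (n + i))" for f :: "nat \<Rightarrow> ennreal"
    by (induction m) (auto simp: add.assoc)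
  then show ?thesis
    unfolding path_cost_def action_continuation
    by (simp add: splice_seq_future_action) (simp add: future_def)
qed

text \<open>The cost of \<open>m\<close> steps is at most that of \<open>n + m\<close> steps, of which the first \<open>n\<close> cost at most \<open>C\<close> each and
  the others are governed by the Markov property.\<close>

lemma total_cost_restart:
  assumes \<rho>: "\<rho> \<in> priors" and \<gamma>: "\<gamma> \<in> admissible" and p: "is_predictor T Q \<rho> \<gamma> n p" and n: "0 < n"
  shows "total_cost c \<rho> \<gamma> m \<le> ennreal (C * real n) +
    (\<integral>\<^sup>+h. total_cost c (p (obs n h)) (continuation \<gamma> n (obs n h)) m \<partial>law \<rho> \<gamma> n)"
proof -
  define F where "F = (\<lambda>(y, h). path_cost c (continuation \<gamma> n y) m h)"
  have F: "F \<in> borel_measurable (seqs n \<Otimes>\<^sub>M seqs m)"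
    unfolding F_def by (rule measurable_path_cost_family[OF measurable_policy_family_continuation[OF \<gamma>]])
  have Fs: "(\<lambda>h. F (obs n h, future n m h)) \<in> borel_measurable (law \<rho> \<gamma> (n + m))"
    unfolding measurable_cong_sets[OF sets_law[OF \<rho> \<gamma>] refl]
    by (intro measurable_compose[OF _ F] measurable_Pair measurable_obs_seqs measurable_future) auto
  have "path_cost c \<gamma> m (restrict h {..<m}) = path_cost c \<gamma> m h" for h
  proof -
    have "action \<gamma> (\<lambda>k. snd (restrict h {..<m} k)) i = action \<gamma> (\<lambda>k. snd (h k)) i" if "i < m" for i
      by (rule action_cong) (use that in auto)
    then show ?thesis
      unfolding path_cost_def by (auto intro!: sum.cong)
  qed
  then have "total_cost c \<rho> \<gamma> m = (\<integral>\<^sup>+h. path_cost c \<gamma> m h \<partial>law \<rho> \<gamma> (n + m))"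
    using nn_integral_law_marginal[OF \<rho> \<gamma> _ measurable_path_cost[OF \<gamma>], of m "n + m"]
    by (simp add: total_cost_def)
  also have "\<dots> \<le> (\<integral>\<^sup>+h. path_cost c \<gamma> (n + m) h \<partial>law \<rho> \<gamma> (n + m))"
    unfolding path_cost_def by (intro nn_integral_mono sum_mono2) auto
  also have "\<dots> \<le> (\<integral>\<^sup>+h. ennreal (C * real n) + F (obs n h, future n m h) \<partial>law \<rho> \<gamma> (n + m))"
    unfolding path_cost_split F_def by (intro nn_integral_mono) (simp add: add_right_mono path_cost_le)
  also have "\<dots> = ennreal (C * real n) + (\<integral>\<^sup>+h. F (obs n h, future n m h) \<partial>law \<rho> \<gamma> (n + m))"
    using Fs by (simp add: nn_integral_add prob_space.emeasure_space_1[OF law_prob_space[OF \<rho> \<gamma>]])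
  also have "(\<integral>\<^sup>+h. F (obs n h, future n m h) \<partial>law \<rho> \<gamma> (n + m)) =
      (\<integral>\<^sup>+h. total_cost c (p (obs n h)) (continuation \<gamma> n (obs n h)) m \<partial>law \<rho> \<gamma> n)"
    unfolding markov_property[OF \<rho> \<gamma> p F n] by (simp add: total_cost_def F_def)
  finally show ?thesis .
qed

text \<open>The total variation distance of two kernels is not known to be a measurable function of \<open>y\<close>, so the
  integral of a sum that contains it cannot be split. The proof therefore integrates the
  measurable function \<open>g\<close>, which is the positive part of the excess of the mean cost under \<open>p(y)\<close>
  over that under \<open>q(y)\<close>, divided by \<open>C\<close>, and uses only that the distance dominates \<open>g\<close>.\<close>

lemma mean_cost_restart_le_tv_dist:
  assumes \<mu>: "\<mu> \<in> priors" and \<gamma>: "\<gamma> \<in> admissible" and p: "is_predictor T Q \<mu> \<gamma> n p"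
    and q: "q \<in> seqs n \<rightarrow>\<^sub>M prob_algebra borel" and n: "0 < n" and N: "0 < N" and C0: "0 < C"
  shows "mean_cost c \<mu> \<gamma> N \<le> ennreal (C * real n / real N) +
    ennreal C * (\<integral>\<^sup>+\<omega>. ennreal (tv_dist (p (obs n \<omega>)) (q (obs n \<omega>))) \<partial>strategic_measure T Q \<mu> \<gamma>) +
    (\<integral>\<^sup>+h. mean_cost c (q (obs n h)) (continuation \<gamma> n (obs n h)) N \<partial>law \<mu> \<gamma> n)"
proof -
  let ?cont = "continuation \<gamma> n"
  let ?D = "\<integral>\<^sup>+\<omega>. ennreal (tv_dist (p (obs n \<omega>)) (q (obs n \<omega>))) \<partial>strategic_measure T Q \<mu> \<gamma>"
  note adm = continuation_admissible[OF \<gamma>]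
  have pm: "p \<in> seqs n \<rightarrow>\<^sub>M prob_algebra borel"
    using p by (simp add: is_predictor_iff[OF \<mu> \<gamma>] disintegrates_def)
  define Vp where "Vp y = mean_cost c (p y) (?cont y) N" for y
  define Vq where "Vq y = mean_cost c (q y) (?cont y) N" for y
  have tm: "(\<lambda>y. total_cost c (r y) (?cont y) N) \<in> borel_measurable (seqs n)"
    if "r \<in> seqs n \<rightarrow>\<^sub>M prob_algebra borel" for r
    by (rule measurable_total_cost_family[OF that measurable_policy_family_continuation[OF \<gamma>]])
  have Vm [measurable]: "Vp \<in> borel_measurable (seqs n)" "Vq \<in> borel_measurable (seqs n)"
    unfolding Vp_def Vq_def mean_cost_def by (intro borel_measurable_times_ennreal borel_measurable_const tm pm q)+
  have obsn: "obs n \<in> law \<mu> \<gamma> n \<rightarrow>\<^sub>M seqs n"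
    by (simp add: measurable_cong_sets[OF sets_law[OF \<mu> \<gamma>] refl] measurable_obs_seqs)
  define g where "g y = ennreal (1 / C) * (Vp y - Vq y)" for y
  have g [measurable]: "g \<in> borel_measurable (seqs n)"
    unfolding g_def by measurable
  have g_tv: "g y \<le> ennreal (tv_dist (p y) (q y))" if y: "y \<in> space (seqs n)" for y
  proof -
    have py: "p y \<in> priors" "q y \<in> priors"
      using measurable_space[OF pm y] measurable_space[OF q y] by auto
    have "Vp y \<le> ennreal (1 / real N) * (total_cost c (q y) (?cont y) N + ennreal (C * real N * tv_dist (p y) (q y)))"
      unfolding Vp_def mean_cost_def by (intro mult_left_mono total_cost_le_tv_dist py adm) simp
    also have "\<dots> = Vq y + ennreal (C * tv_dist (p y) (q y))"
      using N C0 by (simp add: Vq_def mean_cost_def distrib_left flip: ennreal_mult')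
    finally have "Vp y - Vq y \<le> ennreal (C * tv_dist (p y) (q y))"
      using le_less_trans[OF mean_cost_le[OF py(2) adm] ennreal_less_top]
      by (simp add: ennreal_minus_le_iff Vq_def less_top)
    then have "g y \<le> ennreal (1 / C) * ennreal (C * tv_dist (p y) (q y))"
      unfolding g_def by (intro mult_left_mono) auto
    also have "\<dots> = ennreal (tv_dist (p y) (q y))"
      using C0 by (simp flip: ennreal_mult')
    finally show ?thesis .
  qed
  have Vpq: "Vp y \<le> ennreal C * g y + Vq y" for y
  proof -
    have "ennreal C * g y = Vp y - Vq y"
      using C0 by (simp add: g_def mult.assoc[symmetric] flip: ennreal_mult)
    moreover have "Vp y \<le> Vq y + (Vp y - Vq y)"
      by (cases "Vq y \<le> Vp y") (auto simp: add_diff_inverse_ennreal intro: add_increasing2)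
    ultimately show ?thesis
      by (simp add: add.commute)
  qed
  have "mean_cost c \<mu> \<gamma> N \<le> ennreal (1 / real N) * (ennreal (C * real n) +
      (\<integral>\<^sup>+h. total_cost c (p (obs n h)) (?cont (obs n h)) N \<partial>law \<mu> \<gamma> n))"
    unfolding mean_cost_def by (intro mult_left_mono total_cost_restart \<mu> \<gamma> p n) simp
  also have "\<dots> = ennreal (C * real n / real N) + (\<integral>\<^sup>+h. Vp (obs n h) \<partial>law \<mu> \<gamma> n)"
    using measurable_compose[OF obsn tm[OF pm]] cost_bound_nonneg
    by (simp add: Vp_def mean_cost_def distrib_left nn_integral_cmult flip: ennreal_mult')
  also have "(\<integral>\<^sup>+h. Vp (obs n h) \<partial>law \<mu> \<gamma> n) \<le> (\<integral>\<^sup>+h. ennreal C * g (obs n h) + Vq (obs n h) \<partial>law \<mu> \<gamma> n)"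
    by (intro nn_integral_mono Vpq)
  also have "\<dots> = ennreal C * (\<integral>\<^sup>+h. g (obs n h) \<partial>law \<mu> \<gamma> n) + (\<integral>\<^sup>+h. Vq (obs n h) \<partial>law \<mu> \<gamma> n)"
    using measurable_compose[OF obsn g] measurable_compose[OF obsn Vm(2)]
    by (simp add: nn_integral_add nn_integral_cmult)
  also have "(\<integral>\<^sup>+h. g (obs n h) \<partial>law \<mu> \<gamma> n) = (\<integral>\<^sup>+\<omega>. g (obs n \<omega>) \<partial>strategic_measure T Q \<mu> \<gamma>)"
    using nn_integral_law[OF \<mu> \<gamma> measurable_compose[OF measurable_obs_seqs[OF order.refl] g]]
    by (simp add: obs_restrict)
  also have "\<dots> \<le> ?D"
    by (rule nn_integral_mono, rule g_tv, rule measurable_space[OF measurable_obs])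
       (auto intro: measurable_coordinate[OF \<mu> \<gamma>])
  finally show ?thesis
    by (simp add: Vq_def add.assoc add_left_mono add_right_mono mult_left_mono)
qed

text \<open>The horizon \<open>N\<close> tends to infinity for fixed \<open>n\<close>: the share \<open>C n / N\<close> of the first \<open>n\<close> steps
  disappears, the total variation term does not depend on \<open>N\<close>, and the reverse Fatou lemma applies to
  the rest because all mean costs are at most \<open>C\<close>.\<close>

theorem limsup_mean_cost_restart:
  assumes \<mu>: "\<mu> \<in> priors" and \<gamma>: "\<gamma> \<in> admissible" and p: "is_predictor T Q \<mu> \<gamma> n p"
    and q: "q \<in> seqs n \<rightarrow>\<^sub>M prob_algebra borel" and n: "0 < n" and C0: "0 < C"
    and s: "AE h in law \<mu> \<gamma> n. limsup (mean_cost c (q (obs n h)) (continuation \<gamma> n (obs n h))) \<le> s"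
  shows "limsup (mean_cost c \<mu> \<gamma>) \<le>
    ennreal C * (\<integral>\<^sup>+\<omega>. ennreal (tv_dist (p (obs n \<omega>)) (q (obs n \<omega>))) \<partial>strategic_measure T Q \<mu> \<gamma>) + s"
    (is "_ \<le> ?D + s")
proof (rule ennreal_le_epsilon)
  fix e :: real assume e: "0 < e"
  let ?w = "\<lambda>N h. mean_cost c (q (obs n h)) (continuation \<gamma> n (obs n h)) N"
  note adm = continuation_admissible[OF \<gamma>]
  have obsn: "obs n \<in> law \<mu> \<gamma> n \<rightarrow>\<^sub>M seqs n"
    by (simp add: measurable_cong_sets[OF sets_law[OF \<mu> \<gamma>] refl] measurable_obs_seqs)
  have w: "?w N \<in> borel_measurable (law \<mu> \<gamma> n)" for N
    unfolding mean_cost_def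
    by (intro borel_measurable_times_ennreal borel_measurable_const measurable_compose[OF obsn]
        measurable_total_cost_family[OF q measurable_policy_family_continuation[OF \<gamma>]])
  have "((\<lambda>N. C * real n / real N) \<longlongrightarrow> 0) sequentially"
    by (rule tendsto_divide_0[OF tendsto_const]) (simp add: filterlim_real_sequentially filterlim_at_top_imp_at_infinity)
  then have "eventually (\<lambda>N. C * real n / real N < e) sequentially"
    using e by (rule order_tendstoD)
  then have "eventually (\<lambda>N. mean_cost c \<mu> \<gamma> N \<le> (ennreal e + ?D) + (\<integral>\<^sup>+h. ?w N h \<partial>law \<mu> \<gamma> n)) sequentially"
    using eventually_gt_at_top[of 0]
  proof eventually_elim
    fix N :: nat assume *: "C * real n / real N < e" and N: "0 < N"
    show "mean_cost c \<mu> \<gamma> N \<le> (ennreal e + ?D) + (\<integral>\<^sup>+h. ?w N h \<partial>law \<mu> \<gamma> n)"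
      by (rule order_trans[OF mean_cost_restart_le_tv_dist[OF \<mu> \<gamma> p q n N C0]])
         (intro add_right_mono ennreal_leI, use * in simp)
  qed
  then have "limsup (mean_cost c \<mu> \<gamma>) \<le> limsup (\<lambda>N. (ennreal e + ?D) + (\<integral>\<^sup>+h. ?w N h \<partial>law \<mu> \<gamma> n))"
    by (rule Limsup_mono)
  also have "\<dots> = (ennreal e + ?D) + limsup (\<lambda>N. \<integral>\<^sup>+h. ?w N h \<partial>law \<mu> \<gamma> n)"
    by (rule Limsup_const_add) simp
  also have "limsup (\<lambda>N. \<integral>\<^sup>+h. ?w N h \<partial>law \<mu> \<gamma> n) \<le> (\<integral>\<^sup>+h. limsup (\<lambda>N. ?w N h) \<partial>law \<mu> \<gamma> n)"
  proof (rule nn_integral_limsup)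
    show "(\<integral>\<^sup>+h. ennreal C \<partial>law \<mu> \<gamma> n) < \<infinity>"
      by (simp add: prob_space.emeasure_space_1[OF law_prob_space[OF \<mu> \<gamma>]])
    show "AE h in law \<mu> \<gamma> n. ?w N h \<le> ennreal C" for N
      using measurable_space[OF q measurable_space[OF obsn]] by (intro AE_I2 mean_cost_le adm)
  qed (use w in auto)
  also have "\<dots> \<le> (\<integral>\<^sup>+h. s \<partial>law \<mu> \<gamma> n)"
    by (rule nn_integral_mono_AE[OF s])
  also have "\<dots> = s"
    by (simp add: prob_space.emeasure_space_1[OF law_prob_space[OF \<mu> \<gamma>]])
  finally show "limsup (mean_cost c \<mu> \<gamma>) \<le> ?D + s + ennreal e"
    by (simp add: add_left_mono add.commute add.left_commute)
qed

end

end


section \<open>The regret bound\<close>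

theorem theorem3p9:
  fixes T :: "'x::polish_space \<times> 'u::polish_space \<Rightarrow> 'x measure"
    and Q :: "'x \<Rightarrow> 'y::polish_space measure"
    and c :: "'x \<times> 'u \<Rightarrow> real"
    and \<mu> \<nu> :: "'x measure"
    and \<Phi> :: "'x measure \<Rightarrow> 'u"
    and \<gamma>opt :: "'x measure \<Rightarrow> ('y, 'u) policy"
  assumes sigma_compact: "\<exists>K :: nat \<Rightarrow> 'x set. (\<forall>n. compact (K n)) \<and> (\<Union>n. K n) = UNIV"
    and T: "T \<in> borel \<Otimes>\<^sub>M borel \<rightarrow>\<^sub>M prob_algebra borel"
    and Q: "Q \<in> borel \<rightarrow>\<^sub>M prob_algebra borel"
    and \<Phi>: "\<Phi> \<in> prob_algebra borel \<rightarrow>\<^sub>M borel"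
    and optimal: "\<And>\<rho>. \<rho> \<in> priors \<Longrightarrow>
      \<gamma>opt \<rho> \<in> admissible \<and> avg_cost T Q c \<rho> (\<gamma>opt \<rho>) = opt_cost T Q c \<rho> \<and>
      filter_feedback T Q \<Phi> \<rho> (\<gamma>opt \<rho>)"
    and \<mu>: "\<mu> \<in> priors" and \<nu>: "\<nu> \<in> priors"
    and ac: "absolutely_continuous \<nu> \<mu>"
    and c_meas: "c \<in> borel_measurable (borel \<Otimes>\<^sub>M borel)"
    and c_bounded: "bounded (range c)"
    and c_nonneg: "\<And>z. c z \<ge> 0"
    and stable: "predictor_universally_stable T Q \<mu>"
  shows "avg_cost T Q c \<mu> (\<gamma>opt \<nu>) - opt_cost T Q c \<mu> \<le> span_opt_cost T Q c"
proof -
  interpret pomdp T Q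
    by unfold_locales (fact T Q)+
  obtain B where B: "\<And>z. \<bar>c z\<bar> \<le> B"
    using c_bounded by (auto simp: bounded_iff)
  \<comment> \<open>A positive bound, so that one may divide by it.\<close>
  define C where "C = max B 1"
  have C: "0 < C" "c z \<le> C" for z
    using B[of z] by (auto simp: C_def)
  note c = c_meas c_nonneg C(2)
  define \<gamma> where "\<gamma> = \<gamma>opt \<nu>"
  define S where "S = (SUP \<rho>\<in>priors. opt_cost T Q c \<rho>)"
  have \<gamma>: "\<gamma> \<in> admissible" and fb: "filter_feedback T Q \<Phi> \<nu> \<gamma>"
    using optimal[OF \<nu>] by (auto simp: \<gamma>_def)
  have opt_S: "opt_cost T Q c \<rho> \<le> S" if "\<rho> \<in> priors" for \<rho>
    unfolding S_def using that by (rule SUP_upper)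
  obtain \<pi> where \<pi>: "\<And>n. is_filter T Q \<nu> \<gamma> n (\<pi> n)"
    using fb by (auto simp: filter_feedback_def)
  have "\<exists>q. is_predictor T Q \<nu> \<gamma> n q" if "1 \<le> n" for n
    using predictor_of_filter[OF \<nu> \<gamma> \<pi>[of "n - 1"]] that by auto
  then obtain q where q: "\<And>n. 1 \<le> n \<Longrightarrow> is_predictor T Q \<nu> \<gamma> n (q n)"
    by metis
  have "\<exists>p. is_predictor T Q \<mu> \<gamma> n p" if "1 \<le> n" for n
    using predictor_absolutely_continuous[OF \<mu> \<nu> \<gamma> ac q[OF that]] by blast
  then obtain p where p: "\<And>n. 1 \<le> n \<Longrightarrow> is_predictor T Q \<mu> \<gamma> n (p n)"
    by metis
  define D where "D n = (\<integral>\<^sup>+\<omega>. ennreal (tv_dist (p n (obs n \<omega>)) (q n (obs n \<omega>))) \<partial>strategic_measure T Q \<mu> \<gamma>)" for n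
  have "D \<longlonglongrightarrow> 0"
    using stable \<gamma> \<nu> ac p q unfolding predictor_universally_stable_def D_def[abs_def] obs_def by blast
  have bound: "limsup (mean_cost c \<mu> \<gamma>) \<le> ennreal C * D n + e2ennreal S" if n: "1 \<le> n" for n
    unfolding D_def
  proof (rule limsup_mean_cost_restart[OF c \<mu> \<gamma> p[OF n] _ _ C(1)])
    have "disintegrates (law \<nu> \<gamma> (Suc n)) (\<lambda>h. fst (h n)) borel (seqs n) (obs n) (q n)"
      using q[OF n] by (simp add: is_predictor_iff[OF \<nu> \<gamma>])
    then show qm: "q n \<in> seqs n \<rightarrow>\<^sub>M prob_algebra borel"
      by (simp add: disintegrates_def)
    show "0 < n" using n by simp
    have "AE h in law \<nu> \<gamma> n. limsup (mean_cost c (q n (obs n h)) (continuation \<gamma> n (obs n h))) \<le> e2ennreal S"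
      using filter_feedback_continuation[OF \<nu> \<gamma> q[OF n] \<open>0 < n\<close> fb] AE_space
    proof eventually_elim
      fix h :: "nat \<Rightarrow> 'x \<times> 'y"
      let ?\<rho> = "q n (obs n h)" and ?\<beta> = "continuation \<gamma> n (obs n h)"
      assume feedback: "filter_feedback T Q \<Phi> ?\<rho> ?\<beta>" and "h \<in> space (law \<nu> \<gamma> n)"
      then have \<rho>: "?\<rho> \<in> priors"
        using measurable_space[OF qm measurable_space[OF measurable_obs_seqs[OF order.refl]]]
        by (simp add: space_law[OF \<nu> \<gamma>])
      note opt = optimal[OF \<rho>]
      have "mean_cost c ?\<rho> ?\<beta> = mean_cost c ?\<rho> (\<gamma>opt ?\<rho>)"
        using filter_feedback_total_cost_unique[OF \<rho> continuation_admissible[OF \<gamma>] _ feedback, of "\<gamma>opt ?\<rho>" c] opt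
        by (simp add: mean_cost_def fun_eq_iff)
      then have "enn2ereal (limsup (mean_cost c ?\<rho> ?\<beta>)) \<le> S"
        using avg_cost_eq[OF c \<rho>, of "\<gamma>opt ?\<rho>"] opt opt_S[OF \<rho>] by simp
      then have "e2ennreal (enn2ereal (limsup (mean_cost c ?\<rho> ?\<beta>))) \<le> e2ennreal S"
        by (rule e2ennreal_mono)
      then show "limsup (mean_cost c ?\<rho> ?\<beta>) \<le> e2ennreal S"
        by simp
    qed
    then show "AE h in law \<mu> \<gamma> n. limsup (mean_cost c (q n (obs n h)) (continuation \<gamma> n (obs n h))) \<le> e2ennreal S"
      using law_absolutely_continuous[OF \<mu> \<nu> \<gamma> ac] \<mu> \<nu> \<gamma>
      by (intro absolutely_continuous_AE[of "law \<mu> \<gamma> n" "law \<nu> \<gamma> n"]) simp_all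
  qed
  have "(\<lambda>n. ennreal C * D n + e2ennreal S) \<longlonglongrightarrow> ennreal C * 0 + e2ennreal S"
    by (intro tendsto_add ennreal_tendsto_cmult \<open>D \<longlonglongrightarrow> 0\<close> tendsto_const) simp
  then have "limsup (mean_cost c \<mu> \<gamma>) \<le> e2ennreal S"
    using bound by (intro LIMSEQ_le_const) auto
  then have "avg_cost T Q c \<mu> \<gamma> \<le> enn2ereal (e2ennreal S)"
    unfolding avg_cost_eq[OF c \<mu> \<gamma>] by (simp only: less_eq_ennreal.rep_eq)
  also have "\<dots> = S"
  proof (rule enn2ereal_e2ennreal)
    have "0 \<le> opt_cost T Q c \<nu>"
      using optimal[OF \<nu>] avg_cost_eq[OF c \<nu> \<gamma>] enn2ereal_nonneg[of "limsup (mean_cost c \<nu> \<gamma>)"]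
      by (simp add: \<gamma>_def)
    then show "0 \<le> S"
      using opt_S[OF \<nu>] by (rule order_trans)
  qed
  finally have "avg_cost T Q c \<mu> \<gamma> \<le> S" .
  moreover have "(INF \<rho>\<in>priors. opt_cost T Q c \<rho>) \<le> opt_cost T Q c \<mu>"
    using \<mu> by (rule INF_lower)
  ultimately show ?thesis
    unfolding span_opt_cost_def S_def[symmetric] \<gamma>_def by (rule ereal_minus_mono)
qed

end
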